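(* Let $F$ be a perfect tract, $\Gamma$ an ordered abelian group, and $M$ a (strong) $F[\Gamma]$-matroid on a finite totally ordered set $E$. The enriched tropical linear space $\mathcal L_M$ corresponding to $M$ is equal to each of the following subsets of $F[\Gamma]^E$: (i) $\bigcup_{\emptyset\subseteq A\subseteq E}\mathcal L_{M/A}^\circ\times\{\infty\}^A$; (ii) $\mathcal C(M)^\perp$; (iii) $\{X\in F[\Gamma]^E : \theta(X)\in\mathcal V^*(M^{|X|})\}$; (iv) $\bigcap_{B\in\mathcal B(\underline M)}\operatorname{span}(\mathcal C^*_B(M))$.
   Context: Tracts. A tract $F=(F^\times,N_F)$ is a multiplicative abelian group $F^\times$ (identity $1$) together with a subset $N_F$ (the null set) of the group semiring $\mathbb N[F^\times]$ of finite formal sums such that: $0\in N_F$; $1\notin N_F$; there is a unique element $-1\in F^\times$ with $1+(-1)\in N_F$; and if $\sum a_i\in N_F$ then $\sum c a_i\in N_F$ for all $c\in F^\times$. We also write $F=F^\times\cup\{0\}$ with $0\cdot g=0$; zero terms of formal sums are dropped; $-a=(-1)a$. A homomorphism of tracts is a group homomorphism $F_1^\times\to F_2^\times$ whose induced map on formal sums sends $N_{F_1}$ into $N_{F_2}$. Every tract carries a fixed involution $a\mapsto\overline a$ (a tract homomorphism $F\to F$ squaring to the identity); on $F[\Gamma]$ (below) it is $\overline{(a,\gamma)}=(\overline a,\gamma)$. Tropical extension. $\Gamma$ is a (totally) ordered abelian group, written additively; $\infty$ is larger than every element of $\Gamma$ and absorbing. $F[\Gamma]$ is the tract with group $F^\times\times\Gamma$,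 zero element $\infty$, and null set consisting of the zero sum and all finite sums $\sum_{i\in I}(a_i,\gamma_i)$ with $\sum_{i\in I_{\min}}a_i\in N_F$, where $I_{\min}=\{i\in I:\gamma_i\le\gamma_j\ \forall j\in I\}$. Put $\theta(a,\gamma)=a$, $\theta(\infty)=0$, $|(a,\gamma)|=\gamma$, $|\infty|=\infty$; $\theta$ and $|\cdot|$ are applied to tuples coordinatewise, so $|X|\in(\Gamma\cup\{\infty\})^E$ for $X\in F[\Gamma]^E$. Matroids (over any tract, denoted $F$ here). For $0\le r\le|E|$, a (strong) Plücker vector of rank $r$ on $E$ is a nonzero function $P\colon\binom Er\to F$ with $\sum_{j\in J\setminus I}\operatorname{sign}(j;I,J)P(I+j)P(J-j)\in N_F$ for all $I\in\binom{E}{r-1}$, $J\in\binom{E}{r+1}$, where $\operatorname{sign}(j;I,J)=(-1)^\ell$, $\ell=\#\{j'\in J:j<j'\}+\#\{i\in I:j<i\}$. An $F$-matroid $M$ is an equivalence class of Plücker vectors under scaling by $F^\times$ (over a perfect tract weak and strong matroids coincide). Its underlying matroid $\underline M$ has bases $\mathcal B(\underline M)=\{B:P(B)\ne0\}$. The support of $X\in F^E$ is $\underline X=\{i:X_i\ne0\}$. For $\tau=\{i_0<\dots<i_r\}$ let $(C_\tau)_{i_s}=(-1)^sP(\tau-i_s)$, $0$ elsewhere; the circuits $\mathcal C(M)\subseteq F^E$ are the $F^\times$-multiples of the nonzero $C_\tau$. An $F$-matroid is determined by its set of circuits. $X\perp Y$ means $\sum_{i\in E} X_i\overline{Y_i}\in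 N_F$; $\mathcal X^\perp$ is the set of tuples orthogonal to all of $\mathcal X$. The dual $M^*$ has Plücker vector $P^*(I)=\operatorname{sign}(I,I^c)\overline{P(I^c)}$, with $\operatorname{sign}(I,I^c)$ the sign of the permutation listing $I$ then $I^c=E\setminus I$, each increasingly. Cocircuits: $\mathcal C^*(M)=\mathcal C(M^* )$; covectors: $\mathcal V^*(M)=\mathcal C(M)^\perp$; vectors: $\mathcal V(M)=\mathcal C^*(M)^\perp$. $F$ is perfect if $\mathcal V(M)^\perp=\mathcal V^*(M)$ for every $F$-matroid $M$. Contraction and coloops. For $X\in F^E$, $A\subseteq E$, $X\setminus A\in F^{E\setminus A}$ is the restriction. $\operatorname{MinSupp}(\mathcal X)$ is the set of nonzero elements of $\mathcal X$ of inclusion-minimal support. $M/A$ is the $F$-matroid on $E\setminus A$ with circuits $\operatorname{MinSupp}\{C\setminus A: C\in\mathcal C(M)\}$. For $A$ disjoint from the ground set of $M$, $M+_{co\ell}A$ is the $F$-matroid on $E\sqcup A$ with circuits $\mathcal C(M)\times\{(0,\dots,0)\in F^A\}$. Initial matroids. For $\mathbf u\in\Gamma^E$ and $M$ an $F[\Gamma]$-matroid with Plücker vector $P$ of rank $r$, $M^{\mathbf u}$ is the $F$-matroid with Plücker vector $P^{\mathbf u}(I)=\theta(P(I))$ if $|P(I)|-\sum_{i\in I}u_i\le|P(J)|-\sum_{j\in J}u_j$ for all $J\in\binom Er$, and $0$ otherwise. For $\mathbf u\in(\Gamma\cup\{\infty\})^E$ put $Z_{\mathbf u}=\{i:u_i=\infty\}$,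 $\mathbf u^\circ=\mathbf u\setminus Z_{\mathbf u}$, and $M^{\mathbf u}=(M/Z_{\mathbf u})^{\mathbf u^\circ}+_{co\ell}Z_{\mathbf u}$ (an $F$-matroid on $E$). Enriched tropical linear spaces. For a strong $F[\Gamma]$-matroid $M$ on $E$, $\mathcal L_M=\mathcal V^*(M)\subseteq F[\Gamma]^E$, and $\mathcal L_M^\circ=\{X\in\mathcal L_M: X_i\ne\infty\ \forall i\in E\}$. In (i), $\mathcal L_{M/A}^\circ\times\{\infty\}^A$ is the set of $X\in F[\Gamma]^E$ with $X_i=\infty$ for $i\in A$ and $X\setminus A\in\mathcal L_{M/A}^\circ$. Fundamental cocircuits and spans. For $B\in\mathcal B(\underline M)$ and $j\in B$ there is a unique cocircuit $D(j,B)\in\mathcal C^*(M)$ with $\underline{D(j,B)}\subseteq(E\setminus B)\cup\{j\}$ and $j$-th entry equal to the identity; $\mathcal C^*_B(M)=\{D(j,B):j\in B\}$. For a finite set $\mathcal X$ of $E$-tuples over a tract $T$ (here $T=F[\Gamma]$), $\operatorname{span}(\mathcal X)=\{Y\in T^E: \exists\,(\alpha_X)_{X\in\mathcal X}\in T^{\mathcal X}\text{ with } Y_k-\sum_{X\in\mathcal X}\alpha_XX_k\in N_T\ \forall k\in E\}$, where $Y_k-\sum\alpha_XX_k$ denotes the formal sum $Y_k+\sum(-1)\alpha_XX_k$. *)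

theory Defs
  imports
    Main
    "HOL-Library.Multiset"
    "HOL-Library.FuncSet"
    "HOL-Combinatorics.Permutations"
begin

section \<open>Tracts\<close>

text \<open>The carrier type of the class is the unit group \<open>F\<^sup>\<times>\<close>; the group semiring
  \<open>\<nat>[F\<^sup>\<times>]\<close> of finite formal sums is the type of finite multisets over it. The fixed
  involution of the tract is part of the structure.\<close>

class tract = comm_monoid_mult +
  fixes null :: "'a multiset set"
    and invol :: "'a \<Rightarrow> 'a"
  assumes mult_inverse_ex: "\<exists>b. a * b = 1"
    and null_zero: "{#} \<in> null"
    and null_one: "{#1#} \<notin> null"
    and null_neg_one: "\<exists>!e. {#1, e#} \<in> null"
    and null_scale: "S \<in> null \<Longrightarrow> {#c * a. a \<in># S#} \<in> null"
    and invol_one: "invol 1 = 1"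
    and invol_mult: "invol (a * b) = invol a * invol b"
    and invol_null: "S \<in> null \<Longrightarrow> image_mset invol S \<in> null"
    and invol_invol: "invol (invol a) = a"

definition neg_one :: "'a::tract" where
  "neg_one = (THE e. {#1, e#} \<in> null)"

datatype 'a with_zero = Zero | Unit (the_unit: 'a)

instantiation with_zero :: (comm_monoid_mult) "{comm_monoid_mult, mult_zero}"
begin

definition zero_with_zero :: "'a with_zero" where "0 = Zero"

definition one_with_zero :: "'a with_zero" where "1 = Unit 1"

fun times_with_zero :: "'a with_zero \<Rightarrow> 'a with_zero \<Rightarrow> 'a with_zero" where
  "Unit a * Unit b = Unit (a * b)"
| "Zero * y = Zero"
| "x * Zero = Zero"

instance
proof
  fix a b c :: "'a with_zero"
  show "a * b * c = a * (b * c)"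
    by (cases a; cases b; cases c) (simp_all add: mult.assoc)
  show "a * b = b * a"
    by (cases a; cases b) (simp_all add: mult.commute)
  show "1 * a = a"
    by (cases a) (simp_all add: one_with_zero_def)
  show "0 * a = 0"
    by (simp add: zero_with_zero_def)
  show "a * 0 = 0"
    by (cases a) (simp_all add: zero_with_zero_def)
qed

end

abbreviation bar :: "'a::tract with_zero \<Rightarrow> 'a with_zero" where
  "bar \<equiv> map_with_zero invol"

definition is_null :: "'a::tract with_zero multiset \<Rightarrow> bool" where
  "is_null S \<longleftrightarrow> image_mset the_unit (filter_mset (\<lambda>x. x \<noteq> 0) S) \<in> null"


section \<open>Tropical extensions\<close>

text \<open>The unit group \<open>F\<^sup>\<times> \<times> \<Gamma>\<close> of the tract \<open>F[\<Gamma>]\<close>; its elements with zero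
  (the zero being \<open>\<infinity>\<close>) form the type \<open>('a, 'g) trop_ext with_zero\<close>.\<close>

datatype ('a, 'g) trop_ext = Ext (angle: 'a) (valuation: 'g)

instantiation trop_ext :: (tract, linordered_ab_group_add) tract
begin

definition one_trop_ext :: "('a, 'b) trop_ext" where
  "1 = Ext 1 0"

definition times_trop_ext ::
  "('a, 'b) trop_ext \<Rightarrow> ('a, 'b) trop_ext \<Rightarrow> ('a, 'b) trop_ext" where
  "x * y = Ext (angle x * angle y) (valuation x + valuation y)"

definition null_trop_ext :: "('a, 'b) trop_ext multiset set" where
  "null = {S. S = {#} \<or>
     image_mset angle {#x \<in># S. \<forall>y\<in>#S. valuation x \<le> valuation y#} \<in> null}"

definition invol_trop_ext :: "('a, 'b) trop_ext \<Rightarrow> ('a, 'b) trop_ext" where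
  "invol x = Ext (invol (angle x)) (valuation x)"

instance
proof
  fix a b c :: "('a, 'b) trop_ext" and S :: "('a, 'b) trop_ext multiset"
  show "a * b * c = a * (b * c)"
    by (simp add: times_trop_ext_def mult.assoc add.assoc)
  show "a * b = b * a"
    by (simp add: times_trop_ext_def mult.commute add.commute)
  show "1 * a = a"
    by (simp add: times_trop_ext_def one_trop_ext_def)
  show "\<exists>b. a * b = 1"
  proof -
    obtain d where "angle a * d = 1"
      using mult_inverse_ex by blast
    then have "a * Ext d (- valuation a) = 1"
      by (simp add: times_trop_ext_def one_trop_ext_def)
    then show ?thesis by blast
  qed
  show "{#} \<in> (null :: ('a, 'b) trop_ext multiset set)"
    by (simp add: null_trop_ext_def)
  show "{#1#} \<notin> (null :: ('a, 'b) trop_ext multiset set)"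
    by (simp add: null_trop_ext_def one_trop_ext_def null_one)
  have single: "{#d#} \<notin> null" for d :: 'a
  proof
    assume d: "{#d#} \<in> null"
    obtain d' where d': "d * d' = 1" using mult_inverse_ex by blast
    show False using null_scale[OF d, of d'] d' null_one[where 'a='a] by (simp add: mult.commute)
  qed
  have pair: "{#1, x#} \<in> null \<longleftrightarrow> valuation x = 0 \<and> {#1, angle x#} \<in> null"
    for x :: "('a, 'b) trop_ext"
  proof (cases "valuation x" "0::'b" rule: linorder_cases)
    case less
    then show ?thesis using single by (auto simp: null_trop_ext_def one_trop_ext_def)
  next
    case equal
    then show ?thesis by (auto simp: null_trop_ext_def one_trop_ext_def)
  next
    case greater
    then show ?thesis using single by (auto simp: null_trop_ext_def one_trop_ext_def)
  qed
  show "\<exists>!e. {#1, e#} \<in> (null :: ('a, 'b) trop_ext multiset set)"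
  proof -
    obtain e :: 'a where e: "{#1, e#} \<in> null" and u: "\<And>e'. {#1, e'#} \<in> null \<Longrightarrow> e' = e"
      using null_neg_one by blast
    show ?thesis
    proof (rule ex1I[of _ "Ext e 0"])
      show "{#1, Ext e 0 :: ('a, 'b) trop_ext#} \<in> null" using e by (simp add: pair)
    next
      fix x :: "('a, 'b) trop_ext"
      assume "{#1, x#} \<in> null"
      then show "x = Ext e 0" using u by (cases x) (auto simp: pair)
    qed
  qed
  show "{#c * a. a \<in># S#} \<in> null" if S: "S \<in> null"
  proof (cases "S = {#}")
    case True
    then show ?thesis by (simp add: null_trop_ext_def)
  next
    case False
    then have "image_mset angle {#x \<in># S. \<forall>y\<in>#S. valuation x \<le> valuation y#} \<in> null"
      using S by (simp add: null_trop_ext_def)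
    from null_scale[OF this, of "angle c"] show ?thesis
      by (simp add: null_trop_ext_def times_trop_ext_def filter_mset_image_mset
          multiset.map_comp comp_def)
  qed
  show "invol 1 = (1 :: ('a, 'b) trop_ext)"
    by (simp add: invol_trop_ext_def one_trop_ext_def invol_one)
  show "invol (a * b) = invol a * invol b"
    by (simp add: invol_trop_ext_def times_trop_ext_def invol_mult)
  show "image_mset invol S \<in> null" if S: "S \<in> null"
  proof (cases "S = {#}")
    case True
    then show ?thesis by (simp add: null_trop_ext_def)
  next
    case False
    then have "image_mset angle {#x \<in># S. \<forall>y\<in>#S. valuation x \<le> valuation y#} \<in> null"
      using S by (simp add: null_trop_ext_def)
    from invol_null[OF this] show ?thesis
      by (simp add: null_trop_ext_def invol_trop_ext_def filter_mset_image_mset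
          multiset.map_comp comp_def)
  qed
  show "invol (invol a) = a"
    by (simp add: invol_trop_ext_def invol_invol)
qed

end

datatype 'g with_infty = Fin (the_fin: 'g) | Infty

instantiation with_infty :: (linorder) linorder
begin

fun less_eq_with_infty :: "'a with_infty \<Rightarrow> 'a with_infty \<Rightarrow> bool" where
  "Fin x \<le> Fin y \<longleftrightarrow> x \<le> y"
| "Infty \<le> Fin y \<longleftrightarrow> False"
| "x \<le> Infty \<longleftrightarrow> True"

definition less_with_infty :: "'a with_infty \<Rightarrow> 'a with_infty \<Rightarrow> bool" where
  "x < y \<longleftrightarrow> x \<le> y \<and> \<not> y \<le> (x :: 'a with_infty)"

instance
proof
  fix x y z :: "'a with_infty"
  show "x < y \<longleftrightarrow> x \<le> y \<and> \<not> y \<le> x" by (rule less_with_infty_def)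
  show "x \<le> x" by (cases x) simp_all
  show "x \<le> y \<Longrightarrow> y \<le> z \<Longrightarrow> x \<le> z" by (cases x; cases y; cases z) auto
  show "x \<le> y \<Longrightarrow> y \<le> x \<Longrightarrow> x = y" by (cases x; cases y) auto
  show "x \<le> y \<or> y \<le> x" by (cases x; cases y) auto
qed

end

definition theta :: "('a, 'g) trop_ext with_zero \<Rightarrow> 'a with_zero" where
  "theta = map_with_zero angle"

definition val :: "('a, 'g) trop_ext with_zero \<Rightarrow> 'g with_infty" where
  "val x = (case x of Zero \<Rightarrow> Infty | Unit y \<Rightarrow> Fin (valuation y))"


section \<open>Tuples\<close>

text \<open>Tuples indexed by \<open>E\<close> are functions that are \<open>undefined\<close> outside \<open>E\<close>.\<close>

abbreviation tuples :: "'e set \<Rightarrow> ('e \<Rightarrow> 'v) set" where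
  "tuples E \<equiv> E \<rightarrow>\<^sub>E UNIV"

definition supp :: "'e set \<Rightarrow> ('e \<Rightarrow> 'v::zero) \<Rightarrow> 'e set" where
  "supp E X = {i \<in> E. X i \<noteq> 0}"

definition min_supp :: "'e set \<Rightarrow> ('e \<Rightarrow> 'v::zero) set \<Rightarrow> ('e \<Rightarrow> 'v) set" where
  "min_supp E \<X> = {X \<in> \<X>. supp E X \<noteq> {} \<and>
     (\<forall>Y\<in>\<X>. supp E Y \<noteq> {} \<longrightarrow> \<not> supp E Y \<subset> supp E X)}"

definition orthogonal ::
  "'e set \<Rightarrow> ('e \<Rightarrow> 'a::tract with_zero) \<Rightarrow> ('e \<Rightarrow> 'a with_zero) \<Rightarrow> bool" where
  "orthogonal E X Y \<longleftrightarrow> is_null {#X i * bar (Y i). i \<in># mset_set E#}"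

definition perp ::
  "'e set \<Rightarrow> ('e \<Rightarrow> 'a::tract with_zero) set \<Rightarrow> ('e \<Rightarrow> 'a with_zero) set" where
  "perp E \<X> = {Y \<in> tuples E. \<forall>X\<in>\<X>. orthogonal E Y X}"

definition span ::
  "'e set \<Rightarrow> ('e \<Rightarrow> 'a::tract with_zero) set \<Rightarrow> ('e \<Rightarrow> 'a with_zero) set" where
  "span E \<X> = {Y \<in> tuples E. \<exists>\<alpha> :: ('e \<Rightarrow> 'a with_zero) \<Rightarrow> 'a with_zero. \<forall>k\<in>E.
     is_null (add_mset (Y k) {#Unit neg_one * \<alpha> X * X k. X \<in># mset_set \<X>#})}"


section \<open>Matroids over tracts\<close>

abbreviation subsets_of_card :: "'e set \<Rightarrow> nat \<Rightarrow> 'e set set" where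
  "subsets_of_card E r \<equiv> {I. I \<subseteq> E \<and> card I = r}"

definition plucker_sign :: "'e::linorder \<Rightarrow> 'e set \<Rightarrow> 'e set \<Rightarrow> 'a::tract with_zero" where
  "plucker_sign j I J = Unit (neg_one ^ (card {j' \<in> J. j < j'} + card {i \<in> I. j < i}))"

text \<open>Strong Pluecker vectors. The condition \<open>card I + 1 = r\<close> expresses \<open>card I = r - 1\<close>
  without truncation: for \<open>r = 0\<close> there is no such \<open>I\<close>.\<close>

definition plucker_vector ::
  "'e::linorder set \<Rightarrow> nat \<Rightarrow> ('e set \<Rightarrow> 'a::tract with_zero) \<Rightarrow> bool" where
  "plucker_vector E r P \<longleftrightarrow>
     P \<in> tuples (subsets_of_card E r) \<and>
     (\<exists>B \<in> subsets_of_card E r. P B \<noteq> 0) \<and>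
     (\<forall>I J. I \<subseteq> E \<and> card I + 1 = r \<and> J \<subseteq> E \<and> card J = r + 1 \<longrightarrow>
        is_null {#plucker_sign j I J * P (insert j I) * P (J - {j}). j \<in># mset_set (J - I)#})"

text \<open>An \<open>F\<close>-matroid: its ground set, its rank, and an equivalence class of Pluecker vectors.\<close>

datatype ('e, 'a) matroid =
  Matroid (ground: "'e set") (rank: nat) (pluckers: "('e set \<Rightarrow> 'a with_zero) set")

definition is_matroid :: "('e::linorder, 'a::tract) matroid \<Rightarrow> bool" where
  "is_matroid M \<longleftrightarrow> finite (ground M) \<and>
     (\<exists>P. plucker_vector (ground M) (rank M) P \<and>
        pluckers M =
          {\<lambda>I\<in>subsets_of_card (ground M) (rank M). Unit c * P I | c. True})"

definition bases :: "('e::linorder, 'a::tract) matroid \<Rightarrow> 'e set set" where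
  "bases M = {B \<in> subsets_of_card (ground M) (rank M). \<exists>P\<in>pluckers M. P B \<noteq> 0}"

definition circuit_vector ::
  "'e::linorder set \<Rightarrow> ('e set \<Rightarrow> 'a::tract with_zero) \<Rightarrow> 'e set \<Rightarrow> 'e \<Rightarrow> 'a with_zero" where
  "circuit_vector E P \<tau> =
     (\<lambda>i\<in>E. if i \<in> \<tau> then Unit (neg_one ^ card {j \<in> \<tau>. j < i}) * P (\<tau> - {i}) else 0)"

definition circuits :: "('e::linorder, 'a::tract) matroid \<Rightarrow> ('e \<Rightarrow> 'a with_zero) set" where
  "circuits M = {\<lambda>i\<in>ground M. Unit c * circuit_vector (ground M) P \<tau> i | c P \<tau>.
     P \<in> pluckers M \<and> \<tau> \<in> subsets_of_card (ground M) (rank M + 1) \<and>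
     supp (ground M) (circuit_vector (ground M) P \<tau>) \<noteq> {}}"

text \<open>The permutation of \<open>E\<close> sending its \<open>k\<close>-th smallest element to the \<open>k\<close>-th entry of the
  list consisting of \<open>I\<close> and then \<open>E - I\<close>, each in increasing order.\<close>

definition split_perm :: "'e::linorder set \<Rightarrow> 'e set \<Rightarrow> 'e \<Rightarrow> 'e" where
  "split_perm E I x =
     (if x \<in> E
      then (sorted_list_of_set I @ sorted_list_of_set (E - I)) ! card {y \<in> E. y < x}
      else x)"

definition split_sign :: "'e::linorder set \<Rightarrow> 'e set \<Rightarrow> 'a::tract with_zero" where
  "split_sign E I = Unit (if sign (split_perm E I) = 1 then 1 else neg_one)"

definition dual :: "('e::linorder, 'a::tract) matroid \<Rightarrow> ('e, 'a) matroid" where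
  "dual M = (let E = ground M; s = card E - rank M in
     Matroid E s ((\<lambda>P. \<lambda>I\<in>subsets_of_card E s. split_sign E I * bar (P (E - I))) ` pluckers M))"

definition cocircuits :: "('e::linorder, 'a::tract) matroid \<Rightarrow> ('e \<Rightarrow> 'a with_zero) set" where
  "cocircuits M = circuits (dual M)"

definition covectors :: "('e::linorder, 'a::tract) matroid \<Rightarrow> ('e \<Rightarrow> 'a with_zero) set" where
  "covectors M = perp (ground M) (circuits M)"

definition vectors :: "('e::linorder, 'a::tract) matroid \<Rightarrow> ('e \<Rightarrow> 'a with_zero) set" where
  "vectors M = perp (ground M) (cocircuits M)"

text \<open>Every finite totally ordered set is order isomorphic to a finite set of natural numbers,
  so it suffices to let the ground set range over the latter.\<close>

definition perfect :: "'a::tract itself \<Rightarrow> bool" where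
  "perfect _ \<longleftrightarrow> (\<forall>M :: (nat, 'a) matroid. is_matroid M \<longrightarrow>
     perp (ground M) (vectors M) = covectors M)"

definition contract :: "('e::linorder, 'a::tract) matroid \<Rightarrow> 'e set \<Rightarrow> ('e, 'a) matroid" where
  "contract M A = (THE N. is_matroid N \<and> ground N = ground M - A \<and>
     circuits N = min_supp (ground M - A) ((\<lambda>C. restrict C (ground M - A)) ` circuits M))"

definition add_coloops :: "('e::linorder, 'a::tract) matroid \<Rightarrow> 'e set \<Rightarrow> ('e, 'a) matroid" where
  "add_coloops M A = (THE N. is_matroid N \<and> ground N = ground M \<union> A \<and>
     circuits N = (\<lambda>C. \<lambda>i\<in>ground M \<union> A. if i \<in> A then 0 else C i) ` circuits M)"

definition fundamental_cocircuit ::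
  "('e::linorder, 'a::tract) matroid \<Rightarrow> 'e \<Rightarrow> 'e set \<Rightarrow> 'e \<Rightarrow> 'a with_zero" where
  "fundamental_cocircuit M j B =
     (THE D. D \<in> cocircuits M \<and> supp (ground M) D \<subseteq> (ground M - B) \<union> {j} \<and> D j = 1)"

definition fundamental_cocircuits ::
  "('e::linorder, 'a::tract) matroid \<Rightarrow> 'e set \<Rightarrow> ('e \<Rightarrow> 'a with_zero) set" where
  "fundamental_cocircuits M B = (\<lambda>j. fundamental_cocircuit M j B) ` B"


section \<open>Initial matroids and enriched tropical linear spaces\<close>

definition initial_plucker ::
  "'e set \<Rightarrow> nat \<Rightarrow> ('e \<Rightarrow> 'g) \<Rightarrow>
   ('e set \<Rightarrow> ('a::tract, 'g::linordered_ab_group_add) trop_ext with_zero) \<Rightarrow>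
   'e set \<Rightarrow> 'a with_zero" where
  "initial_plucker E r u P =
     (let w = (\<lambda>I. map_with_infty (\<lambda>g. g - (\<Sum>i\<in>I. u i)) (val (P I))) in
      (\<lambda>I\<in>subsets_of_card E r.
        if \<forall>J\<in>subsets_of_card E r. w I \<le> w J then theta (P I) else 0))"

text \<open>Rescaling \<open>P\<close> by a unit \<open>(a, \<gamma>)\<close> rescales \<open>initial_plucker E r u P\<close> by \<open>a\<close>, so the
  image below is again a full equivalence class.\<close>

definition initial_matroid_fin ::
  "('e::linorder, ('a::tract, 'g::linordered_ab_group_add) trop_ext) matroid \<Rightarrow>
   ('e \<Rightarrow> 'g) \<Rightarrow> ('e, 'a) matroid" where
  "initial_matroid_fin M u = Matroid (ground M) (rank M)
     (initial_plucker (ground M) (rank M) u ` pluckers M)"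

definition initial_matroid ::
  "('e::linorder, ('a::tract, 'g::linordered_ab_group_add) trop_ext) matroid \<Rightarrow>
   ('e \<Rightarrow> 'g with_infty) \<Rightarrow> ('e, 'a) matroid" where
  "initial_matroid M u = (let Z = {i \<in> ground M. u i = Infty} in
     add_coloops (initial_matroid_fin (contract M Z) (\<lambda>i\<in>ground M - Z. the_fin (u i))) Z)"

definition trop_linear_space ::
  "('e::linorder, ('a::tract, 'g::linordered_ab_group_add) trop_ext) matroid \<Rightarrow>
   ('e \<Rightarrow> ('a, 'g) trop_ext with_zero) set" where
  "trop_linear_space M = covectors M"

definition trop_linear_space_fin ::
  "('e::linorder, ('a::tract, 'g::linordered_ab_group_add) trop_ext) matroid \<Rightarrow>
   ('e \<Rightarrow> ('a, 'g) trop_ext with_zero) set" where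
  "trop_linear_space_fin M = {X \<in> trop_linear_space M. \<forall>i\<in>ground M. X i \<noteq> 0}"

end

theory Submission
  imports Defs
begin

text \<open>The proof rests on orthogonality of circuits and cocircuits, which is the Pluecker
  relation itself. By orthogonality, a vector whose support lies in a basis is zero, and a vector
  whose support lies in a basis plus one element is determined by its entry there; hence a matroid
  is determined by its circuits, the fundamental cocircuits are unique, and the circuits of a
  contraction are the vectors of minimal support.

  For (iv), the coefficients expressing \<open>X\<close> in the fundamental cocircuits of \<open>B\<close> are forced to be
  the entries of \<open>X\<close> on \<open>B\<close>, and the remaining conditions say that \<open>X\<close> is orthogonal to the
  fundamental circuits of \<open>B\<close>.

  For (i) and (iii), take leading terms. If \<open>Y\<close> has full support and \<open>u = |Y|\<close>, then all terms in the
  orthogonality relations weighted by \<open>u\<close> have comparable valuations: \<open>\<theta>(Y)\<close> is a covector of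
  \<open>M\<^sup>u\<close> if \<open>Y\<close> is one of \<open>M\<close>, and leading terms of vectors of \<open>M\<close> are vectors of \<open>M\<^sup>u\<close>. As
  \<open>F\<close> is perfect, \<open>\<theta>(Y)\<close> is orthogonal to all of the latter, so \<open>Y\<close> is orthogonal to every vector of
  \<open>M\<close>. This is applied to \<open>M/Z\<close> with \<open>Z\<close> the zero set of \<open>X\<close>: the restrictions of the circuits of
  \<open>M\<close> are vectors of \<open>M/Z\<close>, although in general not circuits.\<close>

section \<open>Null sums\<close>

text \<open>Perfection answers a mismatch of levels. For weights \<open>u\<close>, the circuit
  vector of the initial Pluecker vector at \<open>\<tau>\<close> is that of \<open>P\<close> cut at
  a level fixed by \<open>\<tau>\<close>, and it can be zero although the latter is not. The lowest
  terms of the pairing of \<open>Y\<close> with a circuit then sit at a higher level, where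
  \<open>\<theta>(Y)\<close> meets a vector of the initial matroid that is not given as one of its
  circuits, so being a covector says nothing about them directly. Full support of \<open>Y\<close>
  keeps a lowest term alive in the pairing of leading terms; this is why the zeros of
  \<open>X\<close> are contracted before leading terms are compared. Null sums cannot be subtracted
  from one another, so there is no elimination. The linear algebra rests on sums of one or two
  terms, where null means zero or an equation, and a basis is used to cut the supports down to that
  size.\<close>

lemma with_zero_mult_eq_zero_iff [simp]: "x * y = 0 \<longleftrightarrow> x = 0 \<or> y = 0" for x y :: "'a::comm_monoid_mult with_zero"
  by (cases x; cases y) (simp_all add: zero_with_zero_def)

lemma Unit_neq_zero [simp]: "Unit a \<noteq> 0" "0 \<noteq> Unit a"
  by (simp_all add: zero_with_zero_def)

lemma nonzero_cases:
  assumes "x \<noteq> 0" obtains a where "x = Unit a"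
  using assms by (cases x) (auto simp: zero_with_zero_def)

lemma with_zero_inverse:
  fixes x :: "'a::tract with_zero"
  assumes "x \<noteq> 0" obtains y where "y \<noteq> 0" "x * y = 1"
proof -
  from assms obtain a where a: "x = Unit a" by (rule nonzero_cases)
  obtain b where "a * b = 1" using mult_inverse_ex by blast
  then show ?thesis using a that[of "Unit b"] by (simp add: one_with_zero_def)
qed

lemma with_zero_mult_left_cancel [simp]:
  fixes c :: "'a::tract with_zero"
  assumes "c \<noteq> 0" shows "c * x = c * y \<longleftrightarrow> x = y"
proof -
  obtain d where "d * c = 1" using with_zero_inverse[OF assms] by (metis mult.commute)
  then have "d * (c * z) = z" for z by (simp flip: mult.assoc)
  then show ?thesis by metis
qed

lemma map_with_zero_zero [simp]: "map_with_zero f 0 = 0"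
  by (simp add: zero_with_zero_def)

lemma map_with_zero_eq_zero [simp]: "map_with_zero f x = 0 \<longleftrightarrow> x = 0"
  by (cases x) (simp_all add: zero_with_zero_def)

lemma bar_mult [simp]: "bar (x * y) = bar x * bar y"
  by (cases x; cases y) (simp_all add: invol_mult)

lemma bar_bar [simp]: "bar (bar x) = x"
  by (cases x) (simp_all add: invol_invol)

lemma bar_one [simp]: "bar 1 = 1"
  by (simp add: one_with_zero_def invol_one)

lemma is_null_scale:
  assumes "is_null S" shows "is_null (image_mset ((*) c) S)"
proof (cases c)
  case Zero
  have "filter_mset (\<lambda>x. x \<noteq> 0) (image_mset ((*) c) S) = {#}"
    using Zero by (induction S) (auto simp: zero_with_zero_def)
  then show ?thesis by (simp only: is_null_def image_mset_empty null_zero)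
next
  case (Unit a)
  have "image_mset the_unit (filter_mset (\<lambda>x. x \<noteq> 0) (image_mset ((*) c) S))
    = image_mset ((*) a) (image_mset the_unit (filter_mset (\<lambda>x. x \<noteq> 0) S))"
    by (induction S) (auto simp: Unit elim!: nonzero_cases)
  then show ?thesis using assms null_scale by (auto simp: is_null_def)
qed

lemma is_null_scale_iff:
  fixes c :: "'a::tract with_zero"
  assumes "c \<noteq> 0" shows "is_null (image_mset ((*) c) S) \<longleftrightarrow> is_null S"
proof -
  obtain d where "c * d = 1" using assms with_zero_inverse by blast
  then have "d * (c * x) = x" for x
    by (metis mult.assoc mult.commute mult.left_neutral)
  then have "image_mset ((*) d) (image_mset ((*) c) S) = S"
    by (simp add: multiset.map_comp comp_def)
  then show ?thesis using is_null_scale by metis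
qed

lemma is_null_bar:
  assumes "is_null S" shows "is_null (image_mset bar S)"
proof -
  have "image_mset the_unit (filter_mset (\<lambda>x. x \<noteq> 0) (image_mset bar S))
    = image_mset invol (image_mset the_unit (filter_mset (\<lambda>x. x \<noteq> 0) S))"
    by (induction S) (auto elim!: nonzero_cases)
  then show ?thesis using assms invol_null by (auto simp: is_null_def)
qed

lemma is_null_add_zero [simp]: "is_null (add_mset 0 S) \<longleftrightarrow> is_null S"
  by (simp add: is_null_def)

lemma is_null_empty [simp]: "is_null {#}"
  by (simp add: is_null_def null_zero)

lemma is_null_single [simp]: "is_null {#x#} \<longleftrightarrow> x = 0"
proof
  assume n: "is_null {#x#}"
  show "x = 0"
  proof (rule ccontr)
    assume "x \<noteq> 0"
    then obtain y where "x * y = 1" using with_zero_inverse by blast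
    then have "is_null {#1 :: 'a with_zero#}" using is_null_scale[OF n, of y] by (simp add: mult.commute)
    then show False by (simp add: is_null_def one_with_zero_def null_one)
  qed
qed auto

section \<open>The element -1 and two-term null sums\<close>

lemma null_neg_one_iff: "{#1, e#} \<in> null \<longleftrightarrow> e = neg_one"
  using null_neg_one theI'[OF null_neg_one] unfolding neg_one_def by blast

text \<open>Multiplying the null sum of 1 and -1 by the inverse \<open>d\<close> of -1 gives the
  null sum of \<open>d\<close> and 1; uniqueness of -1 forces \<open>d = neg_one\<close>.\<close>

lemma neg_one_square [simp]: "neg_one * neg_one = 1"
proof -
  obtain d :: 'a where d: "neg_one * d = 1" using mult_inverse_ex by blast
  have "{#1, neg_one :: 'a#} \<in> null" using null_neg_one_iff by blast
  from null_scale[OF this, of d] have "{#1, d#} \<in> null"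
    using d by (simp add: mult.commute add_mset_commute)
  then have "d = neg_one" by (simp only: null_neg_one_iff)
  then show ?thesis using d by simp
qed

lemma invol_neg_one [simp]: "invol neg_one = neg_one"
  using invol_null[of "{#1, neg_one#}"] by (simp add: invol_one null_neg_one_iff)

definition neg :: "'a::tract with_zero" where "neg = Unit neg_one"

lemma neg_nonzero [simp]: "neg \<noteq> 0" by (simp add: neg_def)

lemma neg_power_nonzero [simp]: "neg ^ n \<noteq> 0" by (induction n) (auto simp: one_with_zero_def)

lemma neg_square [simp]: "neg * neg = 1" by (simp add: neg_def one_with_zero_def)

lemma neg_square_left [simp]: "neg * (neg * x) = x"
  by (simp add: mult.assoc[symmetric])

lemma bar_neg [simp]: "bar neg = neg" by (simp add: neg_def)

lemma bar_neg_power [simp]: "bar (neg ^ n) = neg ^ n" by (induction n) auto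

lemma Unit_neg_one_power: "Unit (neg_one ^ n) = neg ^ n"
proof (induction n)
  case (Suc n)
  then show ?case unfolding power_Suc by (metis neg_def times_with_zero.simps(1))
qed (simp add: one_with_zero_def)

lemma neg_power_parity: "neg ^ n = (if even n then 1 else neg)"
  by (induction n) auto

lemma neg_power_cong: "even (m + n) \<Longrightarrow> neg ^ m = neg ^ n"
  by (simp add: neg_power_parity)

text \<open>After division by a nonzero \<open>x\<close> this is uniqueness of -1. It is the source
  of all equations between entries that orthogonality yields.\<close>

lemma is_null_pair: "is_null {#x, y#} \<longleftrightarrow> y = neg * x"
proof (cases "x = 0")
  case False
  then obtain z where z: "z \<noteq> 0" "x * z = 1" using with_zero_inverse by blast
  have "is_null {#x, y#} \<longleftrightarrow> is_null {#1, y * z#}"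
    using is_null_scale_iff[OF z(1), of "{#x, y#}"] z by (simp add: mult.commute)
  also have "\<dots> \<longleftrightarrow> y * z = neg"
  proof (cases "y * z = 0")
    case True
    then have "is_null {#1, y * z#} \<longleftrightarrow> is_null {#1 :: 'a with_zero#}"
      by (metis is_null_add_zero add_mset_commute)
    then show ?thesis using True by (metis is_null_single neg_nonzero one_with_zero_def Unit_neq_zero(1))
  next
    case False
    then obtain e where "y * z = Unit e" by (rule nonzero_cases)
    then show ?thesis by (simp add: is_null_def one_with_zero_def null_neg_one_iff neg_def)
  qed
  also have "\<dots> \<longleftrightarrow> y = neg * x"
  proof
    assume "y * z = neg"
    then have "y * (x * z) = neg * x" by (metis mult.assoc mult.commute)
    then show "y = neg * x" using z by simp
  next
    assume "y = neg * x"
    then show "y * z = neg" using z by (simp add: mult.assoc)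
  qed
  finally show ?thesis .
qed auto

section \<open>Null sums over index sets\<close>

definition null_sum :: "('i \<Rightarrow> 'a::tract with_zero) \<Rightarrow> 'i set \<Rightarrow> bool" where
  "null_sum f I = is_null (image_mset f (mset_set I))"

lemma null_sum_cong: "I = J \<Longrightarrow> (\<And>i. i \<in> I \<Longrightarrow> f i = g i) \<Longrightarrow> null_sum f I = null_sum g J"
  unfolding null_sum_def by (cases "finite J") (auto intro!: arg_cong[where f = is_null] image_mset_cong)

lemma null_sum_scale:
  "null_sum f I \<Longrightarrow> null_sum (\<lambda>i. c * f i) I"
  using is_null_scale[of "image_mset f (mset_set I)" c] by (simp add: null_sum_def multiset.map_comp comp_def)

lemma null_sum_scale_iff:
  "c \<noteq> 0 \<Longrightarrow> null_sum (\<lambda>i. c * f i) I \<longleftrightarrow> null_sum f I"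
  using is_null_scale_iff[of c "image_mset f (mset_set I)"] by (simp add: null_sum_def multiset.map_comp comp_def)

lemma null_sum_bar: "null_sum (\<lambda>i. bar (f i)) I \<longleftrightarrow> null_sum f I"
proof -
  have *: "null_sum (\<lambda>i. bar (f i)) I" if "null_sum f I" for f :: "'a \<Rightarrow> 'b with_zero"
    using is_null_bar[of "image_mset f (mset_set I)"] that by (simp add: null_sum_def multiset.map_comp comp_def)
  from *[of f] *[of "\<lambda>i. bar (f i)"] show ?thesis by auto
qed

lemma filter_mset_image_mset_set:
  assumes "finite I" "J \<subseteq> I" "\<And>i. i \<in> I - J \<Longrightarrow> f i = 0"
  shows "filter_mset (\<lambda>x. x \<noteq> 0) (image_mset f (mset_set I)) = filter_mset (\<lambda>x. x \<noteq> 0) (image_mset f (mset_set J))"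
proof -
  have "{i \<in> I. f i \<noteq> 0} = {i \<in> J. f i \<noteq> 0}" using assms by blast
  then show ?thesis using assms finite_subset[OF assms(2,1)] by (simp add: filter_mset_image_mset)
qed

lemma null_sum_subset:
  assumes "finite I" "J \<subseteq> I" "\<And>i. i \<in> I - J \<Longrightarrow> f i = 0"
  shows "null_sum f I \<longleftrightarrow> null_sum f J"
  using filter_mset_image_mset_set[OF assms] by (simp add: null_sum_def is_null_def)

lemma null_sum_zero: "(\<And>i. i \<in> I \<Longrightarrow> f i = 0) \<Longrightarrow> null_sum f I"
  using null_sum_subset[of I "{}" f] by (cases "finite I") (auto simp: null_sum_def)

lemma null_sum_reindex: "inj_on h I \<Longrightarrow> null_sum f (h ` I) \<longleftrightarrow> null_sum (\<lambda>i. f (h i)) I"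
  by (simp add: null_sum_def image_mset_mset_set[symmetric] multiset.map_comp comp_def)

lemma null_sum_single [simp]: "null_sum f {i} \<longleftrightarrow> f i = 0"
  by (simp add: null_sum_def)

lemma null_sum_pair: "i \<noteq> j \<Longrightarrow> null_sum f {i, j} \<longleftrightarrow> f j = neg * f i"
  by (simp add: null_sum_def is_null_pair)

lemma null_sum_insert:
  "finite I \<Longrightarrow> i \<notin> I \<Longrightarrow> null_sum f (insert i I) \<longleftrightarrow> is_null (add_mset (f i) (image_mset f (mset_set I)))"
  by (simp add: null_sum_def)

section \<open>Orthogonality\<close>

lemma orthogonal_null_sum: "orthogonal E X Y \<longleftrightarrow> null_sum (\<lambda>i. X i * bar (Y i)) E"
  by (simp add: orthogonal_def null_sum_def)

text \<open>Applying the involution to the sum exchanges the two tuples and preserves null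
  sums.\<close>

lemma orthogonal_sym: "orthogonal E X Y \<longleftrightarrow> orthogonal E Y X"
  unfolding orthogonal_null_sum
  by (subst null_sum_bar[symmetric]) (simp add: mult.commute)

lemma orthogonal_scale:
  "c \<noteq> 0 \<Longrightarrow> (\<And>i. i \<in> E \<Longrightarrow> Y' i = c * Y i) \<Longrightarrow> orthogonal E X Y' \<longleftrightarrow> orthogonal E X Y"
  unfolding orthogonal_null_sum
  by (subst null_sum_scale_iff[of "bar c", symmetric]) (auto intro!: null_sum_cong simp: ac_simps)

lemma orthogonal_cong:
  "(\<And>i. i \<in> E \<Longrightarrow> X i = X' i) \<Longrightarrow> (\<And>i. i \<in> E \<Longrightarrow> Y i = Y' i) \<Longrightarrow> orthogonal E X Y \<longleftrightarrow> orthogonal E X' Y'"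
  unfolding orthogonal_null_sum by (auto intro!: null_sum_cong)

lemma orthogonal_subset:
  assumes "finite E" "F \<subseteq> E" "\<And>i. i \<in> E - F \<Longrightarrow> X i = 0 \<or> Y i = 0"
  shows "orthogonal E X Y \<longleftrightarrow> orthogonal F X Y"
  unfolding orthogonal_null_sum by (rule null_sum_subset) (use assms in auto)

section \<open>The sign of a shuffle\<close>

text \<open>Explains the index in \<open>split_perm\<close>: in a strictly increasing list an
  element is preceded exactly by the smaller ones.\<close>

lemma nth_sorted_list_of_set_card_less:
  fixes E :: "'e::linorder set"
  assumes "finite E" "x \<in> E"
  shows "sorted_list_of_set E ! card {y \<in> E. y < x} = x"
proof -
  let ?l = "sorted_list_of_set E"
  have s: "sorted_wrt (<) ?l" by (rule strict_sorted_list_of_set)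
  obtain k where k: "k < length ?l" "?l ! k = x"
    using assms by (metis in_set_conv_nth set_sorted_list_of_set)
  have less: "?l ! i < ?l ! j \<longleftrightarrow> i < j" if "i < length ?l" "j < length ?l" for i j
    using that sorted_wrt_nth_less[OF s] by (metis linorder_neqE_nat not_less_iff_gr_or_eq)
  have "{y \<in> E. y < x} = {y \<in> set ?l. y < ?l ! k}" using assms k by simp
  also have "\<dots> = (!) ?l ` {..<k}"
    using k less by (force simp: set_conv_nth)
  finally have "card {y \<in> E. y < x} = card ((!) ?l ` {..<k})" by simp
  also have "\<dots> = k"
    using k by (subst card_image) (auto intro!: inj_onI simp: nth_eq_iff_index_eq)
  finally show ?thesis using k by simp
qed

text \<open>The inversions of the list \<open>I\<close> followed by \<open>E - I\<close>. Both
  blocks are increasing, so only pairs across the blocks can be inverted.\<close>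

definition inversions :: "'e::linorder set \<Rightarrow> 'e set \<Rightarrow> ('e \<times> 'e) set" where
  "inversions E I = {(a, b). a \<in> I \<and> b \<in> E - I \<and> b < a}"

lemma finite_inversions [simp]: "finite E \<Longrightarrow> I \<subseteq> E \<Longrightarrow> finite (inversions E I)"
  by (rule finite_subset[of _ "E \<times> E"]) (auto simp: inversions_def)

lemma sorted_list_of_set_image_strict_mono:
  fixes f :: "'e::linorder \<Rightarrow> 'e"
  assumes "finite A" "\<And>x y. x \<in> A \<Longrightarrow> y \<in> A \<Longrightarrow> x < y \<Longrightarrow> f x < f y"
  shows "sorted_list_of_set (f ` A) = map f (sorted_list_of_set A)"
proof (rule sorted_distinct_set_unique)
  have "sorted_wrt (<) (map f (sorted_list_of_set A))"
    unfolding sorted_wrt_map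
    by (rule sorted_wrt_mono_rel[OF _ strict_sorted_list_of_set]) (use assms in auto)
  then show "sorted (map f (sorted_list_of_set A))" "distinct (map f (sorted_list_of_set A))"
    by (auto simp: strict_sorted_iff)
qed (use assms in auto)

lemma split_perm_no_inversions:
  assumes "finite E" "I \<subseteq> E" "inversions E I = {}"
  shows "split_perm E I = id"
proof -
  have fin: "finite I" using assms finite_subset by blast
  have "sorted_list_of_set I @ sorted_list_of_set (E - I) = sorted_list_of_set E"
  proof (rule sorted_distinct_set_unique)
    have "a \<le> b" if "a \<in> I" "b \<in> E - I" for a b
      using assms that by (force simp: inversions_def)
    then show "sorted (sorted_list_of_set I @ sorted_list_of_set (E - I))"
      using fin assms by (auto simp: sorted_append)
  qed (use fin assms in auto)
  then show ?thesis
    using nth_sorted_list_of_set_card_less[OF assms(1)] by (auto simp: split_perm_def)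
qed

text \<open>Exchanging an adjacent inverted pair composes \<open>split_perm\<close> with a transposition and removes
  exactly one inversion.\<close>

lemma adjacent_inversion:
  assumes "finite E" "I \<subseteq> E" "inversions E I \<noteq> {}"
  obtains a b where "(a, b) \<in> inversions E I" "\<And>e. e \<in> E \<Longrightarrow> \<not> (b < e \<and> e < a)"
proof -
  \<comment> \<open>The gap of a pair. An element strictly between \<open>b\<close> and
    \<open>a\<close> forms an inversion with \<open>b\<close> if it is in \<open>I\<close> and with
    \<open>a\<close> otherwise, with a smaller gap; so an inversion of least gap is
    adjacent.\<close>
  define f where "f = (\<lambda>(a, b). card {e \<in> E. b < e \<and> e < a})"
  obtain p where p: "p \<in> inversions E I" and min: "\<And>q. q \<in> inversions E I \<Longrightarrow> f p \<le> f q"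
    using ex_has_least_nat[of "\<lambda>p. p \<in> inversions E I" _ f] assms(3) by blast
  obtain a b where ab: "p = (a, b)" by (cases p)
  have "\<not> (b < e \<and> e < a)" if e: "e \<in> E" for e
  proof
    assume be: "b < e \<and> e < a"
    have "f (e, b) < f p" "f (a, e) < f p"
      unfolding ab f_def prod.case by (rule psubset_card_mono; use e be assms(1) in force)+
    moreover have "(e, b) \<in> inversions E I \<or> (a, e) \<in> inversions E I"
      using p e be by (auto simp: ab inversions_def)
    ultimately show False using min leD by blast
  qed
  then show ?thesis using that p ab by blast
qed

lemma sign_split_perm:
  assumes "finite E" "I \<subseteq> E"
  shows "permutation (split_perm E I) \<and> sign (split_perm E I) = (-1) ^ card (inversions E I)"
  using assms(2)
proof (induction "card (inversions E I)" arbitrary: I rule: less_induct)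
  case less
  show ?case
  proof (cases "inversions E I = {}")
    case True
    then show ?thesis using split_perm_no_inversions[OF assms(1) less.prems] by simp
  next
    case False
    then obtain a b where ab: "(a, b) \<in> inversions E I"
      and adj: "\<And>e. e \<in> E \<Longrightarrow> \<not> (b < e \<and> e < a)"
      using adjacent_inversion assms(1) less.prems by metis
    \<comment> \<open>As \<open>a\<close> and \<open>b\<close> are neighbours in \<open>E\<close>,
      swapping them preserves every other comparison in \<open>E\<close>; this is
      \<open>mono\<close> below. Passing from \<open>I\<close> to its image under \<open>t\<close>
      therefore loses the inversion (a, b) and no other.\<close>
    define t where "t = transpose a b"
    have abI: "a \<in> I" "b \<in> E" "b \<notin> I" "b < a" "a \<in> E" using ab less.prems by (auto simp: inversions_def)
    have adj1: "e \<le> b \<or> a \<le> e" if "e \<in> E" for e using adj[OF that] by auto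
    have mono: "t x < t y" if "x < y" "x \<in> E" "y \<in> E" "(x, y) \<noteq> (b, a)" for x y
      using that adj1[of x] adj1[of y] abI by (auto simp: t_def transpose_def)
    have tt: "t (t x) = x" for x by (simp add: t_def)
    have tE: "t x \<in> E \<longleftrightarrow> x \<in> E" for x using abI by (auto simp: t_def transpose_def)
    define I' where "I' = t ` I"
    have mem: "x \<in> t ` A \<longleftrightarrow> t x \<in> A" for x A using tt by (metis imageE image_eqI)
    have memI': "x \<in> I' \<longleftrightarrow> t x \<in> I" for x unfolding I'_def by (rule mem)
    have I'E: "I' \<subseteq> E" using tE less.prems memI' by blast
    have compl: "E - I' = t ` (E - I)" by (auto simp: mem tE memI' tt)
    have inv: "inversions E I = insert (a, b) (map_prod t t ` inversions E I')" (is "?L = ?R")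
    proof (intro set_eqI iffI)
      fix p assume p: "p \<in> ?L"
      obtain c d where cd: "p = (c, d)" by (cases p)
      show "p \<in> ?R"
      proof (cases "p = (a, b)")
        case False
        then have "(t c, t d) \<in> inversions E I'"
          using p mono[of d c] tE memI' tt less.prems by (auto simp: inversions_def cd)
        then show ?thesis using tt cd by (force simp: image_iff)
      qed simp
    next
      fix p assume p: "p \<in> ?R"
      show "p \<in> ?L"
      proof (cases "p = (a, b)")
        case False
        then obtain c d where cd: "(c, d) \<in> inversions E I'" "p = (t c, t d)" using p by auto
        have "(d, c) \<noteq> (b, a)" using cd(1) abI by (auto simp: inversions_def memI' t_def)
        then show ?thesis
          using cd mono[of d c] tE memI' tt I'E by (auto simp: inversions_def)
      qed (use ab in simp)
    qed
    have nin: "(a, b) \<notin> map_prod t t ` inversions E I'"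
      using abI by (auto simp: inversions_def memI' t_def transpose_def split: if_splits)
    have inj: "inj_on (map_prod t t) A" for A
      by (rule inj_onI) (metis map_prod_def prod.collapse prod.inject case_prod_unfold tt)
    have card: "card (inversions E I) = Suc (card (inversions E I'))"
      unfolding inv using nin I'E assms(1) by (simp add: card_image inj)
    have fin: "finite I" using less.prems assms(1) finite_subset by blast
    have tI: "t ` I' = I" "t ` (E - I') = E - I"
      by (simp_all add: I'_def set_eq_iff mem tE tt del: image_eqI)
    \<comment> \<open>The only pair that \<open>t\<close> reverses has one element in each block:
      \<open>b\<close> lies in \<open>I'\<close> and \<open>a\<close> in \<open>E - I'\<close>.
      Hence \<open>t\<close> maps the sorted list of each block to a sorted list.\<close>
    have bI': "b \<in> I'" using abI by (simp add: memI' t_def)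
    have aI': "a \<notin> I'" using abI by (simp add: memI' t_def)
    have "sorted_list_of_set I = map t (sorted_list_of_set I')"
      by (subst (1) tI(1)[symmetric], rule sorted_list_of_set_image_strict_mono)
        (use fin I'E aI' I'_def in \<open>auto intro!: mono simp del: image_eqI\<close>)
    moreover have "sorted_list_of_set (E - I) = map t (sorted_list_of_set (E - I'))"
      by (subst (1) tI(2)[symmetric], rule sorted_list_of_set_image_strict_mono)
        (use assms(1) bI' in \<open>auto intro!: mono\<close>)
    ultimately have l: "sorted_list_of_set I @ sorted_list_of_set (E - I) =
        map t (sorted_list_of_set I' @ sorted_list_of_set (E - I'))" by simp
    have len: "card {y \<in> E. y < x} < length (sorted_list_of_set I' @ sorted_list_of_set (E - I'))"
      if "x \<in> E" for x
    proof -
      have "card {y \<in> E. y < x} < card E" using assms(1) that by (intro psubset_card_mono) auto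
      also have "\<dots> = length (sorted_list_of_set I' @ sorted_list_of_set (E - I'))"
        using I'E assms(1) by (simp add: card_Diff_subset finite_subset card_mono)
      finally show ?thesis .
    qed
    have sp: "split_perm E I = t \<circ> split_perm E I'"
    proof
      fix x show "split_perm E I x = (t \<circ> split_perm E I') x"
        using len[of x] abI unfolding split_perm_def l
          by (cases "x = a \<or> x = b") (auto simp: t_def simp del: map_append)
    qed
    have "permutation (split_perm E I') \<and> sign (split_perm E I') = (-1) ^ card (inversions E I')"
      using less.hyps[of I'] card I'E by simp
    moreover have "permutation t" "sign t = -1"
      using abI by (auto simp: t_def permutation_swap_id sign_swap_id)
    ultimately show ?thesis
      unfolding sp card by (simp add: permutation_compose sign_compose)
  qed
qed

lemma split_sign_inversions:
  "finite E \<Longrightarrow> I \<subseteq> E \<Longrightarrow> split_sign E I = neg ^ card (inversions E I)"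
  using sign_split_perm[of E I]
  by (cases "even (card (inversions E I))")
    (auto simp: split_sign_def neg_power_parity, auto simp: neg_def one_with_zero_def)

text \<open>Moving \<open>i\<close> from \<open>\<tau>\<close> to its complement destroys the
  inversions (i, b) and creates the inversions (a, i); the pairs \<open>X\<close> without
  \<open>i\<close> are common to both.\<close>

lemma card_inversions_remove:
  assumes "finite E" "\<tau> \<subseteq> E" "i \<in> \<tau>"
  shows "card (inversions E (\<tau> - {i})) + card {b \<in> E - \<tau>. b < i} =
    card (inversions E \<tau>) + card {a \<in> \<tau>. i < a}"
proof -
  define X where "X = {(a, b). a \<in> \<tau> - {i} \<and> b \<in> E - \<tau> \<and> b < a}"
  have finX: "finite X" by (rule finite_subset[of _ "E \<times> E"]) (use assms in \<open>auto simp: X_def\<close>)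
  have fin: "finite \<tau>" using assms finite_subset by blast
  have "inversions E (\<tau> - {i}) = X \<union> (\<lambda>a. (a, i)) ` {a \<in> \<tau>. i < a}"
    using assms by (auto simp: inversions_def X_def)
  then have 1: "card (inversions E (\<tau> - {i})) = card X + card {a \<in> \<tau>. i < a}"
    using finX fin assms by (simp, subst card_Un_disjoint) (auto simp: X_def card_image inj_on_def)
  have "inversions E \<tau> = X \<union> Pair i ` {b \<in> E - \<tau>. b < i}"
    using assms by (auto simp: inversions_def X_def)
  then have 2: "card (inversions E \<tau>) = card X + card {b \<in> E - \<tau>. b < i}"
    using finX fin assms by (simp, subst card_Un_disjoint) (auto simp: X_def card_image inj_on_def)
  show ?thesis using 1 2 by simp
qed

text \<open>Trades the counts of larger elements, as in \<open>plucker_sign\<close>, for the counts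
  of smaller elements, as in \<open>circuit_vector\<close>.\<close>

lemma card_less_greater:
  fixes A :: "'e::linorder set"
  assumes "finite A"
  shows "i \<in> A \<Longrightarrow> card A = Suc (card {a \<in> A. a < i} + card {a \<in> A. i < a})"
    and "i \<notin> A \<Longrightarrow> card A = card {a \<in> A. a < i} + card {a \<in> A. i < a}"
proof -
  have *: "card (A - {i}) = card {a \<in> A. a < i} + card {a \<in> A. i < a}"
    using assms by (subst card_Un_disjoint[symmetric]) (auto intro!: arg_cong[where f = card])
  show "i \<in> A \<Longrightarrow> card A = Suc (card {a \<in> A. a < i} + card {a \<in> A. i < a})"
    using * assms by (metis card_Suc_Diff1)
  show "i \<notin> A \<Longrightarrow> card A = card {a \<in> A. a < i} + card {a \<in> A. i < a}"
    using * by simp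
qed

section \<open>Circuits and cocircuits\<close>

abbreviation cvec :: "'e::linorder set \<Rightarrow> ('e set \<Rightarrow> 'a::tract with_zero) \<Rightarrow> 'e set \<Rightarrow> 'e \<Rightarrow> 'a with_zero" where
  "cvec \<equiv> circuit_vector"

lemma cvec_apply:
  "i \<in> E \<Longrightarrow> cvec E P \<tau> i = (if i \<in> \<tau> then neg ^ card {j \<in> \<tau>. j < i} * P (\<tau> - {i}) else 0)"
  by (simp add: circuit_vector_def Unit_neg_one_power)

text \<open>Up to a sign depending only on \<open>I\<close>, this is the circuit vector of the dual Pluecker vector at
  the complement of \<open>I\<close> (lemma \<open>cvec_dual\<close>), which frees the rest from the signs of permutations.\<close>

definition dvec :: "'e::linorder set \<Rightarrow> ('e set \<Rightarrow> 'a::tract with_zero) \<Rightarrow> 'e set \<Rightarrow> 'e \<Rightarrow> 'a with_zero" where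
  "dvec E P I = (\<lambda>i\<in>E. if i \<in> I then 0 else neg ^ card {j \<in> I. j < i} * bar (P (insert i I)))"

lemma dvec_apply:
  "i \<in> E \<Longrightarrow> dvec E P I i = (if i \<in> I then 0 else neg ^ card {j \<in> I. j < i} * bar (P (insert i I)))"
  by (simp add: dvec_def)

lemma cvec_perp_dvec:
  assumes "plucker_vector E r P" "finite E" "I \<subseteq> E" "card I + 1 = r" "J \<subseteq> E" "card J = r + 1"
  shows "orthogonal E (cvec E P J) (dvec E P I)"
proof -
  have fin: "finite I" "finite J" using assms finite_subset by blast+
  \<comment> \<open>The Pluecker sign counts the elements of \<open>J\<close> and \<open>I\<close>
    above \<open>j\<close>, the two vectors count those below. Together these are
    \<open>card J - 1\<close> and \<open>card I\<close> elements, since \<open>j\<close> is in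
    \<open>J\<close> but not in \<open>I\<close>; so the discrepancy is one sign for all
    \<open>j\<close>.\<close>
  let ?s = "neg ^ (card J + 1 + card I) :: 'b with_zero"
  have "null_sum (\<lambda>j. plucker_sign j I J * P (insert j I) * P (J - {j})) (J - I)"
    using assms by (simp add: plucker_vector_def null_sum_def)
  then have "null_sum (\<lambda>j. ?s * (plucker_sign j I J * P (insert j I) * P (J - {j}))) (J - I)"
    by (rule null_sum_scale)
  also have "?this \<longleftrightarrow> null_sum (\<lambda>i. cvec E P J i * bar (dvec E P I i)) (J - I)"
  proof (rule null_sum_cong)
    fix j assume j: "j \<in> J - I"
    have "?s * neg ^ (card {j' \<in> J. j < j'} + card {i \<in> I. j < i}) =
      neg ^ card {i \<in> J. i < j} * neg ^ card {i \<in> I. i < j}"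
      unfolding power_add[symmetric]
      by (rule neg_power_cong) (use j card_less_greater(1)[of J j] card_less_greater(2)[of I j] fin in \<open>simp, presburger\<close>)
    then have "?s * (plucker_sign j I J * P (insert j I) * P (J - {j})) =
      (neg ^ card {i \<in> J. i < j} * neg ^ card {i \<in> I. i < j}) * (P (insert j I) * P (J - {j}))"
      unfolding plucker_sign_def Unit_neg_one_power by (simp only: mult.assoc[symmetric])
    also have "\<dots> = cvec E P J j * bar (dvec E P I j)"
    proof -
      have "j \<in> E" using j assms(5) by blast
      then show ?thesis using j unfolding cvec_apply[OF \<open>j \<in> E\<close>] dvec_apply[OF \<open>j \<in> E\<close>] by (simp add: ac_simps)
    qed
    finally show "?s * (plucker_sign j I J * P (insert j I) * P (J - {j})) = cvec E P J j * bar (dvec E P I j)" .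
  qed simp
  also have "\<dots> \<longleftrightarrow> null_sum (\<lambda>i. cvec E P J i * bar (dvec E P I i)) E"
    by (rule null_sum_subset[symmetric]) (use assms in \<open>auto simp: cvec_apply dvec_apply\<close>)
  finally show ?thesis by (simp add: orthogonal_null_sum)
qed

text \<open>Every matroid has this form, so the arguments can run with one chosen representative of
  the class.\<close>

definition of_plucker :: "'e set \<Rightarrow> nat \<Rightarrow> ('e set \<Rightarrow> 'a::tract with_zero) \<Rightarrow> ('e, 'a) matroid" where
  "of_plucker E r P = Matroid E r {\<lambda>I\<in>subsets_of_card E r. Unit c * P I | c. True}"

lemma of_plucker_simps [simp]: "ground (of_plucker E r P) = E" "rank (of_plucker E r P) = r"
  by (simp_all add: of_plucker_def)

lemma is_matroidE:
  assumes "is_matroid M"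
  obtains P where "finite (ground M)" "plucker_vector (ground M) (rank M) P" "M = of_plucker (ground M) (rank M) P"
  using assms by (cases M) (auto simp: is_matroid_def of_plucker_def)

lemma is_matroid_of_plucker: "finite E \<Longrightarrow> plucker_vector E r P \<Longrightarrow> is_matroid (of_plucker E r P)"
  by (auto simp: is_matroid_def of_plucker_def)

lemma plucker_vectorD:
  assumes "plucker_vector E r P"
  shows "P \<in> tuples (subsets_of_card E r)" "\<exists>B. B \<subseteq> E \<and> card B = r \<and> P B \<noteq> 0"
  using assms by (auto simp: plucker_vector_def)

lemma circuits_of_plucker:
  assumes "finite E"
  shows "circuits (of_plucker E r P) =
    {\<lambda>i\<in>E. Unit c * cvec E P \<tau> i | c \<tau>. \<tau> \<subseteq> E \<and> card \<tau> = r + 1 \<and> supp E (cvec E P \<tau>) \<noteq> {}}"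
    (is "?L = ?R")
proof -
  have *: "cvec E (\<lambda>I\<in>subsets_of_card E r. Unit c * P I) \<tau> i = Unit c * cvec E P \<tau> i"
    if "i \<in> E" "\<tau> \<subseteq> E" "card \<tau> = r + 1" for c \<tau> i
    using that assms finite_subset[OF that(2) assms] by (auto simp: cvec_apply ac_simps)
  have s: "supp E (cvec E (\<lambda>I\<in>subsets_of_card E r. Unit c * P I) \<tau>) = supp E (cvec E P \<tau>)"
    if "\<tau> \<subseteq> E" "card \<tau> = r + 1" for c \<tau>
    using *[OF _ that] by (auto simp: supp_def)
  have 1: "(\<lambda>i\<in>E. Unit d * cvec E (\<lambda>I\<in>subsets_of_card E r. Unit c * P I) \<tau> i) =
      (\<lambda>i\<in>E. Unit (d * c) * cvec E P \<tau> i)" if "\<tau> \<subseteq> E" "card \<tau> = r + 1" for c d \<tau>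
    using *[OF _ that] by (auto simp: mult.assoc simp flip: times_with_zero.simps(1))
  show ?thesis
  proof (intro subset_antisym subsetI)
    fix X assume "X \<in> ?L"
    then obtain d c \<tau> where "X = (\<lambda>i\<in>E. Unit d * cvec E (\<lambda>I\<in>subsets_of_card E r. Unit c * P I) \<tau> i)"
      "\<tau> \<subseteq> E" "card \<tau> = r + 1" "supp E (cvec E (\<lambda>I\<in>subsets_of_card E r. Unit c * P I) \<tau>) \<noteq> {}"
      unfolding circuits_def of_plucker_def by auto
    then show "X \<in> ?R" using 1 s by blast
  next
    fix X assume "X \<in> ?R"
    then obtain c \<tau> where X: "X = (\<lambda>i\<in>E. Unit c * cvec E P \<tau> i)" "\<tau> \<subseteq> E" "card \<tau> = r + 1"
      "supp E (cvec E P \<tau>) \<noteq> {}" by auto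
    then have "X = (\<lambda>i\<in>E. Unit c * cvec E (\<lambda>I\<in>subsets_of_card E r. Unit 1 * P I) \<tau> i)"
      using 1[of \<tau> c 1] by simp
    moreover have "(\<lambda>I\<in>subsets_of_card E r. Unit 1 * P I) \<in> pluckers (of_plucker E r P)"
      unfolding of_plucker_def by auto
    moreover have "\<tau> \<in> subsets_of_card E (r + 1)" using X by simp
    ultimately show "X \<in> ?L" using X(4) s[OF X(2,3), of 1] unfolding circuits_def of_plucker_simps by blast
  qed
qed

text \<open>The elements of \<open>\<tau>\<close> below \<open>i\<close>, from the circuit sign, and
  above \<open>i\<close>, from \<open>card_inversions_remove\<close>, number
  \<open>card \<tau> - 1\<close> in total. What still depends on \<open>i\<close> is the count of
  the elements outside \<open>\<tau>\<close> below \<open>i\<close>, which is the sign in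
  \<open>dvec\<close>.\<close>

lemma cvec_dual:
  assumes "finite E" "r \<le> card E" "\<tau> \<subseteq> E" "card \<tau> = card E - r + 1" "i \<in> E"
  shows "cvec E (\<lambda>I\<in>subsets_of_card E (card E - r). split_sign E I * bar (P (E - I))) \<tau> i =
    neg ^ (card (inversions E \<tau>) + card \<tau> + 1) * dvec E P (E - \<tau>) i"
proof (cases "i \<in> \<tau>")
  case True
  have fin: "finite \<tau>" using assms finite_subset by blast
  have "E - (\<tau> - {i}) = insert i (E - \<tau>)" using True assms by auto
  moreover have "neg ^ card {j \<in> \<tau>. j < i} * neg ^ card (inversions E (\<tau> - {i})) =
    (neg ^ (card (inversions E \<tau>) + card \<tau> + 1) * neg ^ card {j \<in> E - \<tau>. j < i} :: 'b with_zero)"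
    unfolding power_add[symmetric]
    by (rule neg_power_cong)
      (use card_inversions_remove[OF assms(1,3) True] card_less_greater(1)[OF fin True] in presburger)
  moreover have "\<tau> - {i} \<subseteq> E" using assms by blast
  ultimately show ?thesis
    using True assms fin
    by (simp add: cvec_apply dvec_apply split_sign_inversions mult.assoc[symmetric])
qed (use assms in \<open>simp add: cvec_apply dvec_apply\<close>)

lemma cocircuits_of_plucker:
  assumes "finite E" "plucker_vector E r P"
  shows "cocircuits (of_plucker E r P) =
    {\<lambda>i\<in>E. Unit c * dvec E P I i | c I. I \<subseteq> E \<and> card I + 1 = r \<and> supp E (dvec E P I) \<noteq> {}}"
    (is "?L = ?R")
proof -
  \<comment> \<open>Makes the truncated subtraction \<open>card E - r\<close> exact.\<close>
  have r: "r \<le> card E" using plucker_vectorD(2)[OF assms(2)] assms(1) card_mono by blast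
  define P' where "P' = (\<lambda>I\<in>subsets_of_card E (card E - r). split_sign E I * bar (P (E - I)))"
  \<comment> \<open>The dual conjugates the scaling factor; as the involution is onto, the image of
    a full scaling class is again a full scaling class.\<close>
  have invol: "range (invol :: 'b \<Rightarrow> 'b) = UNIV" by (metis invol_invol surjI)
  have "(\<lambda>P. \<lambda>I\<in>subsets_of_card E (card E - r). split_sign E I * bar (P (E - I))) `
      {\<lambda>I\<in>subsets_of_card E r. Unit c * P I | c. True} =
    {\<lambda>I\<in>subsets_of_card E (card E - r). Unit (invol c) * P' I | c. True}"
  proof -
    have "card (E - I) = r" if "I \<subseteq> E" "card I = card E - r" for I
      using that r assms(1) by (simp add: card_Diff_subset finite_subset)
    then have "(\<lambda>I\<in>subsets_of_card E (card E - r). split_sign E I * bar ((\<lambda>I\<in>subsets_of_card E r. Unit c * P I) (E - I)))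
      = (\<lambda>I\<in>subsets_of_card E (card E - r). Unit (invol c) * P' I)" for c
      by (auto simp: P'_def ac_simps)
    then show ?thesis by (simp only: setcompr_eq_image image_image)
  qed
  also have "\<dots> = {\<lambda>I\<in>subsets_of_card E (card E - r). Unit c * P' I | c. True}"
  proof -
    have "{F (invol c) |c. True} = {F c |c. True}" for F :: "'b \<Rightarrow> 'a set \<Rightarrow> 'b with_zero"
      unfolding setcompr_eq_image using invol by (metis (no_types) UNIV_def image_image)
    from this[of "\<lambda>c. \<lambda>I\<in>subsets_of_card E (card E - r). Unit c * P' I"] show ?thesis .
  qed
  finally have dual: "dual (of_plucker E r P) = of_plucker E (card E - r) P'"
    by (simp add: dual_def of_plucker_def Let_def)
  define n where "n \<tau> = card (inversions E \<tau>) + card \<tau> + 1" for \<tau>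
  have L: "?L = {\<lambda>i\<in>E. Unit c * cvec E P' \<tau> i | c \<tau>. \<tau> \<subseteq> E \<and> card \<tau> = card E - r + 1 \<and> supp E (cvec E P' \<tau>) \<noteq> {}}"
    unfolding cocircuits_def dual by (rule circuits_of_plucker[OF assms(1)])
  have d: "cvec E P' \<tau> i = neg ^ n \<tau> * dvec E P (E - \<tau>) i"
    if "\<tau> \<subseteq> E" "card \<tau> = card E - r + 1" "i \<in> E" for \<tau> i
    using cvec_dual[OF assms(1) r that] by (simp add: P'_def n_def)
  then have s: "supp E (cvec E P' \<tau>) = supp E (dvec E P (E - \<tau>))" if "\<tau> \<subseteq> E" "card \<tau> = card E - r + 1" for \<tau>
    using that by (auto simp: supp_def)
  show ?thesis
  proof (intro subset_antisym subsetI)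
    fix X assume "X \<in> ?L"
    then obtain c \<tau> where X: "X = (\<lambda>i\<in>E. Unit c * cvec E P' \<tau> i)"
      "\<tau> \<subseteq> E" "card \<tau> = card E - r + 1" "supp E (cvec E P' \<tau>) \<noteq> {}" unfolding L by auto
    have "card \<tau> \<le> card E" using X assms card_mono by blast
    then have "card (E - \<tau>) + 1 = r" using X r assms by (simp add: card_Diff_subset finite_subset)
    moreover have "X = (\<lambda>i\<in>E. Unit (c * neg_one ^ n \<tau>) * dvec E P (E - \<tau>) i)"
      unfolding X(1) using d[OF X(2,3)]
      by (auto simp: mult.assoc Unit_neg_one_power simp flip: times_with_zero.simps(1))
    ultimately show "X \<in> ?R" using X s by blast
  next
    fix X assume "X \<in> ?R"
    then obtain c I where X: "X = (\<lambda>i\<in>E. Unit c * dvec E P I i)"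
      "I \<subseteq> E" "card I + 1 = r" "supp E (dvec E P I) \<noteq> {}" by auto
    define \<tau> where "\<tau> = E - I"
    have \<tau>: "\<tau> \<subseteq> E" "card \<tau> = card E - r + 1" "E - \<tau> = I"
      using X r assms by (auto simp: \<tau>_def card_Diff_subset finite_subset)
    have "neg ^ n \<tau> * (neg ^ n \<tau> * x) = x" for x :: "'b with_zero"
      by (simp add: neg_power_parity)
    then have "X = (\<lambda>i\<in>E. Unit (c * neg_one ^ n \<tau>) * cvec E P' \<tau> i)"
      unfolding X(1) using d[OF \<tau>(1,2)] \<tau>(3)
      by (auto simp: mult.assoc Unit_neg_one_power simp flip: times_with_zero.simps(1))
    then show "X \<in> ?L" unfolding L using \<tau> X s[OF \<tau>(1,2)] by auto
  qed
qed

definition covec :: "'e::linorder set \<Rightarrow> nat \<Rightarrow> ('e set \<Rightarrow> 'a::tract with_zero) \<Rightarrow> ('e \<Rightarrow> 'a with_zero) \<Rightarrow> bool" where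
  "covec E r P Y \<longleftrightarrow> (\<forall>\<tau>. \<tau> \<subseteq> E \<and> card \<tau> = r + 1 \<longrightarrow> orthogonal E Y (cvec E P \<tau>))"

definition vec :: "'e::linorder set \<Rightarrow> nat \<Rightarrow> ('e set \<Rightarrow> 'a::tract with_zero) \<Rightarrow> ('e \<Rightarrow> 'a with_zero) \<Rightarrow> bool" where
  "vec E r P W \<longleftrightarrow> (\<forall>I. I \<subseteq> E \<and> card I + 1 = r \<longrightarrow> orthogonal E W (dvec E P I))"

lemma orthogonal_empty_supp: "supp E Y = {} \<Longrightarrow> orthogonal E X Y"
  unfolding orthogonal_null_sum by (rule null_sum_zero) (auto simp: supp_def)

lemma covectors_of_plucker:
  assumes "finite E"
  shows "covectors (of_plucker E r P) = {Y \<in> tuples E. covec E r P Y}"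
proof -
  have sc: "orthogonal E Y (\<lambda>i\<in>E. Unit c * cvec E P \<tau> i) \<longleftrightarrow> orthogonal E Y (cvec E P \<tau>)" for Y c \<tau>
    by (rule orthogonal_scale[of "Unit c"]) auto
  have "(\<forall>X\<in>{\<lambda>i\<in>E. Unit c * cvec E P \<tau> i | c \<tau>. \<tau> \<subseteq> E \<and> card \<tau> = r + 1 \<and> supp E (cvec E P \<tau>) \<noteq> {}}.
      orthogonal E Y X) \<longleftrightarrow> covec E r P Y" for Y
  proof -
    have "(\<forall>X\<in>{\<lambda>i\<in>E. Unit c * cvec E P \<tau> i | c \<tau>. \<tau> \<subseteq> E \<and> card \<tau> = r + 1 \<and> supp E (cvec E P \<tau>) \<noteq> {}}. orthogonal E Y X) \<longleftrightarrow>
      (\<forall>c \<tau>. \<tau> \<subseteq> E \<and> card \<tau> = r + 1 \<and> supp E (cvec E P \<tau>) \<noteq> {} \<longrightarrow> orthogonal E Y (\<lambda>i\<in>E. Unit c * cvec E P \<tau> i))"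
      by blast
    also have "\<dots> \<longleftrightarrow> (\<forall>\<tau>. \<tau> \<subseteq> E \<and> card \<tau> = r + 1 \<and> supp E (cvec E P \<tau>) \<noteq> {} \<longrightarrow> orthogonal E Y (cvec E P \<tau>))"
      unfolding sc by simp
    also have "\<dots> \<longleftrightarrow> covec E r P Y"
      unfolding covec_def by (metis orthogonal_empty_supp)
    finally show ?thesis .
  qed
  then show ?thesis
    unfolding covectors_def perp_def circuits_of_plucker[OF assms] of_plucker_simps by simp
qed

lemma vectors_of_plucker:
  assumes "finite E" "plucker_vector E r P"
  shows "vectors (of_plucker E r P) = {Y \<in> tuples E. vec E r P Y}"
proof -
  have sc: "orthogonal E Y (\<lambda>i\<in>E. Unit c * dvec E P \<tau> i) \<longleftrightarrow> orthogonal E Y (dvec E P \<tau>)" for Y c \<tau>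
    by (rule orthogonal_scale[of "Unit c"]) auto
  have "(\<forall>X\<in>{\<lambda>i\<in>E. Unit c * dvec E P \<tau> i | c \<tau>. \<tau> \<subseteq> E \<and> card \<tau> + 1 = r \<and> supp E (dvec E P \<tau>) \<noteq> {}}.
      orthogonal E Y X) \<longleftrightarrow> vec E r P Y" for Y
  proof -
    have "(\<forall>X\<in>{\<lambda>i\<in>E. Unit c * dvec E P \<tau> i | c \<tau>. \<tau> \<subseteq> E \<and> card \<tau> + 1 = r \<and> supp E (dvec E P \<tau>) \<noteq> {}}. orthogonal E Y X) \<longleftrightarrow>
      (\<forall>c \<tau>. \<tau> \<subseteq> E \<and> card \<tau> + 1 = r \<and> supp E (dvec E P \<tau>) \<noteq> {} \<longrightarrow> orthogonal E Y (\<lambda>i\<in>E. Unit c * dvec E P \<tau> i))"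
      by blast
    also have "\<dots> \<longleftrightarrow> (\<forall>\<tau>. \<tau> \<subseteq> E \<and> card \<tau> + 1 = r \<and> supp E (dvec E P \<tau>) \<noteq> {} \<longrightarrow> orthogonal E Y (dvec E P \<tau>))"
      unfolding sc by simp
    also have "\<dots> \<longleftrightarrow> vec E r P Y"
      unfolding vec_def by (metis orthogonal_empty_supp)
    finally show ?thesis .
  qed
  then show ?thesis
    unfolding vectors_def perp_def cocircuits_of_plucker[OF assms] of_plucker_simps by simp
qed

section \<open>Matroids are determined by their circuits\<close>

lemma vec_cong: "(\<And>i. i \<in> E \<Longrightarrow> W i = W' i) \<Longrightarrow> vec E r P W \<longleftrightarrow> vec E r P W'"
  unfolding vec_def using orthogonal_cong[of E W W'] by metis

lemma covec_cong: "(\<And>i. i \<in> E \<Longrightarrow> W i = W' i) \<Longrightarrow> covec E r P W \<longleftrightarrow> covec E r P W'"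
  unfolding covec_def using orthogonal_cong[of E W W'] by metis

lemma supp_circuit_vector_subset: "supp E (cvec E P \<tau>) \<subseteq> \<tau>"
  by (auto simp: supp_def circuit_vector_def)

section \<open>Bases, circuits and vectors of one Pluecker vector\<close>

locale plucker =
  fixes E :: "'e::linorder set" and r :: nat and P :: "'e set \<Rightarrow> 'a::tract with_zero"
  assumes fin: "finite E" and pv: "plucker_vector E r P"
begin

definition basis :: "'e set \<Rightarrow> bool" where
  "basis B \<longleftrightarrow> B \<subseteq> E \<and> card B = r \<and> P B \<noteq> 0"

text \<open>These are the sets of \<open>r + 1\<close> elements that contain a basis, in general
  larger than the support of their circuit.\<close>

definition circ :: "'e set \<Rightarrow> bool" where
  "circ \<tau> \<longleftrightarrow> \<tau> \<subseteq> E \<and> card \<tau> = r + 1 \<and> supp E (cvec E P \<tau>) \<noteq> {}"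

lemma basis_exists: "\<exists>B. basis B"
  using plucker_vectorD(2)[OF pv] by (simp add: basis_def)

lemma basis_finite: "basis B \<Longrightarrow> finite B"
  using fin finite_subset by (auto simp: basis_def)

lemma vec_cvec: "\<tau> \<subseteq> E \<Longrightarrow> card \<tau> = r + 1 \<Longrightarrow> vec E r P (cvec E P \<tau>)"
  unfolding vec_def using cvec_perp_dvec[OF pv fin] by blast

lemma covec_dvec: "I \<subseteq> E \<Longrightarrow> card I + 1 = r \<Longrightarrow> covec E r P (dvec E P I)"
  unfolding covec_def using cvec_perp_dvec[OF pv fin] orthogonal_sym by blast

text \<open>Up to scaling, \<open>dvec E P (B - {j})\<close> is the fundamental cocircuit of
  \<open>j\<close>: it meets \<open>B\<close> in \<open>j\<close> only.\<close>

lemma dvec_basis: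
  assumes "basis B" "j \<in> B"
  shows "B - {j} \<subseteq> E" "card (B - {j}) + 1 = r" "dvec E P (B - {j}) j \<noteq> 0"
    "\<And>i. i \<in> B - {j} \<Longrightarrow> dvec E P (B - {j}) i = 0"
proof -
  have "insert j (B - {j}) = B" using assms by blast
  then show "dvec E P (B - {j}) j \<noteq> 0" using assms by (auto simp: basis_def dvec_apply)
  show "card (B - {j}) + 1 = r"
    using card_Suc_Diff1[OF basis_finite[OF assms(1)] assms(2)] assms(1) by (simp add: basis_def)
qed (use assms in \<open>auto simp: basis_def dvec_apply\<close>)

text \<open>Up to scaling, the circuit vector at \<open>insert k B\<close> is the fundamental
  circuit of \<open>k\<close>; its entry at \<open>k\<close> is \<open>P B\<close> up to
  sign.\<close>

lemma cvec_basis: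
  assumes "basis B" "k \<in> E - B"
  shows "insert k B \<subseteq> E" "card (insert k B) = r + 1" "cvec E P (insert k B) k \<noteq> 0"
    "circ (insert k B)"
proof -
  show 1: "insert k B \<subseteq> E" using assms by (auto simp: basis_def)
  show 2: "card (insert k B) = r + 1" using assms basis_finite[OF assms(1)] by (auto simp: basis_def)
  have "insert k B - {k} = B" using assms by blast
  then show 3: "cvec E P (insert k B) k \<noteq> 0" using assms by (auto simp: basis_def cvec_apply)
  show "circ (insert k B)" using 1 2 3 by (auto simp: circ_def supp_def)
qed

text \<open>Every circuit is fundamental, namely for the basis left after deleting an element of its
  support from \<open>\<tau>\<close>.\<close>

lemma circ_basis:
  assumes "circ \<tau>" "k \<in> supp E (cvec E P \<tau>)"
  shows "basis (\<tau> - {k})" "k \<in> E - (\<tau> - {k})" "insert k (\<tau> - {k}) = \<tau>"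
proof -
  have k: "k \<in> \<tau>" "k \<in> E" "P (\<tau> - {k}) \<noteq> 0" using assms(2) by (auto simp: supp_def cvec_apply split: if_splits)
  then show "basis (\<tau> - {k})" using assms(1) fin finite_subset[of \<tau> E]
    by (auto simp: basis_def circ_def)
  show "k \<in> E - (\<tau> - {k})" "insert k (\<tau> - {k}) = \<tau>" using k by auto
qed

text \<open>The cocircuit at \<open>B - {i}\<close> meets \<open>B\<close> in \<open>i\<close> only,
  so the orthogonality sum has a single term.\<close>

lemma vec_zero:
  assumes "vec E r P W" "basis B" "supp E W \<subseteq> B" "i \<in> E"
  shows "W i = 0"
proof (cases "i \<in> B")
  case True
  have "orthogonal E W (dvec E P (B - {i}))"
    using assms(1) dvec_basis[OF assms(2) True] by (simp add: vec_def)
  moreover have "W e = 0 \<or> dvec E P (B - {i}) e = 0" if "e \<in> E - {i}" for e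
    using that assms(3) by (auto simp: supp_def dvec_apply)
  ultimately have "orthogonal {i} W (dvec E P (B - {i}))"
    using orthogonal_subset[OF fin, of "{i}"] assms(4) by blast
  then show ?thesis using dvec_basis[OF assms(2) True] by (simp add: orthogonal_null_sum)
qed (use assms in \<open>auto simp: supp_def\<close>)

text \<open>The cocircuit at \<open>B - {j}\<close> meets \<open>insert k B\<close> in at most
  \<open>j\<close> and \<open>k\<close>, and a null sum of two terms is an equation.\<close>

lemma vec_entry:
  assumes "vec E r P W" "basis B" "j \<in> B" "k \<in> E - B" "supp E W \<subseteq> insert k B"
  shows "W j * bar (dvec E P (B - {j}) j) = neg * (W k * bar (dvec E P (B - {j}) k))"
proof -
  have "orthogonal E W (dvec E P (B - {j}))"
    using assms(1) dvec_basis[OF assms(2,3)] by (simp add: vec_def)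
  moreover have "W e = 0 \<or> dvec E P (B - {j}) e = 0" if "e \<in> E - {k, j}" for e
    using that assms(5) by (auto simp: supp_def dvec_apply)
  moreover have "{k, j} \<subseteq> E" using assms by (auto simp: basis_def)
  ultimately have "orthogonal {k, j} W (dvec E P (B - {j}))"
    using orthogonal_subset[OF fin, of "{k, j}"] by blast
  then show ?thesis using assms by (subst (asm) orthogonal_null_sum, subst (asm) null_sum_pair) auto
qed

text \<open>By \<open>vec_entry\<close> the entry at \<open>k\<close> forces all others. The factor
  \<open>c\<close> may be zero: \<open>vec_minimal\<close> learns only afterwards that its factor is
  not.\<close>

lemma vec_unique:
  assumes W: "vec E r P W" "supp E W \<subseteq> insert k B" and W': "vec E r P W'" "supp E W' \<subseteq> insert k B"
    and B: "basis B" "k \<in> E - B" and eq: "W k = c * W' k" and i: "i \<in> E"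
  shows "W i = c * W' i"
proof -
  consider "i = k" | "i \<in> B" | "i \<notin> insert k B" by blast
  then show ?thesis
  proof cases
    case 2
    let ?d = "bar (dvec E P (B - {i}) i)"
    have "?d * W i = neg * (W k * bar (dvec E P (B - {i}) k))"
      using vec_entry[OF W(1) B(1) 2 B(2) W(2)] by (simp add: mult.commute)
    also have "\<dots> = c * (neg * (W' k * bar (dvec E P (B - {i}) k)))"
      by (simp add: eq ac_simps)
    also have "\<dots> = ?d * (c * W' i)"
      using vec_entry[OF W'(1) B(1) 2 B(2) W'(2)] by (simp add: ac_simps)
    finally show ?thesis using dvec_basis(3)[OF B(1) 2] by simp
  next
    case 3
    then have "W i = 0" "W' i = 0" using W(2) W'(2) i by (auto simp: supp_def)
    then show ?thesis by simp
  qed (use eq in simp)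
qed

text \<open>Take a basis \<open>B\<close> that meets \<open>S\<close> in as many elements as
  possible. If \<open>x\<close> in \<open>S\<close> were missing, the fundamental circuit of
  \<open>x\<close> would have an element \<open>b\<close> outside \<open>S\<close>, and exchanging
  \<open>b\<close> for \<open>x\<close> would enlarge the intersection.\<close>

lemma basis_extend:
  assumes "S \<subseteq> E" "\<And>\<tau>. circ \<tau> \<Longrightarrow> \<not> supp E (cvec E P \<tau>) \<subseteq> S"
  shows "\<exists>B. basis B \<and> S \<subseteq> B"
proof -
  have "finite S" using assms(1) fin finite_subset by blast
  obtain B where B: "basis B" and max: "\<And>B'. basis B' \<Longrightarrow> card (B' \<inter> S) \<le> card (B \<inter> S)"
    using ex_has_greatest_nat[of basis _ "\<lambda>B. card (B \<inter> S)" "Suc (card S)"] basis_exists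
      card_mono[OF \<open>finite S\<close>, of "_ \<inter> S"] by (metis inf_le2 le_imp_less_Suc)
  have "S \<subseteq> B"
  proof (rule ccontr)
    assume "\<not> S \<subseteq> B"
    then obtain x where x: "x \<in> S" "x \<notin> B" by blast
    then have "x \<in> E - B" using assms(1) by blast
    note c = cvec_basis[OF B this]
    obtain b where b: "b \<in> supp E (cvec E P (insert x B))" "b \<notin> S"
      using assms(2)[OF c(4)] by blast
    then have "basis (insert x B - {b})" using circ_basis(1)[OF c(4)] by blast
    moreover have "b \<noteq> x" using b x by blast
    then have "(insert x B - {b}) \<inter> S = insert x (B \<inter> S)" using b x by blast
    then have "card ((insert x B - {b}) \<inter> S) = Suc (card (B \<inter> S))"
      using x \<open>finite S\<close> by simp
    ultimately show False using max by fastforce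
  qed
  then show ?thesis using B by blast
qed

text \<open>The factor is the ratio of the entries at some \<open>k\<close> in the support of the
  circuit. If it were zero, \<open>W\<close> would vanish everywhere.\<close>

lemma vec_minimal:
  assumes "vec E r P W" "circ \<tau>" "supp E W \<subseteq> supp E (cvec E P \<tau>)" "supp E W \<noteq> {}"
  obtains c where "\<And>i. i \<in> E \<Longrightarrow> W i = Unit c * cvec E P \<tau> i"
proof -
  obtain k where k: "k \<in> supp E (cvec E P \<tau>)" using assms(2) by (auto simp: circ_def)
  note b = circ_basis[OF assms(2) k]
  have sub: "supp E (cvec E P \<tau>) \<subseteq> insert k (\<tau> - {k})"
    using supp_circuit_vector_subset b(3) by metis
  obtain d where d: "cvec E P \<tau> k * d = 1" using k with_zero_inverse by (auto simp: supp_def)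
  then have Wk: "W k = (W k * d) * cvec E P \<tau> k" by (simp add: mult.assoc mult.commute[of d])
  have *: "W i = (W k * d) * cvec E P \<tau> i" if "i \<in> E" for i
  proof (rule vec_unique)
    show "vec E r P (cvec E P \<tau>)" using vec_cvec assms(2) by (simp add: circ_def)
    show "supp E W \<subseteq> insert k (\<tau> - {k})" using assms(3) sub by blast
  qed (use assms(1) sub b that Wk in auto)
  then have "W k * d \<noteq> 0" using assms(4) by (auto simp: supp_def)
  then show ?thesis using that * nonzero_cases by metis
qed

section \<open>Circuits as the vectors of minimal support\<close>

abbreviation mat :: "('e, 'a) matroid" where "mat \<equiv> of_plucker E r P"

lemma circuits_mat: "circuits mat = {\<lambda>i\<in>E. Unit c * cvec E P \<tau> i | c \<tau>. circ \<tau>}"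
  using circuits_of_plucker[OF fin, of r P] by (simp add: circ_def)

lemma cvec_in_circuits: "circ \<tau> \<Longrightarrow> cvec E P \<tau> \<in> circuits mat"
  unfolding circuits_mat
  by (rule CollectI, rule exI[of _ 1], rule exI[of _ \<tau>])
    (auto simp: circuit_vector_def one_with_zero_def[symmetric])

lemma vec_scale: "vec E r P W \<Longrightarrow> (\<And>i. i \<in> E \<Longrightarrow> W' i = Unit c * W i) \<Longrightarrow> vec E r P W'"
  unfolding vec_def using orthogonal_scale[of "Unit c" E W' W] orthogonal_sym by (metis Unit_neq_zero(1))

lemma circuits_matD:
  assumes "C \<in> circuits mat"
  obtains c \<tau> where "circ \<tau>" "\<And>i. i \<in> E \<Longrightarrow> C i = Unit c * cvec E P \<tau> i" "C \<in> tuples E"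
    "vec E r P C" "supp E C = supp E (cvec E P \<tau>)" "supp E C \<noteq> {}"
proof -
  obtain c \<tau> where c: "circ \<tau>" "C = (\<lambda>i\<in>E. Unit c * cvec E P \<tau> i)" using assms by (auto simp: circuits_mat)
  then have 1: "\<And>i. i \<in> E \<Longrightarrow> C i = Unit c * cvec E P \<tau> i" "C \<in> tuples E" by auto
  have 2: "vec E r P C" using vec_scale[OF vec_cvec 1(1)] c(1) by (simp add: circ_def)
  have 3: "supp E C = supp E (cvec E P \<tau>)" using 1 by (auto simp: supp_def)
  show ?thesis using that[OF c(1) 1 2 3] 3 c(1) by (auto simp: circ_def)
qed

text \<open>The support of a nonzero vector lies in no basis, so by \<open>basis_extend\<close> it
  contains the support of a circuit. The family \<open>\<W>\<close> is arbitrary between the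
  circuits and the vectors because contraction supplies restricted circuits, which need be neither
  all the vectors nor circuits only.\<close>

lemma min_supp_vectors:
  assumes "\<W> \<subseteq> tuples E" "\<And>W. W \<in> \<W> \<Longrightarrow> vec E r P W" "circuits mat \<subseteq> \<W>"
  shows "min_supp E \<W> = circuits mat"
proof (intro subset_antisym subsetI)
  fix W assume "W \<in> min_supp E \<W>"
  then have W: "W \<in> \<W>" "supp E W \<noteq> {}" "\<And>Y. Y \<in> \<W> \<Longrightarrow> supp E Y \<noteq> {} \<Longrightarrow> \<not> supp E Y \<subset> supp E W"
    by (auto simp: min_supp_def)
  obtain \<tau> where \<tau>: "circ \<tau>" "supp E (cvec E P \<tau>) \<subseteq> supp E W"
  proof (rule ccontr)
    assume "\<not> thesis"
    then have "\<exists>B. basis B \<and> supp E W \<subseteq> B" using that by (intro basis_extend) (auto simp: supp_def)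
    then show False using vec_zero assms(2) W(1,2) by (force simp: supp_def)
  qed
  then have "supp E (cvec E P \<tau>) = supp E W"
    using W(3)[of "cvec E P \<tau>"] cvec_in_circuits assms(3) by (auto simp: circ_def)
  then obtain c where "\<And>i. i \<in> E \<Longrightarrow> W i = Unit c * cvec E P \<tau> i"
    using vec_minimal[OF assms(2)[OF W(1)] \<tau>(1)] W(2) by auto
  moreover have "W \<in> tuples E" using W assms(1) by blast
  ultimately have "W = (\<lambda>i\<in>E. Unit c * cvec E P \<tau> i)" by (auto simp: PiE_iff extensional_def)
  then show "W \<in> circuits mat" using \<tau>(1) by (auto simp: circuits_mat)
next
  fix C assume C: "C \<in> circuits mat"
  obtain c \<tau> where \<tau>: "circ \<tau>" "supp E C = supp E (cvec E P \<tau>)" "supp E C \<noteq> {}"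
    using circuits_matD[OF C] by metis
  have "\<not> supp E Y \<subset> supp E C" if Y: "Y \<in> \<W>" "supp E Y \<noteq> {}" for Y
  proof
    assume lt: "supp E Y \<subset> supp E C"
    then obtain d where "\<And>i. i \<in> E \<Longrightarrow> Y i = Unit d * cvec E P \<tau> i"
      using vec_minimal[OF assms(2)[OF Y(1)] \<tau>(1)] \<tau>(2) Y(2) by auto
    then have "supp E Y = supp E C" unfolding \<tau>(2) by (auto simp: supp_def)
    then show False using lt by simp
  qed
  then show "C \<in> min_supp E \<W>" using C assms(3) \<tau>(3) by (auto simp: min_supp_def)
qed

text \<open>Phrased through \<open>circuits\<close> alone, so that the hypothesis can be transferred
  between two Pluecker vectors with the same circuits.\<close>

lemma basis_extend_circuits:
  assumes "\<And>C. C \<in> circuits mat \<Longrightarrow> \<not> supp E C \<subseteq> S" "S \<subseteq> E"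
  shows "\<exists>B. basis B \<and> S \<subseteq> B"
  using basis_extend[OF assms(2)] assms(1) cvec_in_circuits by blast

lemma circuit_not_in_basis: "C \<in> circuits mat \<Longrightarrow> basis B \<Longrightarrow> \<not> supp E C \<subseteq> B"
  by (elim circuits_matD) (use vec_zero in \<open>force simp: supp_def\<close>)

end

text \<open>Bases contain no circuit, and sets without circuits extend to bases. The ranks are not
  known to agree, so a basis of the second matroid is squeezed between \<open>B\<close> and a basis
  \<open>B2\<close> of the first; \<open>B\<close> and \<open>B2\<close> both have \<open>r\<close>
  elements.\<close>

lemma circuits_determine_bases:
  assumes "plucker E r P" "plucker E r' P'"
    and eq: "circuits (of_plucker E r P) = circuits (of_plucker E r' P')"
    and B: "plucker.basis E r P B"
  shows "plucker.basis E r' P' B"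
proof -
  interpret A: plucker E r P by fact
  interpret B: plucker E r' P' by fact
  obtain B1 where B1: "B.basis B1" "B \<subseteq> B1"
    using B.basis_extend_circuits[of B] A.circuit_not_in_basis[OF _ B] B eq by (auto simp: A.basis_def)
  obtain B2 where B2: "A.basis B2" "B1 \<subseteq> B2"
    using A.basis_extend_circuits[of B1] B.circuit_not_in_basis[OF _ B1(1)] B1 eq by (auto simp: B.basis_def)
  have "B = B2" using B B2 B1 A.basis_finite[OF B2(1)] by (intro card_subset_eq) (auto simp: A.basis_def)
  then show ?thesis using B1 B2 by auto
qed

lemma of_plucker_eqI:
  assumes "plucker E r P" "plucker E r' P'"
    and eq: "circuits (of_plucker E r P) = circuits (of_plucker E r' P')"
  shows "of_plucker E r P = of_plucker E r' P'"
proof -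
  interpret A: plucker E r P by fact
  interpret B: plucker E r' P' by fact
  have bases: "A.basis B \<longleftrightarrow> B.basis B" for B
    using circuits_determine_bases[OF assms] circuits_determine_bases[OF assms(2,1) eq[symmetric]] by blast
  obtain B0 where B0: "A.basis B0" using A.basis_exists by blast
  then have rr: "r' = r" using bases by (auto simp: A.basis_def B.basis_def)
  obtain d where d: "P' B0 * d = 1" "d \<noteq> 0"
    using with_zero_inverse[of "P' B0"] B0 bases by (metis B.basis_def)
  define c where "c = P B0 * d"
  have c: "c \<noteq> 0" "P B0 = c * P' B0"
    using d B0 by (auto simp: c_def A.basis_def mult.assoc mult.commute[of d])
  \<comment> \<open>The ratio at \<open>B0\<close> spreads along basis exchanges. Some
    \<open>x\<close> of \<open>B0\<close> replaces some \<open>b\<close> outside \<open>B0\<close>.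
    The circuit vectors of \<open>P\<close> and \<open>P'\<close> at \<open>insert x B\<close> are
    both vectors of \<open>P'\<close>; by induction their ratio at \<open>b\<close> is
    \<open>c\<close>, hence also at \<open>x\<close>, where the entries are \<open>P B\<close> and
    \<open>P' B\<close> up to the same sign.\<close>
  have ratio: "P B = c * P' B" if "A.basis B" for B
    using that
  proof (induction "card (B - B0)" arbitrary: B rule: less_induct)
    case less
    show ?case
    proof (cases "B = B0")
      case False
      have fB: "finite B" "finite B0" using less.prems B0 A.basis_finite by auto
      have "\<not> B0 \<subseteq> B"
        using False less.prems B0 fB card_subset_eq[of B B0] by (auto simp: A.basis_def)
      then obtain x where x: "x \<in> B0" "x \<notin> B" by blast
      then have xE: "x \<in> E - B" using B0 by (auto simp: A.basis_def)
      let ?\<tau> = "insert x B"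
      note cA = A.cvec_basis[OF less.prems xE] and cB = B.cvec_basis[OF less.prems[unfolded bases] xE]
      have "\<not> supp E (cvec E P ?\<tau>) \<subseteq> B0"
        using A.circuit_not_in_basis A.cvec_in_circuits cA(4) B0 by blast
      then obtain b where b: "b \<in> supp E (cvec E P ?\<tau>)" "b \<notin> B0" by blast
      have bB: "b \<in> B" using b x supp_circuit_vector_subset[of E P ?\<tau>] by auto
      define B1 where "B1 = ?\<tau> - {b}"
      have B1: "A.basis B1" "b \<in> E - B1" "insert b B1 = ?\<tau>"
        using A.circ_basis[OF cA(4) b(1)] by (auto simp: B1_def)
      have "B1 - B0 \<subset> B - B0" using x b bB by (auto simp: B1_def)
      then have IH: "P B1 = c * P' B1"
        using less.hyps[OF psubset_card_mono B1(1)] fB by blast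
      have "cvec E P ?\<tau> \<in> circuits (of_plucker E r' P')"
        using A.cvec_in_circuits[OF cA(4)] eq by simp
      then have v1: "vec E r' P' (cvec E P ?\<tau>)" by (rule B.circuits_matD)
      have v2: "vec E r' P' (cvec E P' ?\<tau>)" using B.vec_cvec cB by blast
      have at: "cvec E Q ?\<tau> b = neg ^ card {j \<in> ?\<tau>. j < b} * Q B1" for Q :: "'a set \<Rightarrow> 'b with_zero"
        using B1 bB by (simp add: cvec_apply B1_def[symmetric])
      have "cvec E P ?\<tau> x = c * cvec E P' ?\<tau> x"
        by (rule B.vec_unique[OF v1 _ v2 _ B1(1)[unfolded bases] B1(2)])
          (use supp_circuit_vector_subset[of E _ ?\<tau>] B1(3) xE in \<open>auto simp: at IH ac_simps\<close>)
      moreover have "cvec E Q ?\<tau> x = neg ^ card {j \<in> ?\<tau>. j < x} * Q B" for Q :: "'a set \<Rightarrow> 'b with_zero"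
        using x xE by (simp add: cvec_apply)
      ultimately have "neg ^ card {j \<in> ?\<tau>. j < x} * P B = neg ^ card {j \<in> ?\<tau>. j < x} * (c * P' B)"
        by (simp add: ac_simps)
      then show ?thesis by simp
    qed (use c in simp)
  qed
  have ratio': "P B = c * P' B" if "B \<subseteq> E" "card B = r" for B
  proof (cases "P B = 0")
    case True
    then have "\<not> B.basis B" using bases by (auto simp: A.basis_def)
    then show ?thesis using True that rr unfolding B.basis_def by simp
  qed (use ratio that in \<open>auto simp: A.basis_def\<close>)
  obtain c' where c': "c = Unit c'" using c(1) by (rule nonzero_cases)
  obtain d' where d': "c' * d' = 1" using mult_inverse_ex by blast
  have 1: "(\<lambda>I\<in>subsets_of_card E r. Unit e * P I) = (\<lambda>I\<in>subsets_of_card E r. Unit (e * c') * P' I)" for e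
    using ratio' by (auto simp: c' mult.assoc simp flip: times_with_zero.simps(1))
  have 2: "(\<lambda>I\<in>subsets_of_card E r. Unit e * P' I) = (\<lambda>I\<in>subsets_of_card E r. Unit (e * d') * P I)" for e
    unfolding 1 using d' by (simp add: mult.assoc mult.commute[of d'])
  show ?thesis unfolding of_plucker_def rr
    using 1 2 by (auto simp only: matroid.inject)
qed

lemma is_matroid_plucker:
  assumes "is_matroid M"
  obtains P where "plucker (ground M) (rank M) P" "M = of_plucker (ground M) (rank M) P"
  using is_matroidE[OF assms] by (metis plucker.intro)

lemma matroid_eqI:
  assumes "is_matroid M" "is_matroid N" "ground M = ground N" "circuits M = circuits N"
  shows "M = N"
  using assms(1,2)
proof (elim is_matroid_plucker)
  fix P Q
  assume *: "plucker (ground M) (rank M) P" "M = of_plucker (ground M) (rank M) P"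
    "plucker (ground N) (rank N) Q" "N = of_plucker (ground N) (rank N) Q"
  have "of_plucker (ground M) (rank M) P = of_plucker (ground M) (rank N) Q"
    by (rule of_plucker_eqI) (use * assms(3,4) in auto)
  then show ?thesis using * assms(3) by simp
qed

section \<open>Contractions and coloops\<close>

text \<open>For disjoint \<open>I\<close> and \<open>A\<close> this counts the inversions in the
  list \<open>I\<close> followed by \<open>A\<close>. Being a sum over \<open>I\<close>, it changes
  by a term in \<open>j\<close> alone when \<open>j\<close> is inserted or removed.\<close>

definition shift :: "'e::linorder set \<Rightarrow> 'e set \<Rightarrow> nat" where
  "shift A I = (\<Sum>i\<in>I. card {a \<in> A. a < i})"

lemma shift_insert: "finite I \<Longrightarrow> j \<notin> I \<Longrightarrow> shift A (insert j I) = card {a \<in> A. a < j} + shift A I"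
  by (simp add: shift_def)

lemma shift_remove: "finite J \<Longrightarrow> j \<in> J \<Longrightarrow> shift A J = card {a \<in> A. a < j} + shift A (J - {j})"
  by (simp add: shift_def sum.remove)

lemma card_filter_Un:
  "finite I \<Longrightarrow> finite A \<Longrightarrow> I \<inter> A = {} \<Longrightarrow> card {x \<in> I \<union> A. Q x} = card {x \<in> I. Q x} + card {x \<in> A. Q x}"
  by (subst card_Un_disjoint[symmetric]) (auto intro: arg_cong[where f = card])

text \<open>The elements of \<open>A\<close> above \<open>j\<close> are counted twice, once with
  each set.\<close>

lemma plucker_sign_Un:
  assumes "finite I" "finite J" "finite A" "I \<inter> A = {}" "J \<inter> A = {}"
  shows "plucker_sign j (I \<union> A) (J \<union> A) = plucker_sign j I J"
  unfolding plucker_sign_def Unit_neg_one_power card_filter_Un[OF assms(1,3,4)] card_filter_Un[OF assms(2,3,5)]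
  by (rule neg_power_cong) presburger

text \<open>Uniqueness is \<open>matroid_eqI\<close>. Thus \<open>contract\<close> and
  \<open>add_coloops\<close> are evaluated by exhibiting one explicit Pluecker vector with the
  prescribed circuits.\<close>

lemma the_matroid:
  assumes "is_matroid M" "ground M = G" "circuits M = \<C>"
  shows "(THE N. is_matroid N \<and> ground N = G \<and> circuits N = \<C>) = M"
proof (rule the_equality)
  fix N assume "is_matroid N \<and> ground N = G \<and> circuits N = \<C>"
  then show "N = M" using assms by (intro matroid_eqI) simp_all
qed (use assms in simp)

section \<open>An explicit Pluecker vector of the contraction\<close>

context plucker
begin

text \<open>By maximality its intersection with \<open>A\<close> is a maximal independent subset of
  \<open>A\<close>; another choice would only rescale the Pluecker vector of the
  contraction.\<close>

definition contr_basis :: "'e set \<Rightarrow> 'e set" where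
  "contr_basis A = (SOME B. basis B \<and> (\<forall>B'. basis B' \<longrightarrow> card (B' \<inter> A) \<le> card (B \<inter> A)))"

lemma contr_basis:
  assumes "A \<subseteq> E"
  shows "basis (contr_basis A)" "basis B \<Longrightarrow> card (B \<inter> A) \<le> card (contr_basis A \<inter> A)"
proof -
  have "finite A" using assms fin finite_subset by blast
  then have "\<exists>B. basis B \<and> (\<forall>B'. basis B' \<longrightarrow> card (B' \<inter> A) \<le> card (B \<inter> A))"
    using ex_has_greatest_nat[of basis _ "\<lambda>B. card (B \<inter> A)" "Suc (card A)"] basis_exists
      card_mono[OF \<open>finite A\<close>, of "_ \<inter> A"] by (metis inf_le2 le_imp_less_Suc)
  from someI_ex[OF this] show "basis (contr_basis A)"
    "basis B \<Longrightarrow> card (B \<inter> A) \<le> card (contr_basis A \<inter> A)"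
    unfolding contr_basis_def by blast+
qed

definition contr_rank :: "'e set \<Rightarrow> nat" where
  "contr_rank A = card (contr_basis A - A)"

text \<open>As an alternating function, \<open>P(i\<^sub>1, \<dots>, i\<^sub>s, a\<^sub>1, \<dots>, a\<^sub>l)\<close> where the \<open>a\<^sub>k\<close> enumerate the
  intersection of \<open>A\<close> with the chosen basis; the power of \<open>-1\<close> sorts the arguments.\<close>

definition contr_plucker :: "'e set \<Rightarrow> 'e set \<Rightarrow> 'a with_zero" where
  "contr_plucker A = (\<lambda>I\<in>subsets_of_card (E - A) (contr_rank A).
     neg ^ shift (contr_basis A \<inter> A) I * P (I \<union> (contr_basis A \<inter> A)))"

lemma contr_card:
  assumes "A \<subseteq> E" "I \<subseteq> E - A"
  shows "I \<inter> (contr_basis A \<inter> A) = {}" "finite I" "finite (contr_basis A \<inter> A)"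
    "I \<union> (contr_basis A \<inter> A) \<subseteq> E"
    "card (I \<union> (contr_basis A \<inter> A)) = card I + card (contr_basis A \<inter> A)"
    "r = contr_rank A + card (contr_basis A \<inter> A)"
proof -
  have b: "basis (contr_basis A)" using contr_basis assms by blast
  show 1: "I \<inter> (contr_basis A \<inter> A) = {}" "finite I" "finite (contr_basis A \<inter> A)"
    using assms fin finite_subset[of I E] basis_finite[OF b] by auto
  show "I \<union> (contr_basis A \<inter> A) \<subseteq> E" using assms by blast
  show "card (I \<union> (contr_basis A \<inter> A)) = card I + card (contr_basis A \<inter> A)"
    using 1 by (simp add: card_Un_disjoint)
  have "card (contr_basis A) = card (contr_basis A - A) + card (contr_basis A \<inter> A)"
    using basis_finite[OF b] by (subst card_Un_disjoint[symmetric]) (auto intro!: arg_cong[where f = card])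
  then show "r = contr_rank A + card (contr_basis A \<inter> A)"
    using b by (simp add: basis_def contr_rank_def)
qed

lemma contr_plucker_apply:
  "I \<subseteq> E - A \<Longrightarrow> card I = contr_rank A \<Longrightarrow>
    contr_plucker A I = neg ^ shift (contr_basis A \<inter> A) I * P (I \<union> (contr_basis A \<inter> A))"
  by (simp add: contr_plucker_def)

lemma contr_plucker_vector:
  assumes "A \<subseteq> E"
  shows "plucker (E - A) (contr_rank A) (contr_plucker A)"
proof (rule plucker.intro)
  show "finite (E - A)" using fin by simp
  let ?A = "contr_basis A \<inter> A"
  show "plucker_vector (E - A) (contr_rank A) (contr_plucker A)"
    unfolding plucker_vector_def
  proof (intro conjI allI impI)
    show "contr_plucker A \<in> tuples (subsets_of_card (E - A) (contr_rank A))"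
      by (simp add: contr_plucker_def)
    have b: "basis (contr_basis A)" using contr_basis assms by blast
    moreover have "contr_basis A - A \<union> ?A = contr_basis A" by blast
    ultimately have "contr_plucker A (contr_basis A - A) \<noteq> 0"
      by (subst contr_plucker_apply) (auto simp: contr_rank_def basis_def)
    then show "\<exists>B\<in>subsets_of_card (E - A) (contr_rank A). contr_plucker A B \<noteq> 0"
      using b by (intro bexI[of _ "contr_basis A - A"]) (auto simp: contr_rank_def basis_def)
  next
    fix I J
    assume "I \<subseteq> E - A \<and> card I + 1 = contr_rank A \<and> J \<subseteq> E - A \<and> card J = contr_rank A + 1"
    then have I: "I \<subseteq> E - A" "card I + 1 = contr_rank A" and J: "J \<subseteq> E - A" "card J = contr_rank A + 1"
      by auto
    note cI = contr_card[OF assms I(1)] and cJ = contr_card[OF assms J(1)]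
    have "null_sum (\<lambda>j. plucker_sign j (I \<union> ?A) (J \<union> ?A) * P (insert j (I \<union> ?A)) * P (J \<union> ?A - {j}))
        ((J \<union> ?A) - (I \<union> ?A))"
      using pv cI(4,5,6) cJ(4,5,6) I(2) J(2) by (simp add: plucker_vector_def null_sum_def)
    \<comment> \<open>In each term \<open>j\<close> moves from \<open>J\<close> to \<open>I\<close>
      and takes its share of the shift along, so the total shift of the two arguments is the same
      for all \<open>j\<close>.\<close>
    then have "null_sum (\<lambda>j. neg ^ (shift ?A I + shift ?A J) * (plucker_sign j (I \<union> ?A) (J \<union> ?A) *
        P (insert j (I \<union> ?A)) * P (J \<union> ?A - {j}))) ((J \<union> ?A) - (I \<union> ?A))"
      by (rule null_sum_scale)
    also have "?this \<longleftrightarrow> null_sum (\<lambda>j. plucker_sign j I J * contr_plucker A (insert j I) * contr_plucker A (J - {j})) (J - I)"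
    proof (rule null_sum_cong)
      show e: "J \<union> ?A - (I \<union> ?A) = J - I" using cJ(1) by blast
      fix j assume "j \<in> J \<union> ?A - (I \<union> ?A)"
      then have j: "j \<in> J" "j \<notin> I" "j \<in> E - A" using e J by auto
      have 1: "contr_plucker A (insert j I) = neg ^ shift ?A (insert j I) * P (insert j (I \<union> ?A))"
        using contr_plucker_apply[of "insert j I" A] I j cI(2) by simp
      have "J - {j} \<union> ?A = J \<union> ?A - {j}" using j by blast
      then have 2: "contr_plucker A (J - {j}) = neg ^ shift ?A (J - {j}) * P (J \<union> ?A - {j})"
        using contr_plucker_apply[of "J - {j}" A] J j cJ(2) by auto
      have 3: "neg ^ (shift ?A I + shift ?A J) = neg ^ shift ?A (insert j I) * neg ^ shift ?A (J - {j})"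
        unfolding power_add[symmetric]
        by (rule neg_power_cong) (use shift_insert[OF cI(2) j(2), of ?A] shift_remove[OF cJ(2) j(1), of ?A] in presburger)
      show "neg ^ (shift ?A I + shift ?A J) * (plucker_sign j (I \<union> ?A) (J \<union> ?A) * P (insert j (I \<union> ?A)) * P (J \<union> ?A - {j}))
        = plucker_sign j I J * contr_plucker A (insert j I) * contr_plucker A (J - {j})"
        unfolding 1 2 3 plucker_sign_Un[OF cI(2) cJ(2) cI(3) cI(1) cJ(1)] by (simp only: ac_simps)
    qed
    finally show "is_null {#plucker_sign j I J * contr_plucker A (insert j I) * contr_plucker A (J - {j}). j \<in># mset_set (J - I)#}"
      by (simp add: null_sum_def)
  qed
qed

lemma cvec_contr:
  assumes "A \<subseteq> E" "\<tau> \<subseteq> E - A" "card \<tau> = contr_rank A + 1" "i \<in> E - A"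
  shows "cvec (E - A) (contr_plucker A) \<tau> i =
    neg ^ shift (contr_basis A \<inter> A) \<tau> * cvec E P (\<tau> \<union> (contr_basis A \<inter> A)) i"
proof (cases "i \<in> \<tau>")
  case True
  let ?A = "contr_basis A \<inter> A"
  note c = contr_card[OF assms(1,2)]
  have "\<tau> - {i} \<union> ?A = \<tau> \<union> ?A - {i}" using assms(4) by blast
  then have 1: "contr_plucker A (\<tau> - {i}) = neg ^ shift ?A (\<tau> - {i}) * P (\<tau> \<union> ?A - {i})"
    using contr_plucker_apply[of "\<tau> - {i}" A] assms True c(2) by auto
  have 2: "neg ^ card {j \<in> \<tau>. j < i} * neg ^ shift ?A (\<tau> - {i}) =
    (neg ^ shift ?A \<tau> * neg ^ card {j \<in> \<tau> \<union> ?A. j < i} :: 'a with_zero)"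
    unfolding power_add[symmetric] card_filter_Un[OF c(2,3,1)]
    by (rule neg_power_cong) (use shift_remove[OF c(2) True, of ?A] in presburger)
  have "cvec (E - A) (contr_plucker A) \<tau> i =
      (neg ^ card {j \<in> \<tau>. j < i} * neg ^ shift ?A (\<tau> - {i})) * P (\<tau> \<union> ?A - {i})"
    using True assms(4) by (simp add: cvec_apply 1 mult.assoc)
  also have "\<dots> = neg ^ shift ?A \<tau> * cvec E P (\<tau> \<union> ?A) i"
    unfolding 2 using True assms(4) by (simp add: cvec_apply mult.assoc)
  finally show ?thesis .
qed (use assms in \<open>auto simp: cvec_apply\<close>)

lemma dvec_contr:
  assumes "A \<subseteq> E" "I \<subseteq> E - A" "card I + 1 = contr_rank A" "i \<in> E - A"
  shows "dvec (E - A) (contr_plucker A) I i =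
    neg ^ shift (contr_basis A \<inter> A) I * dvec E P (I \<union> (contr_basis A \<inter> A)) i"
proof (cases "i \<in> I")
  case False
  let ?A = "contr_basis A \<inter> A"
  note c = contr_card[OF assms(1,2)]
  have 1: "contr_plucker A (insert i I) = neg ^ shift ?A (insert i I) * P (insert i (I \<union> ?A))"
    using contr_plucker_apply[of "insert i I" A] assms False c(2) by simp
  have 2: "neg ^ card {j \<in> I. j < i} * neg ^ shift ?A (insert i I) =
    (neg ^ shift ?A I * neg ^ card {j \<in> I \<union> ?A. j < i} :: 'a with_zero)"
    unfolding power_add[symmetric] card_filter_Un[OF c(2,3,1)]
    by (rule neg_power_cong) (use shift_insert[OF c(2) False, of ?A] in presburger)
  have "dvec (E - A) (contr_plucker A) I i =
      (neg ^ card {j \<in> I. j < i} * neg ^ shift ?A (insert i I)) * bar (P (insert i (I \<union> ?A)))"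
    using False assms(4) by (simp add: dvec_apply 1 mult.assoc)
  also have "\<dots> = neg ^ shift ?A I * dvec E P (I \<union> ?A) i"
    unfolding 2 using False assms(4) by (simp add: dvec_apply mult.assoc)
  finally show ?thesis .
qed (use assms in \<open>auto simp: dvec_apply\<close>)

text \<open>Otherwise adding \<open>i\<close> would produce a basis that meets \<open>A\<close> in
  more elements than the chosen one.\<close>

lemma dvec_zero_on_contracted:
  assumes "A \<subseteq> E" "I \<subseteq> E - A" "card I + 1 = contr_rank A" "i \<in> A"
  shows "dvec E P (I \<union> (contr_basis A \<inter> A)) i = 0"
proof (rule ccontr)
  let ?A = "contr_basis A \<inter> A"
  note c = contr_card[OF assms(1,2)]
  assume "dvec E P (I \<union> ?A) i \<noteq> 0"
  then have i: "i \<notin> I \<union> ?A" "P (insert i (I \<union> ?A)) \<noteq> 0"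
    using assms by (auto simp: dvec_apply split: if_splits)
  have "card (insert i (I \<union> ?A)) = r"
    using i(1) c(2,3,5,6) assms(3) by (subst card_insert_disjoint) auto
  then have "basis (insert i (I \<union> ?A))" using i(2) c(4) assms(1,4) by (auto simp: basis_def)
  then have "card (insert i (I \<union> ?A) \<inter> A) \<le> card ?A" using contr_basis(2)[OF assms(1)] by blast
  moreover have "insert i (I \<union> ?A) \<inter> A = insert i ?A" using assms by blast
  moreover have "card (insert i ?A) = Suc (card ?A)" using i(1) c(3) by simp
  ultimately show False by simp
qed

text \<open>Up to sign, a cocircuit of the contraction is the restriction of a cocircuit that
  vanishes on \<open>A\<close>, so the entries of \<open>W\<close> on \<open>A\<close> do not
  contribute.\<close>

lemma vec_contr:
  assumes "A \<subseteq> E" "vec E r P W"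
  shows "vec (E - A) (contr_rank A) (contr_plucker A) W"
  unfolding vec_def
proof (intro allI impI, elim conjE)
  fix I assume I: "I \<subseteq> E - A" "card I + 1 = contr_rank A"
  let ?I = "I \<union> (contr_basis A \<inter> A)"
  note c = contr_card[OF assms(1) I(1)]
  have "orthogonal E W (dvec E P ?I)"
    using assms(2) c(4,5,6) I(2) by (simp add: vec_def)
  then have "orthogonal (E - A) W (dvec E P ?I)"
    using orthogonal_subset[OF fin, of "E - A" W "dvec E P ?I"]
      dvec_zero_on_contracted[OF assms(1) I] by auto
  then show "orthogonal (E - A) W (dvec (E - A) (contr_plucker A) I)"
    by (subst orthogonal_scale[of "neg ^ shift (contr_basis A \<inter> A) I", OF _ dvec_contr[OF assms(1) I]]) auto
qed

text \<open>Circuits of the contraction are restrictions of circuits that may be nonzero on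
  \<open>A\<close>; here it is \<open>Y\<close> that has to vanish there.\<close>

lemma covec_contr:
  assumes "A \<subseteq> E" "covec E r P Y" "\<And>i. i \<in> A \<Longrightarrow> Y i = 0"
  shows "covec (E - A) (contr_rank A) (contr_plucker A) Y"
  unfolding covec_def
proof (intro allI impI, elim conjE)
  fix \<tau> assume \<tau>: "\<tau> \<subseteq> E - A" "card \<tau> = contr_rank A + 1"
  let ?\<tau> = "\<tau> \<union> (contr_basis A \<inter> A)"
  note c = contr_card[OF assms(1) \<tau>(1)]
  have "orthogonal E Y (cvec E P ?\<tau>)"
    using assms(2) c(4,5,6) \<tau>(2) by (simp add: covec_def)
  then have "orthogonal (E - A) Y (cvec E P ?\<tau>)"
    using orthogonal_subset[OF fin, of "E - A" Y "cvec E P ?\<tau>"] assms(3) by auto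
  then show "orthogonal (E - A) Y (cvec (E - A) (contr_plucker A) \<tau>)"
    by (subst orthogonal_scale[of "neg ^ shift (contr_basis A \<inter> A) \<tau>", OF _ cvec_contr[OF assms(1) \<tau>]]) auto
qed

text \<open>An instance of \<open>min_supp_vectors\<close>: restricted circuits are vectors of the
  contraction by \<open>vec_contr\<close>, and each circuit of the contraction extends to a circuit
  after joining the chosen part of \<open>A\<close> to \<open>\<tau>\<close>.\<close>

lemma contract_mat:
  assumes "A \<subseteq> E"
  shows "contract mat A = of_plucker (E - A) (contr_rank A) (contr_plucker A)"
proof -
  interpret N: plucker "E - A" "contr_rank A" "contr_plucker A"
    using contr_plucker_vector[OF assms] .
  let ?W = "(\<lambda>C. restrict C (E - A)) ` circuits mat"
  have "min_supp (E - A) ?W = circuits N.mat"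
  proof (rule N.min_supp_vectors)
    show "?W \<subseteq> tuples (E - A)" by (simp add: image_subset_iff)
    fix W assume "W \<in> ?W"
    then obtain C where C: "C \<in> circuits mat" "W = restrict C (E - A)" by blast
    then have "vec E r P C" by (elim circuits_matD)
    then show "vec (E - A) (contr_rank A) (contr_plucker A) W"
      using vec_contr[OF assms, of C] vec_cong[of "E - A" W C] C(2) by simp
  next
    show "circuits N.mat \<subseteq> ?W"
    proof
      fix C assume "C \<in> circuits N.mat"
      then obtain c \<tau> where \<tau>: "N.circ \<tau>" "C = (\<lambda>i\<in>E - A. Unit c * cvec (E - A) (contr_plucker A) \<tau> i)"
        by (auto simp: N.circuits_mat)
      let ?\<tau> = "\<tau> \<union> (contr_basis A \<inter> A)"
      have t: "\<tau> \<subseteq> E - A" "card \<tau> = contr_rank A + 1" using \<tau>(1) by (auto simp: N.circ_def)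
      note cc = contr_card[OF assms t(1)] and cv = cvec_contr[OF assms t]
      have "supp (E - A) (cvec (E - A) (contr_plucker A) \<tau>) \<subseteq> supp E (cvec E P ?\<tau>)"
        using cv by (auto simp: supp_def)
      then have "circ ?\<tau>" using \<tau>(1) cc(4,5,6) t(2) by (auto simp: circ_def N.circ_def)
      then have "(\<lambda>i\<in>E. Unit (c * neg_one ^ shift (contr_basis A \<inter> A) \<tau>) * cvec E P ?\<tau> i) \<in> circuits mat"
        unfolding circuits_mat by blast
      moreover have "C = restrict (\<lambda>i\<in>E. Unit (c * neg_one ^ shift (contr_basis A \<inter> A) \<tau>) * cvec E P ?\<tau> i) (E - A)"
        unfolding \<tau>(2) using cv
        by (auto simp: mult.assoc Unit_neg_one_power simp flip: times_with_zero.simps(1))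
      ultimately show "C \<in> ?W" by blast
    qed
  qed
  then have e: "circuits N.mat = min_supp (E - A) ?W" ..
  have m: "is_matroid N.mat" using is_matroid_of_plucker[OF N.fin N.pv] .
  show ?thesis
    unfolding contract_def of_plucker_simps
    by (rule the_matroid[OF m _ e]) simp
qed

end

text \<open>A coloop lies in every basis, whence the case distinction; the sign sorts the list
  \<open>I - Z\<close> followed by \<open>Z\<close>.\<close>

definition coloop_plucker :: "'e::linorder set \<Rightarrow> nat \<Rightarrow> ('e set \<Rightarrow> 'a::tract with_zero) \<Rightarrow> 'e set \<Rightarrow> 'e set \<Rightarrow> 'a with_zero" where
  "coloop_plucker E r P Z = (\<lambda>I\<in>subsets_of_card (E \<union> Z) (r + card Z).
     if Z \<subseteq> I then neg ^ shift Z (I - Z) * P (I - Z) else 0)"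

section \<open>Circuits and covectors after adding coloops\<close>

context plucker
begin

context
  fixes Z :: "'e set"
  assumes Z: "finite Z" "E \<inter> Z = {}"
begin

lemma coloop_decompose:
  assumes "I \<subseteq> E \<union> Z" "Z \<subseteq> I"
  shows "I - Z \<subseteq> E" "finite (I - Z)" "(I - Z) \<inter> Z = {}" "I - Z \<union> Z = I" "card I = card (I - Z) + card Z"
proof -
  show 1: "I - Z \<subseteq> E" "(I - Z) \<inter> Z = {}" "I - Z \<union> Z = I" using assms Z by auto
  show 2: "finite (I - Z)" using fin 1 finite_subset by blast
  show "card I = card (I - Z) + card Z" using card_Un_disjoint[OF 2 Z(1) 1(2)] 1(3) by simp
qed

lemma coloop_plucker_vector: "plucker (E \<union> Z) (r + card Z) (coloop_plucker E r P Z)"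
proof (rule plucker.intro)
  show "finite (E \<union> Z)" using fin Z by simp
  let ?Q = "coloop_plucker E r P Z"
  show "plucker_vector (E \<union> Z) (r + card Z) ?Q"
    unfolding plucker_vector_def
  proof (intro conjI allI impI)
    show "?Q \<in> tuples (subsets_of_card (E \<union> Z) (r + card Z))" by (simp add: coloop_plucker_def)
    obtain B where B: "basis B" using basis_exists by blast
    have "B \<union> Z - Z = B" using B Z by (auto simp: basis_def)
    moreover have "card (B \<union> Z) = r + card Z"
      using B Z basis_finite[OF B] by (subst card_Un_disjoint) (auto simp: basis_def)
    ultimately have "B \<union> Z \<in> subsets_of_card (E \<union> Z) (r + card Z)" "?Q (B \<union> Z) \<noteq> 0"
      using B by (auto simp: coloop_plucker_def basis_def)
    then show "\<exists>B\<in>subsets_of_card (E \<union> Z) (r + card Z). ?Q B \<noteq> 0" by blast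
  next
    fix I J
    assume "I \<subseteq> E \<union> Z \<and> card I + 1 = r + card Z \<and> J \<subseteq> E \<union> Z \<and> card J = r + card Z + 1"
    then have I: "I \<subseteq> E \<union> Z" "card I + 1 = r + card Z" and J: "J \<subseteq> E \<union> Z" "card J = r + card Z + 1"
      by auto
    have finIJ: "finite I" "finite J" using I J fin Z finite_subset[of _ "E \<union> Z"] by auto
    have "null_sum (\<lambda>j. plucker_sign j I J * ?Q (insert j I) * ?Q (J - {j})) (J - I)"
    proof (cases "Z \<subseteq> I \<and> Z \<subseteq> J")
      case True
      define I0 J0 where "I0 = I - Z" and "J0 = J - Z"
      note cI = coloop_decompose[OF I(1) conjunct1[OF True], folded I0_def]
        and cJ = coloop_decompose[OF J(1) conjunct2[OF True], folded J0_def]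
      have "null_sum (\<lambda>j. plucker_sign j I0 J0 * P (insert j I0) * P (J0 - {j})) (J0 - I0)"
        using pv cI cJ I(2) J(2) by (simp add: plucker_vector_def null_sum_def)
      then have "null_sum (\<lambda>j. neg ^ (shift Z I0 + shift Z J0) * (plucker_sign j I0 J0 * P (insert j I0) * P (J0 - {j}))) (J0 - I0)"
        by (rule null_sum_scale)
      also have "?this \<longleftrightarrow> null_sum (\<lambda>j. plucker_sign j I J * ?Q (insert j I) * ?Q (J - {j})) (J - I)"
      proof (rule null_sum_cong)
        show "J0 - I0 = J - I" using True by (auto simp: I0_def J0_def)
        fix j assume "j \<in> J0 - I0"
        then have j: "j \<in> J0" "j \<notin> I0" "j \<notin> Z" "j \<in> J" "j \<notin> I" "j \<in> E"
          using True J by (auto simp: I0_def J0_def)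
        have e: "insert j I - Z = insert j I0" "J - {j} - Z = J0 - {j}" "Z \<subseteq> insert j I" "Z \<subseteq> J - {j}"
          "insert j I \<subseteq> E \<union> Z" "J - {j} \<subseteq> E \<union> Z"
          using j True I J by (auto simp: I0_def J0_def)
        have 1: "?Q (insert j I) = neg ^ shift Z (insert j I0) * P (insert j I0)"
          unfolding coloop_plucker_def using e j I finIJ by auto
        have 2: "?Q (J - {j}) = neg ^ shift Z (J0 - {j}) * P (J0 - {j})"
          unfolding coloop_plucker_def using e j J finIJ by auto
        have 3: "neg ^ (shift Z I0 + shift Z J0) = neg ^ shift Z (insert j I0) * neg ^ shift Z (J0 - {j})"
          unfolding power_add[symmetric]
          by (rule neg_power_cong) (use shift_insert[OF cI(2) j(2), of Z] shift_remove[OF cJ(2) j(1), of Z] in presburger)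
        have 4: "plucker_sign j I J = plucker_sign j I0 J0"
          using plucker_sign_Un[OF cI(2) cJ(2) Z(1) cI(3) cJ(3)] cI(4) cJ(4) by simp
        show "neg ^ (shift Z I0 + shift Z J0) * (plucker_sign j I0 J0 * P (insert j I0) * P (J0 - {j}))
          = plucker_sign j I J * ?Q (insert j I) * ?Q (J - {j})"
          unfolding 1 2 3 4 by (simp only: ac_simps)
      qed
      finally show ?thesis .
    next
      case False
      show ?thesis
      proof (rule null_sum_zero)
        fix j assume j: "j \<in> J - I"
        have c: "insert j I \<subseteq> E \<union> Z" "card (insert j I) = r + card Z" "J - {j} \<subseteq> E \<union> Z" "card (J - {j}) = r + card Z"
          using j I J finIJ by auto
        \<comment> \<open>An element of \<open>Z\<close> missing from \<open>J\<close> stays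
          missing. One missing from \<open>I\<close> either stays missing from
          \<open>insert j I\<close> or equals \<open>j\<close>, and then \<open>J - {j}\<close>
          misses it.\<close>
        have "\<not> Z \<subseteq> insert j I \<or> \<not> Z \<subseteq> J - {j}" using False by blast
        then have "?Q (insert j I) = 0 \<or> ?Q (J - {j}) = 0"
          unfolding coloop_plucker_def using c by auto
        then show "plucker_sign j I J * ?Q (insert j I) * ?Q (J - {j}) = 0" by auto
      qed
    qed
    then show "is_null {#plucker_sign j I J * ?Q (insert j I) * ?Q (J - {j}). j \<in># mset_set (J - I)#}"
      by (simp add: null_sum_def)
  qed
qed

text \<open>Deleting a coloop from \<open>\<tau>\<close> leaves a set without it, where the extended
  Pluecker vector is zero; so circuit vectors vanish on \<open>Z\<close>.\<close>

lemma cvec_coloop: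
  assumes "\<tau> \<subseteq> E \<union> Z" "card \<tau> = r + card Z + 1" "i \<in> E \<union> Z"
  shows "cvec (E \<union> Z) (coloop_plucker E r P Z) \<tau> i =
    (if Z \<subseteq> \<tau> \<and> i \<notin> Z then neg ^ shift Z (\<tau> - Z) * cvec E P (\<tau> - Z) i else 0)"
proof (cases "i \<in> \<tau>")
  case True
  have f: "finite \<tau>" using assms(1) fin Z finite_subset[of _ "E \<union> Z"] by auto
  have c: "\<tau> - {i} \<subseteq> E \<union> Z" "card (\<tau> - {i}) = r + card Z" using assms True f by auto
  show ?thesis
  proof (cases "Z \<subseteq> \<tau> \<and> i \<notin> Z")
    case t: True
    then have z: "Z \<subseteq> \<tau>" by simp
    note d = coloop_decompose[OF assms(1) z]
    have e: "\<tau> - {i} - Z = \<tau> - Z - {i}" "Z \<subseteq> \<tau> - {i}" "i \<in> \<tau> - Z" "i \<in> E" using t True assms by auto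
    have Q: "coloop_plucker E r P Z (\<tau> - {i}) = neg ^ shift Z (\<tau> - Z - {i}) * P (\<tau> - Z - {i})"
      unfolding coloop_plucker_def using c e by auto
    have 2: "neg ^ card {j \<in> \<tau>. j < i} * neg ^ shift Z (\<tau> - Z - {i}) =
      (neg ^ shift Z (\<tau> - Z) * neg ^ card {j \<in> \<tau> - Z. j < i} :: 'a with_zero)"
      unfolding power_add[symmetric]
      by (rule neg_power_cong)
        (use shift_remove[OF d(2) e(3), of Z] card_filter_Un[OF d(2) Z(1) d(3), of "\<lambda>j. j < i", unfolded d(4)]
          in presburger)
    have "cvec (E \<union> Z) (coloop_plucker E r P Z) \<tau> i =
        (neg ^ card {j \<in> \<tau>. j < i} * neg ^ shift Z (\<tau> - Z - {i})) * P (\<tau> - Z - {i})"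
      using True assms(3) by (simp add: cvec_apply Q mult.assoc)
    also have "\<dots> = neg ^ shift Z (\<tau> - Z) * cvec E P (\<tau> - Z) i"
      unfolding 2 using e by (simp add: cvec_apply mult.assoc)
    finally show ?thesis using t by simp
  next
    case False
    then have "\<not> Z \<subseteq> \<tau> - {i}" by blast
    then have "coloop_plucker E r P Z (\<tau> - {i}) = 0" unfolding coloop_plucker_def using c by auto
    then show ?thesis using False assms(3) by (auto simp: cvec_apply)
  qed
qed (use assms in \<open>auto simp: cvec_apply\<close>)

lemma coloop_circ:
  "plucker.circ (E \<union> Z) (r + card Z) (coloop_plucker E r P Z) \<tau> \<longleftrightarrow> Z \<subseteq> \<tau> \<and> \<tau> \<subseteq> E \<union> Z \<and> circ (\<tau> - Z)"
proof -
  interpret N: plucker "E \<union> Z" "r + card Z" "coloop_plucker E r P Z" by (rule coloop_plucker_vector)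
  show ?thesis
  proof (cases "\<tau> \<subseteq> E \<union> Z \<and> card \<tau> = r + card Z + 1 \<and> Z \<subseteq> \<tau>")
    case True
    then have "supp (E \<union> Z) (cvec (E \<union> Z) (coloop_plucker E r P Z) \<tau>) = supp E (cvec E P (\<tau> - Z))"
      using Z(2) by (auto simp: supp_def cvec_coloop split: if_splits)
    then show ?thesis using True coloop_decompose[of \<tau>] by (auto simp: N.circ_def circ_def)
  next
    case False
    have "\<not> N.circ \<tau>"
    proof
      assume c: "N.circ \<tau>"
      then have t: "\<tau> \<subseteq> E \<union> Z" "card \<tau> = r + card Z + 1" by (auto simp: N.circ_def)
      then have "\<not> Z \<subseteq> \<tau>" using False by blast
      then have "cvec (E \<union> Z) (coloop_plucker E r P Z) \<tau> i = 0" if "i \<in> E \<union> Z" for i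
        using cvec_coloop[OF t that] by simp
      then show False using c by (auto simp: N.circ_def supp_def)
    qed
    moreover have "\<not> (Z \<subseteq> \<tau> \<and> \<tau> \<subseteq> E \<union> Z \<and> circ (\<tau> - Z))"
      using False coloop_decompose(5)[of \<tau>] by (auto simp: circ_def)
    ultimately show ?thesis by blast
  qed
qed

lemma add_coloops_mat: "add_coloops mat Z = of_plucker (E \<union> Z) (r + card Z) (coloop_plucker E r P Z)"
proof -
  interpret N: plucker "E \<union> Z" "r + card Z" "coloop_plucker E r P Z" by (rule coloop_plucker_vector)
  let ?e = "\<lambda>C. \<lambda>i\<in>E \<union> Z. if i \<in> Z then 0 else C i"
  have ext: "(\<lambda>i\<in>E \<union> Z. Unit c * cvec (E \<union> Z) (coloop_plucker E r P Z) \<tau> i) =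
      ?e (\<lambda>i\<in>E. Unit (c * neg_one ^ shift Z (\<tau> - Z)) * cvec E P (\<tau> - Z) i)"
    if "N.circ \<tau>" for c \<tau>
  proof
    have t: "\<tau> \<subseteq> E \<union> Z" "card \<tau> = r + card Z + 1" "Z \<subseteq> \<tau>"
      using that coloop_circ[of \<tau>] unfolding N.circ_def by blast+
    fix i
    show "(\<lambda>i\<in>E \<union> Z. Unit c * cvec (E \<union> Z) (coloop_plucker E r P Z) \<tau> i) i =
      ?e (\<lambda>i\<in>E. Unit (c * neg_one ^ shift Z (\<tau> - Z)) * cvec E P (\<tau> - Z) i) i"
      using cvec_coloop[OF t(1,2), of i] t(3)
      by (auto simp: mult.assoc Unit_neg_one_power simp flip: times_with_zero.simps(1))
  qed
  have e: "circuits N.mat = ?e ` circuits mat"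
  proof (intro subset_antisym subsetI)
    fix C assume "C \<in> circuits N.mat"
    then obtain c \<tau> where t: "N.circ \<tau>" "C = (\<lambda>i\<in>E \<union> Z. Unit c * cvec (E \<union> Z) (coloop_plucker E r P Z) \<tau> i)"
      by (auto simp: N.circuits_mat)
    have "(\<lambda>i\<in>E. Unit (c * neg_one ^ shift Z (\<tau> - Z)) * cvec E P (\<tau> - Z) i) \<in> circuits mat"
      using t(1) unfolding circuits_mat coloop_circ by blast
    then show "C \<in> ?e ` circuits mat" unfolding t(2) ext[OF t(1)] by blast
  next
    fix C assume "C \<in> ?e ` circuits mat"
    then obtain c \<tau> where t: "circ \<tau>" "C = ?e (\<lambda>i\<in>E. Unit c * cvec E P \<tau> i)" by (auto simp: circuits_mat)
    have z: "\<tau> \<union> Z - Z = \<tau>" using t(1) Z(2) by (auto simp: circ_def)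
    then have N: "N.circ (\<tau> \<union> Z)" using t(1) by (auto simp: coloop_circ circ_def)
    have sq: "neg_one ^ n * neg_one ^ n = (1 :: 'a)" for n
      by (metis neg_one_square power_mult_distrib power_one)
    have "C = (\<lambda>i\<in>E \<union> Z. Unit (c * neg_one ^ shift Z \<tau>) * cvec (E \<union> Z) (coloop_plucker E r P Z) (\<tau> \<union> Z) i)"
      unfolding ext[OF N] t(2) z mult.assoc sq mult_1_right ..
    then show "C \<in> circuits N.mat" unfolding N.circuits_mat using N by blast
  qed
  have m: "is_matroid N.mat" using is_matroid_of_plucker[OF N.fin N.pv] .
  show ?thesis
    unfolding add_coloops_def of_plucker_simps
    by (rule the_matroid[OF m _ e]) simp
qed

text \<open>Circuits of the extension vanish on \<open>Z\<close>, so they put no condition on the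
  entries of \<open>Y\<close> there.\<close>

lemma covec_coloop:
  "covec (E \<union> Z) (r + card Z) (coloop_plucker E r P Z) Y \<longleftrightarrow> covec E r P Y"
proof -
  have o: "orthogonal (E \<union> Z) Y (cvec (E \<union> Z) (coloop_plucker E r P Z) \<tau>) \<longleftrightarrow> orthogonal E Y (cvec E P (\<tau> - Z))"
    if t: "\<tau> \<subseteq> E \<union> Z" "card \<tau> = r + card Z + 1" "Z \<subseteq> \<tau>" for \<tau>
  proof -
    let ?c = "cvec (E \<union> Z) (coloop_plucker E r P Z) \<tau>"
    have "orthogonal (E \<union> Z) Y ?c \<longleftrightarrow> orthogonal E Y ?c"
      using fin Z t by (intro orthogonal_subset) (auto simp: cvec_coloop)
    also have "\<dots> \<longleftrightarrow> orthogonal E Y (cvec E P (\<tau> - Z))"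
      using Z t by (intro orthogonal_scale[of "neg ^ shift Z (\<tau> - Z)"]) (auto simp: cvec_coloop)
    finally show ?thesis .
  qed
  show ?thesis
  proof
    assume l: "covec (E \<union> Z) (r + card Z) (coloop_plucker E r P Z) Y"
    show "covec E r P Y" unfolding covec_def
    proof (intro allI impI, elim conjE)
      fix \<tau> assume t: "\<tau> \<subseteq> E" "card \<tau> = r + 1"
      have z: "\<tau> \<union> Z - Z = \<tau>" using t Z by blast
      have "card (\<tau> \<union> Z) = r + card Z + 1"
        using coloop_decompose(5)[of "\<tau> \<union> Z"] t z by auto
      then show "orthogonal E Y (cvec E P \<tau>)"
        using o[of "\<tau> \<union> Z"] l t z by (auto simp: covec_def)
    qed
  next
    assume r: "covec E r P Y"
    show "covec (E \<union> Z) (r + card Z) (coloop_plucker E r P Z) Y" unfolding covec_def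
    proof (intro allI impI, elim conjE)
      fix \<tau> assume t: "\<tau> \<subseteq> E \<union> Z" "card \<tau> = r + card Z + 1"
      show "orthogonal (E \<union> Z) Y (cvec (E \<union> Z) (coloop_plucker E r P Z) \<tau>)"
      proof (cases "Z \<subseteq> \<tau>")
        case True
        then show ?thesis using o[OF t] coloop_decompose[OF t(1)] t(2) r by (auto simp: covec_def)
      next
        case False
        then have "cvec (E \<union> Z) (coloop_plucker E r P Z) \<tau> i = 0" if "i \<in> E \<union> Z" for i
          using cvec_coloop[OF t that] by simp
        then show ?thesis by (intro orthogonal_empty_supp) (auto simp: supp_def)
      qed
    qed
  qed
qed

end

end

section \<open>Spans of fundamental cocircuits\<close>

lemma is_null_add_subset:
  assumes "finite I" "J \<subseteq> I" "\<And>i. i \<in> I - J \<Longrightarrow> f i = 0"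
  shows "is_null (add_mset x (image_mset f (mset_set I))) \<longleftrightarrow> is_null (add_mset x (image_mset f (mset_set J)))"
  using filter_mset_image_mset_set[OF assms] by (auto simp: is_null_def)

context plucker
begin

lemma bases_mat: "bases mat = {B. basis B}"
proof -
  have "B \<in> bases mat \<longleftrightarrow> basis B" for B
  proof -
    have "(\<exists>Q\<in>pluckers mat. Q B \<noteq> 0) \<longleftrightarrow> P B \<noteq> 0" if "B \<in> subsets_of_card E r"
    proof
      assume "\<exists>Q\<in>pluckers mat. Q B \<noteq> 0"
      then show "P B \<noteq> 0" using that by (auto simp: of_plucker_def)
    next
      assume "P B \<noteq> 0"
      then show "\<exists>Q\<in>pluckers mat. Q B \<noteq> 0" using that
        by (intro bexI[of _ "\<lambda>I\<in>subsets_of_card E r. Unit 1 * P I"]) (auto simp: of_plucker_def)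
    qed
    then show ?thesis by (auto simp: bases_def basis_def)
  qed
  then show ?thesis by blast
qed

text \<open>Dual to \<open>vec_entry\<close>: the fundamental circuit of \<open>k\<close> lies in
  \<open>insert k B\<close> and so meets the support of \<open>Y\<close> in at most \<open>j\<close>
  and \<open>k\<close>.\<close>

lemma covec_entry:
  assumes "covec E r P Y" "basis B" "j \<in> B" "k \<in> E - B" "supp E Y \<subseteq> (E - B) \<union> {j}"
  shows "Y j * bar (cvec E P (insert k B) j) = neg * (Y k * bar (cvec E P (insert k B) k))"
proof -
  let ?c = "cvec E P (insert k B)"
  have "orthogonal E Y ?c"
    using assms(1) cvec_basis[OF assms(2,4)] by (simp add: covec_def)
  moreover have "Y e = 0 \<or> ?c e = 0" if "e \<in> E - {k, j}" for e
    using that assms(5) by (auto simp: supp_def cvec_apply)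
  moreover have "{k, j} \<subseteq> E" using assms by (auto simp: basis_def)
  ultimately have "orthogonal {k, j} Y ?c"
    using orthogonal_subset[OF fin, of "{k, j}"] by blast
  then show ?thesis using assms by (subst (asm) orthogonal_null_sum, subst (asm) null_sum_pair) auto
qed

lemma cocircuits_covec:
  assumes "D \<in> cocircuits mat"
  shows "covec E r P D" "D \<in> tuples E"
proof -
  obtain c I where I: "D = (\<lambda>i\<in>E. Unit c * dvec E P I i)" "I \<subseteq> E" "card I + 1 = r"
    using assms unfolding cocircuits_of_plucker[OF fin pv] by auto
  then have "covec E r P (dvec E P I)" by (intro covec_dvec)
  moreover have "orthogonal E D C \<longleftrightarrow> orthogonal E (dvec E P I) C" for C
    using orthogonal_scale[of "Unit c" E D "dvec E P I" C] I(1) by (simp add: orthogonal_sym[of E _ C])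
  ultimately show "covec E r P D" by (simp add: covec_def)
  show "D \<in> tuples E" using I(1) by simp
qed

text \<open>Existence: \<open>dvec E P (B - {j})\<close> divided by its entry at \<open>j\<close>.
  Uniqueness: by \<open>covec_entry\<close> with the fundamental circuit of \<open>i\<close>, the
  entry 1 at \<open>j\<close> determines the entry at each \<open>i\<close> outside
  \<open>B\<close>.\<close>

lemma fundamental_cocircuit:
  assumes B: "basis B" "j \<in> B"
  defines "D \<equiv> fundamental_cocircuit mat j B"
  shows "covec E r P D" "supp E D \<subseteq> (E - B) \<union> {j}" "D j = 1"
proof -
  let ?Q = "\<lambda>D. D \<in> cocircuits mat \<and> supp E D \<subseteq> (E - B) \<union> {j} \<and> D j = 1"
  have jE: "j \<in> E" using B by (auto simp: basis_def)
  note d = dvec_basis[OF B]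
  obtain e where e: "e \<noteq> 0" "dvec E P (B - {j}) j * e = 1" using d(3) with_zero_inverse by blast
  then obtain c where c: "e = Unit c" by (elim nonzero_cases)
  define D0 where "D0 = (\<lambda>i\<in>E. Unit c * dvec E P (B - {j}) i)"
  have "D0 j = 1" using e jE by (simp add: D0_def c mult.commute)
  moreover have "supp E D0 \<subseteq> (E - B) \<union> {j}" using d(4) by (auto simp: D0_def supp_def)
  moreover have "supp E (dvec E P (B - {j})) \<noteq> {}" using d(3) jE by (auto simp: supp_def)
  then have "D0 \<in> cocircuits mat"
    unfolding cocircuits_of_plucker[OF fin pv] D0_def using d(1,2) by blast
  ultimately have Q0: "?Q D0" by blast
  have uniq: "D1 = D2" if Q: "?Q D1" "?Q D2" for D1 D2
  proof (rule PiE_ext)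
    show "D1 \<in> tuples E" "D2 \<in> tuples E" using Q cocircuits_covec by auto
    fix i assume i: "i \<in> E"
    consider "i = j" | "i \<in> B" "i \<noteq> j" | "i \<in> E - B" using i by blast
    then show "D1 i = D2 i"
    proof cases
      case 2
      then have "i \<notin> supp E D1" "i \<notin> supp E D2" using Q by blast+
      then show ?thesis using i by (simp add: supp_def)
    next
      case 3
      note c = cvec_basis(3)[OF B(1) 3]
      have "1 * bar (cvec E P (insert i B) j) = neg * (D' i * bar (cvec E P (insert i B) i))" if "?Q D'" for D'
        using covec_entry[of D' B j i] cocircuits_covec[of D'] that B 3 by simp
      from this[OF Q(1)] this[OF Q(2)]
      have "bar (cvec E P (insert i B) i) * D1 i = bar (cvec E P (insert i B) i) * D2 i"
        by (simp add: mult.commute)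
      then show ?thesis using c by simp
    qed (use Q in auto)
  qed
  have "D = D0"
    unfolding D_def fundamental_cocircuit_def of_plucker_simps
    by (rule the_equality) (use Q0 uniq in blast)+
  then have "?Q D" using Q0 by simp
  then show "covec E r P D" "supp E D \<subseteq> (E - B) \<union> {j}" "D j = 1" using cocircuits_covec by auto
qed

lemma in_span_fundamental_iff:
  assumes B: "basis B" and X: "X \<in> tuples E"
  shows "X \<in> span E (fundamental_cocircuits mat B) \<longleftrightarrow> (\<forall>k\<in>E - B. orthogonal E X (cvec E P (insert k B)))"
proof -
  have BE: "B \<subseteq> E" and fB: "finite B" using B basis_finite by (auto simp: basis_def)
  define D where "D j = fundamental_cocircuit mat j B" for j
  note fD = fundamental_cocircuit[OF B, folded D_def]
  have D0: "D j k = 0" if "j \<in> B" "k \<in> B" "k \<noteq> j" for j k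
    using fD(2)[OF that(1)] that BE by (auto simp: supp_def)
  \<comment> \<open>The span indexes its coefficients by the cocircuits themselves; injectivity lets
    \<open>B\<close> index them instead, and \<open>inv_into\<close> translates back.\<close>
  have inj: "inj_on D B"
    by (rule inj_onI) (metis D0 fD(3) Unit_neq_zero(1) one_with_zero_def)
  define cond where "cond a k \<longleftrightarrow> is_null (add_mset (X k) (image_mset (\<lambda>j. neg * a j * D j k) (mset_set B)))"
    for a :: "'e \<Rightarrow> 'a with_zero" and k
  have D_image: "fundamental_cocircuits mat B = D ` B" by (simp add: fundamental_cocircuits_def D_def)
  have span: "X \<in> span E (fundamental_cocircuits mat B) \<longleftrightarrow> (\<exists>\<alpha>. \<forall>k\<in>E. cond (\<lambda>j. \<alpha> (D j)) k)"
    using X unfolding span_def D_image cond_def neg_def[symmetric]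
    by (simp add: image_mset_mset_set[OF inj, symmetric] multiset.map_comp comp_def)
  \<comment> \<open>At \<open>k\<close> in \<open>B\<close> only the cocircuit of \<open>k\<close>
    contributes, with entry 1: a two-term sum that fixes the coefficient.\<close>
  have condB: "cond a k \<longleftrightarrow> a k = X k" if "k \<in> B" for a k
  proof -
    have "cond a k \<longleftrightarrow> is_null (add_mset (X k) (image_mset (\<lambda>j. neg * a j * D j k) (mset_set {k})))"
      unfolding cond_def by (rule is_null_add_subset) (use fB that D0 in auto)
    then show ?thesis using fD(3)[OF that] by (simp add: is_null_pair)
  qed
  \<comment> \<open>By \<open>covec_entry\<close> each conjugated entry of the fundamental circuit
    at \<open>j\<close> in \<open>B\<close> is \<open>neg * D j k\<close> times the one at
    \<open>k\<close>. With this nonzero common factor taken out, the orthogonality sum is the span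
    condition at \<open>k\<close>.\<close>
  have condN: "cond X k \<longleftrightarrow> orthogonal E X (cvec E P (insert k B))" if k: "k \<in> E - B" for k
  proof -
    let ?c = "cvec E P (insert k B)"
    have "orthogonal E X ?c \<longleftrightarrow> orthogonal (insert k B) X ?c"
      by (rule orthogonal_subset) (use k BE fin in \<open>auto simp: cvec_apply\<close>)
    also have "\<dots> \<longleftrightarrow> null_sum (\<lambda>i. X i * bar (?c i)) (insert k B)" by (rule orthogonal_null_sum)
    also have "\<dots> \<longleftrightarrow> is_null (add_mset (X k * bar (?c k)) (image_mset (\<lambda>j. X j * bar (?c j)) (mset_set B)))"
      using k fB by (intro null_sum_insert) auto
    also have "image_mset (\<lambda>j. X j * bar (?c j)) (mset_set B) =
        image_mset (\<lambda>j. bar (?c k) * (neg * X j * D j k)) (mset_set B)"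
    proof (rule image_mset_cong)
      fix j assume "j \<in># mset_set B"
      then have j: "j \<in> B" using fB by simp
      have "bar (?c j) = neg * (D j k * bar (?c k))"
        using covec_entry[OF fD(1)[OF j] B j k fD(2)[OF j]] fD(3)[OF j] by simp
      then show "X j * bar (?c j) = bar (?c k) * (neg * X j * D j k)" by (simp add: ac_simps)
    qed
    also have "add_mset (X k * bar (?c k)) (image_mset (\<lambda>j. bar (?c k) * (neg * X j * D j k)) (mset_set B)) =
        image_mset ((*) (bar (?c k))) (add_mset (X k) (image_mset (\<lambda>j. neg * X j * D j k) (mset_set B)))"
      by (simp add: multiset.map_comp comp_def mult.commute)
    also have "is_null \<dots> \<longleftrightarrow> cond X k"
      unfolding cond_def by (rule is_null_scale_iff) (use cvec_basis(3)[OF B k] in simp)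
    finally show ?thesis by simp
  qed
  have cond_cong: "cond a k \<longleftrightarrow> cond b k" if "\<And>j. j \<in> B \<Longrightarrow> a j = b j" for a b k
  proof -
    have "image_mset (\<lambda>j. neg * a j * D j k) (mset_set B) = image_mset (\<lambda>j. neg * b j * D j k) (mset_set B)"
      by (rule image_mset_cong) (use that fB in simp)
    then show ?thesis by (simp add: cond_def)
  qed
  show ?thesis
  proof
    assume "X \<in> span E (fundamental_cocircuits mat B)"
    then obtain \<alpha> where \<alpha>: "\<forall>k\<in>E. cond (\<lambda>j. \<alpha> (D j)) k" unfolding span by blast
    then have "\<alpha> (D j) = X j" if "j \<in> B" for j
      using condB[OF that, of "\<lambda>j. \<alpha> (D j)"] that BE by blast
    then have "cond (\<lambda>j. \<alpha> (D j)) k \<longleftrightarrow> cond X k" for k by (rule cond_cong)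
    then show "\<forall>k\<in>E - B. orthogonal E X (cvec E P (insert k B))" using \<alpha> condN by blast
  next
    assume o: "\<forall>k\<in>E - B. orthogonal E X (cvec E P (insert k B))"
    have "cond (\<lambda>j. X (inv_into B D (D j))) k" if "k \<in> E" for k
    proof -
      have "cond (\<lambda>j. X (inv_into B D (D j))) k \<longleftrightarrow> cond X k"
        by (rule cond_cong) (simp add: inv_into_f_f[OF inj])
      then show ?thesis using that o condB condN by blast
    qed
    then show "X \<in> span E (fundamental_cocircuits mat B)"
      unfolding span by (intro exI[of _ "\<lambda>Y. X (inv_into B D Y)"]) blast
  qed
qed

lemma covectors_eq_spans: "covectors mat = (\<Inter>B\<in>bases mat. span E (fundamental_cocircuits mat B))"
proof (intro subset_antisym subsetI)
  fix X assume "X \<in> covectors mat"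
  then have X: "X \<in> tuples E" "covec E r P X" by (auto simp: covectors_of_plucker[OF fin])
  show "X \<in> (\<Inter>B\<in>bases mat. span E (fundamental_cocircuits mat B))"
  proof
    fix B assume "B \<in> bases mat"
    then have "basis B" by (simp add: bases_mat)
    then show "X \<in> span E (fundamental_cocircuits mat B)"
      using in_span_fundamental_iff X cvec_basis(1,2) by (auto simp: covec_def)
  qed
next
  fix X assume X: "X \<in> (\<Inter>B\<in>bases mat. span E (fundamental_cocircuits mat B))"
  \<comment> \<open>A basis exists, so the intersection is not over the empty family.\<close>
  then have t: "X \<in> tuples E" using basis_exists by (force simp: bases_mat span_def)
  have "orthogonal E X (cvec E P \<tau>)" if "\<tau> \<subseteq> E" "card \<tau> = r + 1" for \<tau>
  proof (cases "supp E (cvec E P \<tau>) = {}")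
    case False
    then have c: "circ \<tau>" using that by (simp add: circ_def)
    obtain k where "k \<in> supp E (cvec E P \<tau>)" using False by blast
    note b = circ_basis[OF c this]
    then have "X \<in> span E (fundamental_cocircuits mat (\<tau> - {k}))" using X by (simp add: bases_mat)
    then show ?thesis using in_span_fundamental_iff[OF b(1) t] b(2,3) by metis
  qed (rule orthogonal_empty_supp)
  then show "X \<in> covectors mat" using t by (simp add: covectors_of_plucker[OF fin] covec_def)
qed

end

section \<open>Leading terms and initial matroids\<close>

text \<open>The level \<open>g\<close> is prescribed instead of being the valuation of
  \<open>x\<close>: terms above it are sent to zero, as they are in the null set of the
  extension.\<close>

definition lead :: "'g \<Rightarrow> ('a, 'g) trop_ext with_zero \<Rightarrow> 'a with_zero" where
  "lead g x = (case x of Zero \<Rightarrow> Zero | Unit y \<Rightarrow> if valuation y = g then Unit (angle y) else Zero)"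

definition val_ge :: "'g::ord \<Rightarrow> ('a, 'g) trop_ext with_zero \<Rightarrow> bool" where
  "val_ge g x = (case x of Zero \<Rightarrow> True | Unit y \<Rightarrow> g \<le> valuation y)"

lemma lead_zero [simp]: "lead g 0 = 0" by (simp add: lead_def zero_with_zero_def)

lemma val_ge_zero [simp]: "val_ge g 0" by (simp add: val_ge_def zero_with_zero_def)

lemma lead_Unit [simp]: "lead g (Unit y) = (if valuation y = g then Unit (angle y) else 0)"
  by (simp add: lead_def zero_with_zero_def)

lemma val_ge_Unit [simp]: "val_ge g (Unit y) \<longleftrightarrow> g \<le> valuation y"
  by (simp add: val_ge_def)

lemma with_zero_cases:
  obtains "x = 0" | y where "x = Unit y"
  by (cases "x = 0") (auto elim: nonzero_cases)

lemma val_ge_mult: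
  fixes x y :: "('a::tract, 'g::linordered_ab_group_add) trop_ext with_zero"
  assumes "val_ge a x" "val_ge b y"
  shows "val_ge (a + b) (x * y)"
  using assms
  by (cases x rule: with_zero_cases; cases y rule: with_zero_cases)
    (auto simp: times_trop_ext_def intro: add_mono)

text \<open>With both lower bounds, the valuation of the product can equal \<open>a + b\<close> only
  if both bounds are attained; without them, one excess could compensate a deficit.\<close>

lemma lead_mult:
  fixes x y :: "('a::tract, 'g::linordered_ab_group_add) trop_ext with_zero"
  assumes "val_ge a x" "val_ge b y"
  shows "lead (a + b) (x * y) = lead a x * lead b y"
proof (cases "x = 0 \<or> y = 0")
  case False
  then obtain x' y' where xy: "x = Unit x'" "y = Unit y'" by (metis nonzero_cases)
  have "valuation x' + valuation y' = a + b \<longleftrightarrow> valuation x' = a \<and> valuation y' = b"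
    using assms unfolding xy
    by (metis add_less_le_mono add_le_less_mono less_irrefl order.not_eq_order_implies_strict val_ge_Unit)
  then show ?thesis by (auto simp: xy times_trop_ext_def)
qed auto

lemma val_ge_bar [simp]: "val_ge g (bar x) \<longleftrightarrow> val_ge g x"
  by (cases x rule: with_zero_cases) (auto simp: invol_trop_ext_def)

lemma lead_bar [simp]: "lead g (bar x) = bar (lead g x)"
  by (cases x rule: with_zero_cases) (auto simp: invol_trop_ext_def)

lemma neg_one_trop_ext: "neg_one = (Ext neg_one 0 :: ('a::tract, 'g::linordered_ab_group_add) trop_ext)"
proof -
  have "{#1, neg_one :: 'a#} \<in> null" by (simp add: null_neg_one_iff)
  then have "{#1, Ext neg_one 0 :: ('a, 'g) trop_ext#} \<in> null"
    by (simp add: null_trop_ext_def one_trop_ext_def)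
  then show ?thesis by (simp add: null_neg_one_iff)
qed

lemma lead_neg_power:
  "lead 0 (neg ^ n :: ('a::tract, 'g::linordered_ab_group_add) trop_ext with_zero) = neg ^ n"
  "val_ge 0 (neg ^ n :: ('a::tract, 'g::linordered_ab_group_add) trop_ext with_zero)"
  unfolding neg_power_parity by (simp_all add: neg_def one_with_zero_def neg_one_trop_ext one_trop_ext_def)

lemma lead_neg_power_mult:
  fixes x :: "('a::tract, 'g::linordered_ab_group_add) trop_ext with_zero"
  assumes "val_ge g x"
  shows "lead g (neg ^ n * x) = neg ^ n * lead g x" "val_ge g (neg ^ n * x)"
  using lead_mult[OF lead_neg_power(2) assms, of n] val_ge_mult[OF lead_neg_power(2) assms, of n]
  by (simp_all add: lead_neg_power)

lemma is_null_lead_aux: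
  "image_mset the_unit (filter_mset (\<lambda>x. x \<noteq> 0) (image_mset (lead g) S)) =
    image_mset angle (filter_mset (\<lambda>y. valuation y = g) (image_mset the_unit (filter_mset (\<lambda>x. x \<noteq> 0) S)))"
proof (induction S)
  case (add x S)
  then show ?case by (cases x rule: with_zero_cases) auto
qed simp

text \<open>When level \<open>g\<close> is attained, it selects exactly the terms of minimal
  valuation. If it were not, the leading sum would be null for being empty and say nothing about
  \<open>S\<close>.\<close>

lemma is_null_lead_iff:
  fixes S :: "('a::tract, 'g::linordered_ab_group_add) trop_ext with_zero multiset"
  assumes ge: "\<And>x. x \<in># S \<Longrightarrow> val_ge g x" and att: "x0 \<in># S" "lead g x0 \<noteq> 0"
  shows "is_null S \<longleftrightarrow> is_null (image_mset (lead g) S)"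
proof -
  define T where "T = image_mset the_unit (filter_mset (\<lambda>x. x \<noteq> 0) S)"
  have T: "g \<le> valuation y" if "y \<in># T" for y
    using that by (auto simp: T_def elim!: nonzero_cases dest: ge)
  obtain y0 where y0: "x0 = Unit y0" "valuation y0 = g"
    using att(2) by (cases x0 rule: with_zero_cases) (auto split: if_splits)
  have "y0 \<in># T" using att(1) y0(1) by (force simp: T_def image_iff)
  then have "filter_mset (\<lambda>x. \<forall>y\<in>#T. valuation x \<le> valuation y) T = filter_mset (\<lambda>y. valuation y = g) T"
    using T y0(2) by (intro filter_mset_cong) (auto intro: order.antisym)
  moreover have "T \<noteq> {#}" using \<open>y0 \<in># T\<close> by auto
  ultimately show ?thesis
    by (simp add: is_null_def is_null_lead_aux T_def[symmetric] null_trop_ext_def)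
qed

lemma is_null_lead:
  fixes S :: "('a::tract, 'g::linordered_ab_group_add) trop_ext with_zero multiset"
  assumes "\<And>x. x \<in># S \<Longrightarrow> val_ge g x" "is_null S"
  shows "is_null (image_mset (lead g) S)"
proof (cases "\<exists>x0. x0 \<in># S \<and> lead g x0 \<noteq> 0")
  case True
  then show ?thesis using is_null_lead_iff assms by blast
next
  case False
  then have "filter_mset (\<lambda>x. x \<noteq> 0) (image_mset (lead g) S) = {#}" by (auto simp: filter_mset_eq_conv)
  then show ?thesis by (simp only: is_null_def image_mset_empty null_zero)
qed

text \<open>The levels of the two tuples add up to one \<open>g\<close> at all indices, so the
  leading terms of the pairing are the pairing of the leading terms. The way back needs an index at
  which both leading terms survive.\<close>

lemma orthogonal_lead:
  fixes X Y :: "'e \<Rightarrow> ('a::tract, 'g::linordered_ab_group_add) trop_ext with_zero"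
  assumes "\<And>i. i \<in> E \<Longrightarrow> val_ge (a i) (X i)" "\<And>i. i \<in> E \<Longrightarrow> val_ge (b i) (Y i)"
    "\<And>i. i \<in> E \<Longrightarrow> a i + b i = g"
    and X': "\<And>i. i \<in> E \<Longrightarrow> X' i = lead (a i) (X i)" and Y': "\<And>i. i \<in> E \<Longrightarrow> Y' i = lead (b i) (Y i)"
  shows "orthogonal E X Y \<Longrightarrow> orthogonal E X' Y'"
    and "finite E \<Longrightarrow> i \<in> E \<Longrightarrow> X' i \<noteq> 0 \<Longrightarrow> Y' i \<noteq> 0 \<Longrightarrow> orthogonal E X' Y' \<Longrightarrow> orthogonal E X Y"
proof -
  let ?S = "image_mset (\<lambda>i. X i * bar (Y i)) (mset_set E)"
  have ge: "val_ge g (X i * bar (Y i))" and ld: "lead g (X i * bar (Y i)) = X' i * bar (Y' i)" if "i \<in> E" for i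
    using val_ge_mult[OF assms(1)[OF that], of "b i" "bar (Y i)"] lead_mult[OF assms(1)[OF that], of "b i" "bar (Y i)"]
      assms(2,3)[OF that] X'[OF that] Y'[OF that] by auto
  have ge': "val_ge g x" if "x \<in># ?S" for x
    using that ge by (cases "finite E") auto
  have o': "orthogonal E X' Y' \<longleftrightarrow> is_null (image_mset (lead g) ?S)"
  proof -
    have "image_mset (\<lambda>i. X' i * bar (Y' i)) (mset_set E) = image_mset (\<lambda>i. lead g (X i * bar (Y i))) (mset_set E)"
      by (cases "finite E") (auto intro: image_mset_cong simp: ld)
    then show ?thesis by (simp add: orthogonal_def multiset.map_comp comp_def)
  qed
  show "orthogonal E X Y \<Longrightarrow> orthogonal E X' Y'"
    unfolding o' using is_null_lead[of ?S g] ge' by (auto simp: orthogonal_def)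
  assume i: "finite E" "i \<in> E" "X' i \<noteq> 0" "Y' i \<noteq> 0" and o: "orthogonal E X' Y'"
  have "X i * bar (Y i) \<in># ?S" using i by simp
  moreover have "lead g (X i * bar (Y i)) \<noteq> 0" using i ld by simp
  ultimately have "is_null ?S \<longleftrightarrow> is_null (image_mset (lead g) ?S)"
    using is_null_lead_iff[of ?S g] ge' by blast
  then show "orthogonal E X Y" using o o' by (simp add: orthogonal_def)
qed

section \<open>Initial forms of a Pluecker vector with respect to weights\<close>

locale trop_plucker = plucker E r P
  for E :: "'e::linorder set" and r and P :: "'e set \<Rightarrow> ('a::tract, 'g::linordered_ab_group_add) trop_ext with_zero" +
  fixes u :: "'e \<Rightarrow> 'g"
begin

definition ip :: "'e set \<Rightarrow> 'a with_zero" where "ip = initial_plucker E r u P"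

text \<open>The level of the initial Pluecker vector. Only bases enter, so the minimum is finite and
  lies in the value group.\<close>

definition minval :: 'g where
  "minval = Min ((\<lambda>B. valuation (the_unit (P B)) - sum u B) ` {B. basis B})"

lemma finite_bases: "finite {B. basis B}"
  by (rule finite_subset[of _ "Pow E"]) (use fin in \<open>auto simp: basis_def\<close>)

lemma minval:
  assumes "I \<subseteq> E" "card I = r"
  shows "val_ge (minval + sum u I) (P I)"
proof (cases "P I" rule: with_zero_cases)
  case (2 y)
  then have "minval \<le> valuation (the_unit (P I)) - sum u I"
    unfolding minval_def using assms
    by (intro Min_le finite_imageI finite_bases image_eqI[of _ _ I]) (simp_all add: basis_def)
  then show ?thesis by (simp add: 2 algebra_simps)
qed simp

lemma minval_attained: "\<exists>B. basis B \<and> lead (minval + sum u B) (P B) \<noteq> 0"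
proof -
  have "minval \<in> (\<lambda>B. valuation (the_unit (P B)) - sum u B) ` {B. basis B}"
    unfolding minval_def using finite_bases basis_exists by (intro Min_in) auto
  then obtain B where B: "basis B" "minval = valuation (the_unit (P B)) - sum u B" by auto
  obtain y where "P B = Unit y" using B(1) nonzero_cases by (auto simp: basis_def)
  then show ?thesis using B by (intro exI[of _ B]) simp
qed

text \<open>An attained lower bound \<open>m\<close> is the minimal weight. The function
  \<open>Q\<close> is arbitrary so that the multiples of \<open>P\<close> are covered too.\<close>

lemma initial_plucker_eqI:
  assumes ge: "\<And>I. I \<subseteq> E \<Longrightarrow> card I = r \<Longrightarrow> val_ge (m + sum u I) (Q I)"
    and att: "B \<subseteq> E" "card B = r" "lead (m + sum u B) (Q B) \<noteq> 0"
  shows "initial_plucker E r u Q = (\<lambda>I\<in>subsets_of_card E r. lead (m + sum u I) (Q I))"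
proof
  fix I
  define w where "w = (\<lambda>I. map_with_infty (\<lambda>g. g - (\<Sum>i\<in>I. u i)) (val (Q I)))"
  have w: "w I = (if Q I = 0 then Infty else Fin (valuation (the_unit (Q I)) - sum u I))" for I
    by (cases "Q I" rule: with_zero_cases) (auto simp: w_def val_def zero_with_zero_def)
  have m: "Fin m \<le> w I" if "I \<subseteq> E" "card I = r" for I
    using ge[OF that] by (cases "Q I" rule: with_zero_cases) (auto simp: w algebra_simps)
  have wB: "w B = Fin m"
    using att(3) by (cases "Q B" rule: with_zero_cases) (auto simp: w split: if_splits)
  show "initial_plucker E r u Q I = (\<lambda>I\<in>subsets_of_card E r. lead (m + sum u I) (Q I)) I"
  proof (cases "I \<subseteq> E \<and> card I = r")
    case True
    have iff: "(\<forall>J\<in>subsets_of_card E r. w I \<le> w J) \<longleftrightarrow> w I = Fin m"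
      using m wB True att(1,2) by (metis (mono_tags, lifting) mem_Collect_eq order.antisym)
    have "initial_plucker E r u Q I = (if w I = Fin m then theta (Q I) else 0)"
      unfolding initial_plucker_def Let_def w_def[symmetric] using True iff by simp
    also have "\<dots> = lead (m + sum u I) (Q I)"
      by (cases "Q I" rule: with_zero_cases) (auto simp: w theta_def)
    finally show ?thesis using True by simp
  qed (auto simp: initial_plucker_def)
qed

lemma ip_apply: "I \<subseteq> E \<Longrightarrow> card I = r \<Longrightarrow> ip I = lead (minval + sum u I) (P I)"
proof -
  obtain B where "basis B" "lead (minval + sum u B) (P B) \<noteq> 0" using minval_attained by blast
  then have "ip = (\<lambda>I\<in>subsets_of_card E r. lead (minval + sum u I) (P I))"
    unfolding ip_def by (intro initial_plucker_eqI minval) (auto simp: basis_def)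
  then show "I \<subseteq> E \<Longrightarrow> card I = r \<Longrightarrow> ?thesis" by simp
qed

text \<open>Scaling raises all weights by the valuation of \<open>c\<close>, so the minimizing sets
  stay the same.\<close>

lemma initial_plucker_scale:
  "initial_plucker E r u (\<lambda>I\<in>subsets_of_card E r. Unit c * P I) =
    (\<lambda>I\<in>subsets_of_card E r. Unit (angle c) * ip I)"
proof -
  obtain B where B: "basis B" "lead (minval + sum u B) (P B) \<noteq> 0" using minval_attained by blast
  have c: "val_ge (valuation c) (Unit c)" "lead (valuation c) (Unit c) = Unit (angle c)" by simp_all
  have 1: "lead (valuation c + (minval + sum u I)) (Unit c * P I) = Unit (angle c) * lead (minval + sum u I) (P I)"
    "val_ge (valuation c + (minval + sum u I)) (Unit c * P I)"
    if "I \<subseteq> E" "card I = r" for I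
    using lead_mult[OF c(1) minval[OF that]] val_ge_mult[OF c(1) minval[OF that]] c(2) by simp_all
  have "initial_plucker E r u (\<lambda>I\<in>subsets_of_card E r. Unit c * P I) =
    (\<lambda>I\<in>subsets_of_card E r. lead (valuation c + minval + sum u I) ((\<lambda>I\<in>subsets_of_card E r. Unit c * P I) I))"
    by (rule initial_plucker_eqI[where B = B]) (use 1 B in \<open>auto simp: basis_def add.assoc\<close>)
  also have "\<dots> = (\<lambda>I\<in>subsets_of_card E r. Unit (angle c) * ip I)"
    using 1 by (auto simp: add.assoc ip_apply)
  finally show ?thesis .
qed

lemma initial_matroid_fin_mat: "initial_matroid_fin mat u = of_plucker E r ip"
proof -
  have "initial_plucker E r u ` pluckers mat = {\<lambda>I\<in>subsets_of_card E r. Unit (angle c) * ip I | c :: ('a, 'g) trop_ext. True}"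
    unfolding of_plucker_def matroid.sel setcompr_eq_image image_image initial_plucker_scale ..
  also have "\<dots> = {\<lambda>I\<in>subsets_of_card E r. Unit c * ip I | c. True}"
  proof -
    have "{F (angle c) |c :: ('a, 'g) trop_ext. True} = {F c |c. True}" for F :: "'a \<Rightarrow> 'e set \<Rightarrow> 'a with_zero"
    proof (intro subset_antisym subsetI)
      fix x assume "x \<in> {F c |c. True}"
      then obtain c where "x = F (angle (Ext c (0 :: 'g)))" by auto
      then show "x \<in> {F (angle c) |c :: ('a, 'g) trop_ext. True}" by blast
    qed blast
    from this[of "\<lambda>c. \<lambda>I\<in>subsets_of_card E r. Unit c * ip I"] show ?thesis .
  qed
  finally show ?thesis by (simp add: initial_matroid_fin_def of_plucker_def)
qed

lemma ip_plucker: "plucker E r ip"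
proof (rule plucker.intro)
  show "plucker_vector E r ip"
    unfolding plucker_vector_def
  proof (intro conjI allI impI)
    show "ip \<in> tuples (subsets_of_card E r)" by (simp add: ip_def initial_plucker_def Let_def)
    show "\<exists>B\<in>subsets_of_card E r. ip B \<noteq> 0"
      using minval_attained ip_apply by (auto simp: basis_def)
  next
    fix I J
    assume "I \<subseteq> E \<and> card I + 1 = r \<and> J \<subseteq> E \<and> card J = r + 1"
    then have I: "I \<subseteq> E" "card I + 1 = r" and J: "J \<subseteq> E" "card J = r + 1" by auto
    have f: "finite I" "finite J" using I J fin finite_subset by auto
    let ?t = "\<lambda>j. plucker_sign j I J * P (insert j I) * P (J - {j})"
    \<comment> \<open>The level of both factors together; moving \<open>j\<close> from
      \<open>J\<close> to \<open>I\<close> does not change the sum of the weights, so all terms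
      share it.\<close>
    let ?g = "minval + minval + sum u I + sum u J"
    have t: "val_ge ?g (?t j)" "lead ?g (?t j) = plucker_sign j I J * ip (insert j I) * ip (J - {j})"
      if j: "j \<in> J - I" for j
    proof -
      have 1: "insert j I \<subseteq> E" "card (insert j I) = r" "J - {j} \<subseteq> E" "card (J - {j}) = r"
        using j I J f by auto
      have 2: "val_ge (minval + sum u (insert j I)) (plucker_sign j I J * P (insert j I))"
        "lead (minval + sum u (insert j I)) (plucker_sign j I J * P (insert j I)) = plucker_sign j I J * ip (insert j I)"
        unfolding plucker_sign_def Unit_neg_one_power
        using lead_neg_power_mult[OF minval[OF 1(1,2)]] ip_apply[OF 1(1,2)] by simp_all
      have g: "?g = minval + sum u (insert j I) + (minval + sum u (J - {j}))"
        using j f by (simp add: sum_diff1 algebra_simps)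
      show "val_ge ?g (?t j)" "lead ?g (?t j) = plucker_sign j I J * ip (insert j I) * ip (J - {j})"
        unfolding g using val_ge_mult[OF 2(1) minval[OF 1(3,4)]] lead_mult[OF 2(1) minval[OF 1(3,4)]] 2(2) ip_apply[OF 1(3,4)]
        by simp_all
    qed
    have "is_null (image_mset ?t (mset_set (J - I)))" using pv I J by (simp add: plucker_vector_def)
    then have "is_null (image_mset (lead ?g) (image_mset ?t (mset_set (J - I))))"
      using t(1) f by (intro is_null_lead) auto
    moreover have "image_mset (lead ?g) (image_mset ?t (mset_set (J - I))) =
        {#plucker_sign j I J * ip (insert j I) * ip (J - {j}). j \<in># mset_set (J - I)#}"
      unfolding multiset.map_comp using t(2) f by (intro image_mset_cong) auto
    ultimately show "is_null {#plucker_sign j I J * ip (insert j I) * ip (J - {j}). j \<in># mset_set (J - I)#}" by simp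
  qed
qed (rule fin)

text \<open>The entry at \<open>i\<close> involves \<open>\<tau> - {i}\<close>, hence the level
  lowered by \<open>u i\<close>. This complements the valuation \<open>u i\<close> of a tuple paired
  with it.\<close>

lemma cvec_ip:
  assumes "\<tau> \<subseteq> E" "card \<tau> = r + 1" "i \<in> E"
  shows "val_ge (minval + sum u \<tau> - u i) (cvec E P \<tau> i)"
    "cvec E ip \<tau> i = lead (minval + sum u \<tau> - u i) (cvec E P \<tau> i)"
proof -
  have f: "finite \<tau>" using assms fin finite_subset by auto
  have "val_ge (minval + sum u \<tau> - u i) (cvec E P \<tau> i) \<and>
    cvec E ip \<tau> i = lead (minval + sum u \<tau> - u i) (cvec E P \<tau> i)"
  proof (cases "i \<in> \<tau>")
    case True
    have 1: "\<tau> - {i} \<subseteq> E" "card (\<tau> - {i}) = r" using True assms f by auto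
    have e: "minval + sum u \<tau> - u i = minval + sum u (\<tau> - {i})" using True f by (simp add: sum_diff1)
    show ?thesis unfolding e using True assms(3) lead_neg_power_mult[OF minval[OF 1]] ip_apply[OF 1]
      by (simp add: cvec_apply)
  qed (use assms(3) in \<open>simp add: cvec_apply\<close>)
  then show "val_ge (minval + sum u \<tau> - u i) (cvec E P \<tau> i)"
    "cvec E ip \<tau> i = lead (minval + sum u \<tau> - u i) (cvec E P \<tau> i)" by auto
qed

text \<open>The entry at \<open>i\<close> involves \<open>insert i I\<close>, so here
  \<open>u i\<close> is added; this complements the levels of circuit vectors.\<close>

lemma dvec_ip:
  assumes "I \<subseteq> E" "card I + 1 = r" "i \<in> E"
  shows "val_ge (minval + sum u I + u i) (dvec E P I i)"
    "dvec E ip I i = lead (minval + sum u I + u i) (dvec E P I i)"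
proof -
  have f: "finite I" using assms fin finite_subset by auto
  have "val_ge (minval + sum u I + u i) (dvec E P I i) \<and>
    dvec E ip I i = lead (minval + sum u I + u i) (dvec E P I i)"
  proof (cases "i \<in> I")
    case False
    have 1: "insert i I \<subseteq> E" "card (insert i I) = r" using False assms f by auto
    have e: "minval + sum u I + u i = minval + sum u (insert i I)" using False f by (simp add: algebra_simps)
    have m: "val_ge (minval + sum u I + u i) (bar (P (insert i I)))" unfolding e using minval[OF 1] by simp
    show ?thesis using False assms(3) lead_neg_power_mult[OF m] ip_apply[OF 1]
      by (simp add: dvec_apply e)
  qed (use assms(3) in \<open>simp add: dvec_apply\<close>)
  then show "val_ge (minval + sum u I + u i) (dvec E P I i)"
    "dvec E ip I i = lead (minval + sum u I + u i) (dvec E P I i)" by auto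
qed

lemma covec_theta:
  assumes "covec E r P Y" "\<And>i. i \<in> E \<Longrightarrow> val (Y i) = Fin (u i)"
  shows "covec E r ip (\<lambda>i. theta (Y i))"
  unfolding covec_def
proof (intro allI impI, elim conjE)
  fix \<tau> assume t: "\<tau> \<subseteq> E" "card \<tau> = r + 1"
  have Y: "val_ge (u i) (Y i)" "theta (Y i) = lead (u i) (Y i)" if "i \<in> E" for i
    using assms(2)[OF that] by (cases "Y i"; auto simp: val_def theta_def)+
  show "orthogonal E (\<lambda>i. theta (Y i)) (cvec E ip \<tau>)"
    by (rule orthogonal_lead(1)[where X = Y and Y = "cvec E P \<tau>" and a = u
          and b = "\<lambda>i. minval + sum u \<tau> - u i" and g = "minval + sum u \<tau>"])
      (use Y cvec_ip[OF t] assms(1) t in \<open>auto simp: covec_def\<close>)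
qed

text \<open>The level \<open>g\<close> is free because the lowest level of a pairing varies with
  \<open>W\<close>; it is chosen in \<open>full_support_orthogonal\<close>.\<close>

lemma vec_lead:
  assumes "vec E r P W" "\<And>i. i \<in> E \<Longrightarrow> val_ge (g - u i) (W i)"
  shows "vec E r ip (\<lambda>i. lead (g - u i) (W i))"
  unfolding vec_def
proof (intro allI impI, elim conjE)
  fix I assume I: "I \<subseteq> E" "card I + 1 = r"
  show "orthogonal E (\<lambda>i. lead (g - u i) (W i)) (dvec E ip I)"
    by (rule orthogonal_lead(1)[where X = W and Y = "dvec E P I" and a = "\<lambda>i. g - u i"
          and b = "\<lambda>i. minval + sum u I + u i" and g = "g + minval + sum u I"])
      (use assms(2) dvec_ip[OF I] assms(1) I in \<open>auto simp: vec_def algebra_simps\<close>)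
qed

end

section \<open>Perfection\<close>

lemma val_eq_Infty_iff: "val x = Infty \<longleftrightarrow> x = 0"
  by (cases x) (auto simp: val_def zero_with_zero_def)

lemma orthogonal_image:
  assumes "inj_on f E"
  shows "orthogonal (f ` E) X Y \<longleftrightarrow> orthogonal E (\<lambda>i. X (f i)) (\<lambda>i. Y (f i))"
  unfolding orthogonal_null_sum by (rule null_sum_reindex[OF assms])

section \<open>Relabelling the ground set\<close>

context plucker
begin

context
  fixes f :: "'e \<Rightarrow> 'n::linorder"
  assumes f: "strict_mono_on E f"
begin

lemma inj_f: "inj_on f E"
  using f by (rule strict_mono_on_imp_inj_on)

lemma f_less_iff: "i \<in> E \<Longrightarrow> j \<in> E \<Longrightarrow> f i < f j \<longleftrightarrow> i < j"
  using f by (rule strict_mono_on_less)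

lemma card_f_image: "I \<subseteq> E \<Longrightarrow> card (f ` I) = card I"
  using inj_f by (meson card_image inj_on_subset)

text \<open>All signs are given by counts of smaller or larger elements, so relabelling along the
  order-preserving \<open>f\<close> leaves them unchanged.\<close>

definition transport :: "'n set \<Rightarrow> 'a with_zero" where
  "transport = (\<lambda>I\<in>subsets_of_card (f ` E) r. P (inv_into E f ` I))"

lemma transport_image: "I \<subseteq> E \<Longrightarrow> card I = r \<Longrightarrow> transport (f ` I) = P I"
  using inv_into_image_cancel[OF inj_f] card_f_image by (auto simp: transport_def)

lemma card_f_filter:
  assumes "I \<subseteq> E" "j \<in> E"
  shows "card {i \<in> f ` I. i < f j} = card {i \<in> I. i < j}" "card {i \<in> f ` I. f j < i} = card {i \<in> I. j < i}"
proof -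
  have "{i \<in> f ` I. i < f j} = f ` {i \<in> I. i < j}" "{i \<in> f ` I. f j < i} = f ` {i \<in> I. j < i}"
    using assms f_less_iff by auto
  then show "card {i \<in> f ` I. i < f j} = card {i \<in> I. i < j}" "card {i \<in> f ` I. f j < i} = card {i \<in> I. j < i}"
    using card_f_image[of "{i \<in> I. i < j}"] card_f_image[of "{i \<in> I. j < i}"] assms(1) by auto
qed

lemma image_remove: "I \<subseteq> E \<Longrightarrow> j \<in> E \<Longrightarrow> f ` I - {f j} = f ` (I - {j})"
  using inj_on_image_set_diff[OF inj_f, of I "{j}"] by auto

lemma mem_f_image: "I \<subseteq> E \<Longrightarrow> j \<in> E \<Longrightarrow> f j \<in> f ` I \<longleftrightarrow> j \<in> I"
  using inj_on_image_mem_iff[OF inj_f] by blast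

lemma transport_plucker: "plucker (f ` E) r transport"
proof (rule plucker.intro)
  show "finite (f ` E)" using fin by simp
  show "plucker_vector (f ` E) r transport"
    unfolding plucker_vector_def
  proof (intro conjI allI impI)
    show "transport \<in> tuples (subsets_of_card (f ` E) r)" by (simp add: transport_def)
    obtain B where "basis B" using basis_exists by blast
    then show "\<exists>B\<in>subsets_of_card (f ` E) r. transport B \<noteq> 0"
      using transport_image[of B] card_f_image[of B] by (intro bexI[of _ "f ` B"]) (auto simp: basis_def)
  next
    fix I' J' assume "I' \<subseteq> f ` E \<and> card I' + 1 = r \<and> J' \<subseteq> f ` E \<and> card J' = r + 1"
    then obtain I J where I: "I \<subseteq> E" "I' = f ` I" "card I + 1 = r" and J: "J \<subseteq> E" "J' = f ` J" "card J = r + 1"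
      using card_f_image by (metis subset_imageE)
    have fn: "finite I" "finite J" using I J fin finite_subset by auto
    have "null_sum (\<lambda>j. plucker_sign j I J * P (insert j I) * P (J - {j})) (J - I)"
      using pv I J by (simp add: plucker_vector_def null_sum_def)
    also have "?this \<longleftrightarrow> null_sum (\<lambda>j. plucker_sign (f j) I' J' * transport (insert (f j) I') * transport (J' - {f j})) (J - I)"
    proof (rule null_sum_cong)
      fix j assume j: "j \<in> J - I"
      then have jE: "j \<in> E" using J by blast
      have "transport (insert (f j) I') = P (insert j I)"
        using transport_image[of "insert j I"] I j jE fn by simp
      moreover have "transport (J' - {f j}) = P (J - {j})"
        using transport_image[of "J - {j}"] J j fn image_remove[OF J(1) jE] by auto
      moreover have "plucker_sign (f j) I' J' = (plucker_sign j I J :: 'a with_zero)"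
        unfolding plucker_sign_def I(2) J(2) card_f_filter[OF I(1) jE] card_f_filter[OF J(1) jE] ..
      ultimately show "plucker_sign j I J * P (insert j I) * P (J - {j}) =
        plucker_sign (f j) I' J' * transport (insert (f j) I') * transport (J' - {f j})" by simp
    qed simp
    also have "\<dots> \<longleftrightarrow> null_sum (\<lambda>j. plucker_sign j I' J' * transport (insert j I') * transport (J' - {j})) (f ` (J - I))"
      by (rule null_sum_reindex[symmetric]) (use inj_f J in \<open>auto intro: inj_on_subset\<close>)
    also have "f ` (J - I) = J' - I'" unfolding I(2) J(2)
      using inj_on_image_set_diff[OF inj_f, of J I] I J by auto
    finally show "is_null {#plucker_sign j I' J' * transport (insert j I') * transport (J' - {j}). j \<in># mset_set (J' - I')#}"
      by (simp add: null_sum_def)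
  qed
qed

lemma cvec_transport:
  assumes "\<tau> \<subseteq> E" "card \<tau> = r + 1" "i \<in> E"
  shows "cvec (f ` E) transport (f ` \<tau>) (f i) = cvec E P \<tau> i"
proof -
  have "finite \<tau>" using assms fin finite_subset by auto
  then show ?thesis
    using assms transport_image[of "\<tau> - {i}"] subset_trans[OF Diff_subset, of \<tau> E "{i}"]
    by (simp add: cvec_apply mem_f_image card_f_filter image_remove)
qed

lemma dvec_transport:
  assumes "I \<subseteq> E" "card I + 1 = r" "i \<in> E"
  shows "dvec (f ` E) transport (f ` I) (f i) = dvec E P I i"
proof -
  have "finite I" using assms fin finite_subset by auto
  then show ?thesis
    using assms transport_image[of "insert i I"]
    by (simp add: dvec_apply mem_f_image card_f_filter)
qed

lemma covec_transport:
  assumes "covec E r P Y"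
  shows "covec (f ` E) r transport (\<lambda>x\<in>f ` E. Y (inv_into E f x))"
  unfolding covec_def
proof (intro allI impI, elim conjE)
  fix \<tau>' assume "\<tau>' \<subseteq> f ` E" "card \<tau>' = r + 1"
  then obtain \<tau> where t: "\<tau> \<subseteq> E" "\<tau>' = f ` \<tau>" "card \<tau> = r + 1"
    using card_f_image by (metis subset_imageE)
  then have "orthogonal E Y (cvec E P \<tau>)" using assms by (simp add: covec_def)
  also have "?this \<longleftrightarrow> orthogonal E (\<lambda>i. (\<lambda>x\<in>f ` E. Y (inv_into E f x)) (f i)) (\<lambda>i. cvec (f ` E) transport \<tau>' (f i))"
    by (rule orthogonal_cong) (use t cvec_transport inv_into_f_f[OF inj_f] in auto)
  finally show "orthogonal (f ` E) (\<lambda>x\<in>f ` E. Y (inv_into E f x)) (cvec (f ` E) transport \<tau>')"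
    by (simp only: orthogonal_image[OF inj_f])
qed

lemma vec_transport:
  assumes "vec E r P W"
  shows "vec (f ` E) r transport (\<lambda>x\<in>f ` E. W (inv_into E f x))"
  unfolding vec_def
proof (intro allI impI, elim conjE)
  fix I' assume "I' \<subseteq> f ` E" "card I' + 1 = r"
  then obtain I where I: "I \<subseteq> E" "I' = f ` I" "card I + 1 = r"
    using card_f_image by (metis subset_imageE)
  then have "orthogonal E W (dvec E P I)" using assms by (simp add: vec_def)
  also have "?this \<longleftrightarrow> orthogonal E (\<lambda>i. (\<lambda>x\<in>f ` E. W (inv_into E f x)) (f i)) (\<lambda>i. dvec (f ` E) transport I' (f i))"
    by (rule orthogonal_cong) (use I dvec_transport inv_into_f_f[OF inj_f] in auto)
  finally show "orthogonal (f ` E) (\<lambda>x\<in>f ` E. W (inv_into E f x)) (dvec (f ` E) transport I')"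
    by (simp only: orthogonal_image[OF inj_f])
qed

end

text \<open>\<open>perfect\<close> speaks of ground sets of natural numbers; numbering the elements
  of \<open>E\<close> in increasing order carries the matroid there.\<close>

lemma perfect_orthogonal:
  assumes "perfect TYPE('a)" "covec E r P Y" "vec E r P W"
  shows "orthogonal E Y W"
proof -
  define f where "f x = card {y \<in> E. y < x}" for x
  have f: "strict_mono_on E f"
    unfolding f_def by (rule strict_mono_onI, rule psubset_card_mono) (use fin in auto)
  let ?P = "transport f"
  interpret T: plucker "f ` E" r ?P by (rule transport_plucker[OF f])
  have inv: "inv_into E f (f i) = i" if "i \<in> E" for i using inv_into_f_f[OF inj_f[OF f] that] .
  let ?Y = "\<lambda>x\<in>f ` E. Y (inv_into E f x)" and ?W = "\<lambda>x\<in>f ` E. W (inv_into E f x)"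
  have "?Y \<in> covectors T.mat"
    using covec_transport[OF f assms(2)] by (simp add: covectors_of_plucker[OF T.fin])
  moreover have W: "?W \<in> vectors T.mat"
    using vec_transport[OF f assms(3)] by (simp add: vectors_of_plucker[OF T.fin T.pv])
  moreover have "perp (f ` E) (vectors T.mat) = covectors T.mat"
    using assms(1) is_matroid_of_plucker[OF T.fin T.pv] unfolding perfect_def by fastforce
  ultimately have "?Y \<in> perp (f ` E) (vectors T.mat)" by simp
  then have "orthogonal (f ` E) ?Y ?W" using W unfolding perp_def by blast
  then have "orthogonal E (\<lambda>i. ?Y (f i)) (\<lambda>i. ?W (f i))" by (simp only: orthogonal_image[OF inj_f[OF f]])
  also have "?this \<longleftrightarrow> orthogonal E Y W" by (rule orthogonal_cong) (simp_all add: inv)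
  finally show ?thesis .
qed

end

section \<open>Orthogonality recovered from leading terms\<close>

context trop_plucker
begin

lemma full_support_orthogonal:
  assumes perf: "perfect TYPE('a)" and Y: "covec E r ip (\<lambda>i. theta (Y i))"
    and val: "\<And>i. i \<in> E \<Longrightarrow> val (Y i) = Fin (u i)" and W: "vec E r P W"
  shows "orthogonal E Y W"
proof (cases "supp E W = {}")
  case False
  \<comment> \<open>On the support of \<open>W\<close> this is the valuation of the term of the
    pairing at \<open>i\<close>. Its minimum \<open>g\<close> is the level at which the pairing is
    decided, so \<open>W\<close> is cut at \<open>g - u i\<close>.\<close>
  define h where "h i = valuation (the_unit (W i)) + u i" for i
  have finS: "finite (supp E W)" using fin by (simp add: supp_def)
  define g where "g = Min (h ` supp E W)"
  have ge: "val_ge (g - u i) (W i)" if i: "i \<in> E" for i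
  proof (cases "W i" rule: with_zero_cases)
    case (2 y)
    then have "g \<le> h i" unfolding g_def using finS i by (intro Min_le) (auto simp: supp_def)
    then show ?thesis by (simp add: 2 h_def algebra_simps)
  qed simp
  have "g \<in> h ` supp E W" unfolding g_def using finS False by (intro Min_in) auto
  then obtain k where k: "k \<in> E" "W k \<noteq> 0" "g = h k" by (auto simp: supp_def)
  then have nz: "lead (g - u k) (W k) \<noteq> 0" by (auto simp: h_def elim!: nonzero_cases)
  have Y': "val_ge (u i) (Y i)" "theta (Y i) = lead (u i) (Y i)" "theta (Y i) \<noteq> 0" if "i \<in> E" for i
    using val[OF that] by (cases "Y i"; auto simp: val_def theta_def)+
  interpret I: plucker E r ip by (rule ip_plucker)
  have "orthogonal E (\<lambda>i. theta (Y i)) (\<lambda>i. lead (g - u i) (W i))"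
    by (rule I.perfect_orthogonal[OF perf Y vec_lead[OF W ge]])
  \<comment> \<open>At \<open>k\<close> the minimum is attained, so the leading term of
    \<open>W\<close> is nonzero there; that of \<open>Y\<close> is nonzero everywhere by full
    support. This permits the way back from leading terms.\<close>
  then show ?thesis
    by (rule orthogonal_lead(2)[where a = u and b = "\<lambda>i. g - u i" and g = g and i = k, rotated -1])
      (use ge Y' k(1) nz fin in auto)
qed (rule orthogonal_empty_supp)

end

text \<open>A cycle of three implications: from the matroid to its contraction, from there to the
  initial matroid, and by perfection from the initial matroid back to the start.\<close>

lemma covec_iff_contract:
  fixes P :: "'e::linorder set \<Rightarrow> ('a::tract, 'g::linordered_ab_group_add) trop_ext with_zero"
    and X :: "'e \<Rightarrow> ('a, 'g) trop_ext with_zero"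
  assumes perf: "perfect TYPE('a)" and P: "plucker E r P"
  defines "Z \<equiv> {i \<in> E. X i = 0}"
  defines "s \<equiv> plucker.contr_rank E r P Z" and "Q \<equiv> plucker.contr_plucker E r P Z"
  defines "u \<equiv> \<lambda>i\<in>E - Z. the_fin (val (X i))"
  shows "covec E r P X \<longleftrightarrow> covec (E - Z) s Q X"
    and "covec E r P X \<longleftrightarrow> covec (E - Z) s (initial_plucker (E - Z) s u Q) (\<lambda>i. theta (X i))"
proof -
  interpret plucker E r P by fact
  have Z: "Z \<subseteq> E" by (auto simp: Z_def)
  interpret N: plucker "E - Z" s Q
    unfolding s_def Q_def by (rule contr_plucker_vector[OF Z])
  interpret N: trop_plucker "E - Z" s Q u by unfold_locales
  have val: "val (X i) = Fin (u i)" if "i \<in> E - Z" for i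
    using that by (cases "X i") (auto simp: Z_def u_def val_def zero_with_zero_def)
  have 1: "covec (E - Z) s Q X" if "covec E r P X"
    unfolding s_def Q_def using covec_contr[OF Z that] by (simp add: Z_def)
  have 2: "covec (E - Z) s N.ip (\<lambda>i. theta (X i))" if "covec (E - Z) s Q X"
    using N.covec_theta[OF that val] .
  have 3: "covec E r P X" if i: "covec (E - Z) s N.ip (\<lambda>i. theta (X i))"
    unfolding covec_def
  proof (intro allI impI, elim conjE)
    fix \<tau> assume t: "\<tau> \<subseteq> E" "card \<tau> = r + 1"
    have v: "vec (E - Z) s Q (cvec E P \<tau>)"
      unfolding s_def Q_def by (rule vec_contr[OF Z vec_cvec[OF t]])
    have "orthogonal (E - Z) X (cvec E P \<tau>)"
      by (rule N.full_support_orthogonal[OF perf i val v])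
    then show "orthogonal E X (cvec E P \<tau>)"
      by (subst orthogonal_subset[OF fin, of "E - Z"]) (auto simp: Z_def)
  qed
  show "covec E r P X \<longleftrightarrow> covec (E - Z) s Q X" using 1 2 3 by blast
  show "covec E r P X \<longleftrightarrow> covec (E - Z) s (initial_plucker (E - Z) s u Q) (\<lambda>i. theta (X i))"
    using 1 2 3 unfolding N.ip_def by blast
qed

theorem theorem4:
  fixes E :: "'e::linorder set"
    and M :: "('e, ('a::tract, 'g::linordered_ab_group_add) trop_ext) matroid"
  assumes "perfect TYPE('a)"
    and "is_matroid M"
    and "ground M = E"
  shows "trop_linear_space M =
      (\<Union>A\<in>Pow E. {X \<in> tuples E. (\<forall>i\<in>A. X i = 0) \<and>
         restrict X (E - A) \<in> trop_linear_space_fin (contract M A)}) \<and>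
    trop_linear_space M = perp E (circuits M) \<and>
    trop_linear_space M =
      {X \<in> tuples E. (\<lambda>i\<in>E. theta (X i)) \<in>
         covectors (initial_matroid M (\<lambda>i\<in>E. val (X i)))} \<and>
    trop_linear_space M = (\<Inter>B\<in>bases M. span E (fundamental_cocircuits M B))"
proof (intro conjI)
  obtain r P where "plucker E r P" and M: "M = of_plucker E r P"
    using is_matroid_plucker[OF assms(2)] assms(3) by metis
  then interpret plucker E r P by simp
  have L: "trop_linear_space M = {X \<in> tuples E. covec E r P X}"
    by (simp add: trop_linear_space_def M covectors_of_plucker[OF fin])
  define Z where "Z X = {i \<in> E. X i = 0}" for X :: "'e \<Rightarrow> ('a, 'g) trop_ext with_zero"
  have Z: "Z X \<subseteq> E" for X by (auto simp: Z_def)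
  note iff = covec_iff_contract[OF assms(1) plucker_axioms, folded Z_def]
  have cov: "covectors (contract M A) = {X \<in> tuples (E - A). covec (E - A) (contr_rank A) (contr_plucker A) X}"
    if "A \<subseteq> E" for A
    unfolding M contract_mat[OF that] by (rule covectors_of_plucker) (use fin in simp)
  have restr: "restrict X (E - A) \<in> trop_linear_space_fin (contract M A) \<longleftrightarrow>
      covec (E - A) (contr_rank A) (contr_plucker A) X \<and> (\<forall>i\<in>E - A. X i \<noteq> 0)" if "A \<subseteq> E" for X A
  proof -
    have "ground (contract M A) = E - A" unfolding M contract_mat[OF that] by simp
    then show ?thesis
      unfolding trop_linear_space_fin_def trop_linear_space_def cov[OF that]
      using covec_cong[of "E - A" "restrict X (E - A)" X] by auto
  qed
  show "trop_linear_space M = (\<Union>A\<in>Pow E. {X \<in> tuples E. (\<forall>i\<in>A. X i = 0) \<and>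
         restrict X (E - A) \<in> trop_linear_space_fin (contract M A)})" (is "_ = ?R")
  proof (intro subset_antisym subsetI)
    fix X assume "X \<in> trop_linear_space M"
    then have X: "X \<in> tuples E" "covec E r P X" by (auto simp: L)
    then have "restrict X (E - Z X) \<in> trop_linear_space_fin (contract M (Z X))"
      using restr[OF Z] iff(1) by (auto simp: Z_def)
    moreover have "\<forall>i\<in>Z X. X i = 0" by (simp add: Z_def)
    ultimately show "X \<in> ?R" using X(1) Z[of X] by blast
  next
    fix X assume "X \<in> ?R"
    then obtain A where A: "A \<subseteq> E" "X \<in> tuples E" "\<forall>i\<in>A. X i = 0"
      "restrict X (E - A) \<in> trop_linear_space_fin (contract M A)" by blast
    then have c: "covec (E - A) (contr_rank A) (contr_plucker A) X" "\<forall>i\<in>E - A. X i \<noteq> 0"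
      using restr by blast+
    \<comment> \<open>The entries outside \<open>A\<close> are nonzero, so \<open>X\<close> lies
      only in the piece indexed by its own zero set.\<close>
    have "Z X = A" using A(1,3) c(2) by (auto simp: Z_def)
    then show "X \<in> trop_linear_space M" using A(2) c(1) iff(1)[of X] by (simp add: L)
  qed
  show "trop_linear_space M = perp E (circuits M)"
    by (simp add: trop_linear_space_def covectors_def assms(3))
  show "trop_linear_space M = (\<Inter>B\<in>bases M. span E (fundamental_cocircuits M B))"
    unfolding trop_linear_space_def M by (rule covectors_eq_spans)
  \<comment> \<open>The infinite coordinates of \<open>|X|\<close> are the zeros of
    \<open>X\<close>. They become coloops of the initial matroid, whose circuits vanish there, so
    the condition is one on the contraction.\<close>
  have init: "(\<lambda>i\<in>E. theta (X i)) \<in> covectors (initial_matroid M (\<lambda>i\<in>E. val (X i))) \<longleftrightarrow> covec E r P X" for X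
  proof -
    let ?s = "contr_rank (Z X)" and ?Q = "contr_plucker (Z X)"
    let ?u = "\<lambda>i\<in>E - Z X. the_fin (val (X i))"
    interpret N: plucker "E - Z X" ?s ?Q by (rule contr_plucker_vector[OF Z])
    interpret N: trop_plucker "E - Z X" ?s ?Q ?u by unfold_locales
    interpret I: plucker "E - Z X" ?s N.ip by (rule N.ip_plucker)
    have "{i \<in> ground M. (\<lambda>i\<in>E. val (X i)) i = Infty} = Z X"
      by (auto simp: Z_def assms(3) val_eq_Infty_iff)
    moreover have "(\<lambda>i\<in>ground M - Z X. the_fin ((\<lambda>i\<in>E. val (X i)) i)) = ?u"
      by (auto simp: assms(3))
    ultimately have "initial_matroid M (\<lambda>i\<in>E. val (X i)) = add_coloops I.mat (Z X)"
      unfolding initial_matroid_def Let_def by (simp add: M contract_mat[OF Z] N.initial_matroid_fin_mat)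
    moreover have Zf: "finite (Z X)" "(E - Z X) \<inter> Z X = {}" "E - Z X \<union> Z X = E"
      using Z[of X] finite_subset[OF Z fin] by auto
    ultimately have "initial_matroid M (\<lambda>i\<in>E. val (X i)) =
        of_plucker E (?s + card (Z X)) (coloop_plucker (E - Z X) ?s N.ip (Z X))"
      using I.add_coloops_mat[OF Zf(1,2)] by (simp only: Zf(3))
    then have "(\<lambda>i\<in>E. theta (X i)) \<in> covectors (initial_matroid M (\<lambda>i\<in>E. val (X i))) \<longleftrightarrow>
        covec (E - Z X) ?s N.ip (\<lambda>i\<in>E. theta (X i))"
      using covectors_of_plucker[OF fin, of "?s + card (Z X)" "coloop_plucker (E - Z X) ?s N.ip (Z X)"]
        I.covec_coloop[OF Zf(1,2), unfolded Zf(3)] by simp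
    also have "\<dots> \<longleftrightarrow> covec (E - Z X) ?s N.ip (\<lambda>i. theta (X i))" by (rule covec_cong) simp
    also have "\<dots> \<longleftrightarrow> covec E r P X" using iff(2)[of X] by (simp add: N.ip_def)
    finally show ?thesis .
  qed
  show "trop_linear_space M = {X \<in> tuples E. (\<lambda>i\<in>E. theta (X i)) \<in>
         covectors (initial_matroid M (\<lambda>i\<in>E. val (X i)))}"
    by (simp only: L init)
qed

end
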